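(* Let $\Lambda\in D^+_{p,q|n}$, and suppose $L_0(\Lambda)$ is a type-1 unitary simple $\mathfrak{k}$-module. Then $L(\Lambda)$ is unitary if and only if $$(\Lambda-\xi,\Lambda+\xi+2\rho)\le 0\qquad\text{for all }\xi\in\Pi_{\mathfrak{k}}(\Lambda).$$
   Context: Fix positive integers $p,q,n$ and put $m=p+q$. An index $a\in\{1,\dots,m+n\}$ has parity $[a]=\bar 0$ if $a\le m$ and $[a]=\bar 1$ if $a>m$. $\mathfrak{gl}_{p+q|n}=\mathfrak{gl}_{m|n}$ is the complex general linear Lie superalgebra with basis the matrix units $E_{ab}$ of parity $[a]+[b]$ and bracket $[E_{ab},E_{cd}]=\delta_{b,c}E_{ad}-(-1)^{([a]+[b])([c]+[d])}\delta_{d,a}E_{cb}$. The Cartan subalgebra is spanned by the $E_{aa}$; $\{\epsilon_a\}$ is the basis of its dual with $\epsilon_a(E_{bb})=\delta_{a,b}$, and $\delta_\mu:=\epsilon_{m+\mu}$ for $\mu=1,\dots,n$. The standard Borel subalgebra is spanned by the $E_{ab}$ with $a\le b$. The tuple $(\lambda_1,\dots,\lambda_m,\omega_1,\dots,\omega_n)$ denotes the weight $\sum_i\lambda_i\epsilon_i+\sum_\mu\omega_\mu\delta_\mu$. The symmetric bilinear form on weights is given by $(\epsilon_i,\epsilon_j)=\delta_{i,j}$, $(\epsilon_i,\delta_\mu)=0$, $(\delta_\mu,\delta_\nu)=-\delta_{\mu,\nu}$ for $i,j\le m$ and $\mu,\nu\le n$, and $\rho=\frac12\sum_{i=1}^m(m-n-2i+1)\epsilon_i+\frac12\sum_{\mu=1}^n(m+n-2\mu+1)\delta_\mu$.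 $\mathfrak{gl}_{p+q|n}=\mathfrak{k}_-\oplus\mathfrak{k}\oplus\mathfrak{k}_+$, where $\mathfrak{k}\cong\mathfrak{gl}_p\oplus\mathfrak{gl}_{q|n}$ is spanned by the $E_{ab}$ with $a,b\le p$ or $a,b>p$; $\mathfrak{k}_+$ is spanned by the $E_{ia}$ and $\mathfrak{k}_-$ by the $E_{ai}$ with $1\le i\le p<a\le m+n$. $D^+_{p,q|n}$ is the set of weights $(\lambda_1,\dots,\lambda_m,\omega_1,\dots,\omega_n)$ with all components real, $\lambda_i-\lambda_{i+1}\in\mathbb{Z}_{\ge0}$ for $i\in\{1,\dots,p-1\}\cup\{p+1,\dots,m-1\}$, and $\omega_\mu-\omega_{\mu+1}\in\mathbb{Z}_{\ge0}$ for $\mu\in\{1,\dots,n-1\}$. For $\Lambda\in D^+_{p,q|n}$, $L_0(\Lambda)$ is the simple $\mathfrak{k}$-module of highest weight $\Lambda$, with $\mathfrak{k}_+$ acting by zero; $V(\Lambda)=\mathrm{U}(\mathfrak{gl}_{p+q|n})\otimes_{\mathrm{U}(\mathfrak{k}\oplus\mathfrak{k}_+)}L_0(\Lambda)$; $L(\Lambda)$ is its unique simple quotient. $\Pi_{\mathfrak{k}}(\Lambda)$ is the set of all $\mathfrak{k}$-highest weights of $L(\Lambda)$, i.e. weights of nonzero weight vectors of $L(\Lambda)$ annihilated by all $E_{ab}\in\mathfrak{k}$ with $a<b$. All Hermitian forms are anti-linear in the first argument. A $\mathfrak{k}$-module is type-1 unitary if it carries a positive-definite Hermitian form with $\langle E_{ab}v,w\rangle=\langle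 v,E_{ba}w\rangle$ for all $E_{ab}\in\mathfrak{k}$. A $\mathfrak{gl}_{p+q|n}$-module is unitary if it carries a positive-definite Hermitian form with $\langle E_{ab}v,w\rangle=\langle v,(E_{ab})^\star w\rangle$ for all $a,b$, where $(E_{ab})^\star=E_{ba}$ if $a,b\le p$ or $a,b>p$, and $(E_{ab})^\star=-E_{ba}$ otherwise. *)

theory Defs
  imports
    "HOL-Algebra.Module"
    "HOL-Algebra.QuotRing"
    "HOL-Algebra.Algebraic_Closure_Type"
    "HOL-Library.Poly_Mapping"
    "HOL-Library.Z2"
    "HOL-Library.Complex_Order"
begin

section \<open>Indices, weights and the bilinear form\<close>

text \<open>
  Indices are the natural numbers from 1 to \<open>p + q + n\<close>, so \<open>\<epsilon>\<^sub>i\<close> has index \<open>i\<close> and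
  \<open>\<delta>\<^sub>\<mu>\<close> has index \<open>p + q + \<mu>\<close>.
\<close>

definition gl_ix :: "nat \<Rightarrow> nat \<Rightarrow> nat \<Rightarrow> (nat \<times> nat) set" where
  "gl_ix p q n = {1..p + q + n} \<times> {1..p + q + n}"

definition k_ix :: "nat \<Rightarrow> nat \<Rightarrow> nat \<Rightarrow> (nat \<times> nat) set" where
  "k_ix p q n = {(a, b) \<in> gl_ix p q n. a \<le> p \<and> b \<le> p \<or> a > p \<and> b > p}"

definition kplus_ix :: "nat \<Rightarrow> nat \<Rightarrow> nat \<Rightarrow> (nat \<times> nat) set" where
  "kplus_ix p q n = {(a, b) \<in> gl_ix p q n. a \<le> p \<and> p < b}"

definition parity :: "nat \<Rightarrow> nat \<Rightarrow> nat \<Rightarrow> bit" where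
  "parity p q a = (if a \<le> p + q then 0 else 1)"

definition minus1_pow :: "bit \<Rightarrow> 'a::ring_1" where
  "minus1_pow x = (if x = 0 then 1 else - 1)"

text \<open>
  A weight is its tuple of components; components outside the index range are 0, so that
  equality of weights is equality of functions.
\<close>

definition weights :: "nat \<Rightarrow> nat \<Rightarrow> nat \<Rightarrow> (nat \<Rightarrow> complex) set" where
  "weights p q n = {\<Lambda>. \<forall>a. a \<notin> {1..p + q + n} \<longrightarrow> \<Lambda> a = 0}"

definition bil :: "nat \<Rightarrow> nat \<Rightarrow> nat \<Rightarrow> (nat \<Rightarrow> complex) \<Rightarrow> (nat \<Rightarrow> complex) \<Rightarrow> complex" where
  "bil p q n \<Lambda> \<Lambda>' =
     (\<Sum>i = 1..p + q. \<Lambda> i * \<Lambda>' i) - (\<Sum>\<mu> = 1..n. \<Lambda> (p + q + \<mu>) * \<Lambda>' (p + q + \<mu>))"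

definition rho :: "nat \<Rightarrow> nat \<Rightarrow> nat \<Rightarrow> nat \<Rightarrow> complex" where
  "rho p q n a =
     (let m = p + q in
      if a \<in> {1..m} then (of_nat m - of_nat n - 2 * of_nat a + 1) / 2
      else if a \<in> {m + 1..m + n} then (of_nat m + of_nat n - 2 * of_nat (a - m) + 1) / 2
      else 0)"

definition D_plus :: "nat \<Rightarrow> nat \<Rightarrow> nat \<Rightarrow> (nat \<Rightarrow> complex) set" where
  "D_plus p q n = {\<Lambda> \<in> weights p q n.
     (\<forall>a. \<Lambda> a \<in> \<real>) \<and>
     (\<forall>i \<in> {1..<p} \<union> {p + 1..<p + q}. \<Lambda> i - \<Lambda> (i + 1) \<in> \<nat>) \<and>
     (\<forall>\<mu> \<in> {1..<n}. \<Lambda> (p + q + \<mu>) - \<Lambda> (p + q + \<mu> + 1) \<in> \<nat>)}"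


section \<open>Supermodules\<close>

abbreviation CC :: "complex ring" where
  "CC \<equiv> ring_of_type_algebra"

text \<open>
  A complex vector space with operators \<open>E\<^sub>a\<^sub>b\<close> and subspaces of even and odd vectors.
  The ring-theoretic fields \<open>mult\<close> and \<open>one\<close> inherited from the library record are irrelevant.
\<close>

record 'v glmod = "(complex, 'v) module" +
  act :: "nat \<Rightarrow> nat \<Rightarrow> 'v \<Rightarrow> 'v"
  grade :: "bit \<Rightarrow> 'v set"

text \<open>
  \<open>S\<close> is the set of index pairs of the matrix units spanning the Lie superalgebra
  that acts: \<open>gl_ix\<close> for \<open>\<gg>\<ll>\<close> and \<open>k_ix\<close> for \<open>\<kk>\<close>.
\<close>

definition supermodule ::
    "nat \<Rightarrow> nat \<Rightarrow> (nat \<times> nat) set \<Rightarrow> 'v glmod \<Rightarrow> bool" where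
  "supermodule p q S M \<longleftrightarrow>
     module CC M \<and>
     (\<forall>i. submodule (grade M i) CC M) \<and>
     (\<forall>v \<in> carrier M. \<exists>!(v0, v1). v0 \<in> grade M 0 \<and> v1 \<in> grade M 1 \<and> v = v0 \<oplus>\<^bsub>M\<^esub> v1) \<and>
     (\<forall>(a, b) \<in> S.
        (\<forall>v \<in> carrier M. act M a b v \<in> carrier M) \<and>
        (\<forall>v \<in> carrier M. \<forall>w \<in> carrier M.
           act M a b (v \<oplus>\<^bsub>M\<^esub> w) = act M a b v \<oplus>\<^bsub>M\<^esub> act M a b w) \<and>
        (\<forall>c. \<forall>v \<in> carrier M. act M a b (c \<odot>\<^bsub>M\<^esub> v) = c \<odot>\<^bsub>M\<^esub> act M a b v) \<and>
        (\<forall>i. \<forall>v \<in> grade M i. act M a b v \<in> grade M (parity p q a + parity p q b + i))) \<and>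
     (\<forall>(a, b) \<in> S. \<forall>(c, d) \<in> S. \<forall>v \<in> carrier M.
        let s = minus1_pow ((parity p q a + parity p q b) * (parity p q c + parity p q d)) in
        act M a b (act M c d v) \<ominus>\<^bsub>M\<^esub> s \<odot>\<^bsub>M\<^esub> act M c d (act M a b v) =
        (if b = c then act M a d v else \<zero>\<^bsub>M\<^esub>) \<ominus>\<^bsub>M\<^esub>
        s \<odot>\<^bsub>M\<^esub> (if d = a then act M c b v else \<zero>\<^bsub>M\<^esub>))"

definition subsupermodule :: "(nat \<times> nat) set \<Rightarrow> 'v glmod \<Rightarrow> 'v set \<Rightarrow> bool" where
  "subsupermodule S M N \<longleftrightarrow>
     submodule N CC M \<and>
     (\<forall>(a, b) \<in> S. \<forall>v \<in> N. act M a b v \<in> N) \<and>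
     (\<forall>v \<in> N. \<exists>v0 \<in> N \<inter> grade M 0. \<exists>v1 \<in> N \<inter> grade M 1. v = v0 \<oplus>\<^bsub>M\<^esub> v1)"

definition simple_supermodule ::
    "nat \<Rightarrow> nat \<Rightarrow> (nat \<times> nat) set \<Rightarrow> 'v glmod \<Rightarrow> bool" where
  "simple_supermodule p q S M \<longleftrightarrow>
     supermodule p q S M \<and> carrier M \<noteq> {\<zero>\<^bsub>M\<^esub>} \<and>
     (\<forall>N. subsupermodule S M N \<longrightarrow> N = {\<zero>\<^bsub>M\<^esub>} \<or> N = carrier M)"

text \<open>The operations on cosets follow the pattern of \<^const>\<open>rcoset_mult\<close> in the library.\<close>

definition quot :: "'v glmod \<Rightarrow> 'v set \<Rightarrow> 'v set glmod" where
  "quot M N = \<lparr>carrier = a_rcosets\<^bsub>M\<^esub> N, monoid.mult = undefined, one = undefined,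
     zero = N, add = set_add M,
     module.smult = (\<lambda>c A. \<Union>x\<in>A. N +>\<^bsub>M\<^esub> (c \<odot>\<^bsub>M\<^esub> x)),
     act = (\<lambda>a b A. \<Union>x\<in>A. N +>\<^bsub>M\<^esub> act M a b x),
     grade = (\<lambda>i. (\<lambda>x. N +>\<^bsub>M\<^esub> x) ` grade M i)\<rparr>"

definition k_highest_weights :: "nat \<Rightarrow> nat \<Rightarrow> nat \<Rightarrow> 'v glmod \<Rightarrow> (nat \<Rightarrow> complex) set" where
  "k_highest_weights p q n M = {\<xi> \<in> weights p q n.
     \<exists>v \<in> carrier M. v \<noteq> \<zero>\<^bsub>M\<^esub> \<and>
       (\<forall>a \<in> {1..p + q + n}. act M a a v = \<xi> a \<odot>\<^bsub>M\<^esub> v) \<and>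
       (\<forall>(a, b) \<in> k_ix p q n. a < b \<longrightarrow> act M a b v = \<zero>\<^bsub>M\<^esub>)}"


section \<open>The universal enveloping superalgebra\<close>

text \<open>
  The tensor algebra of \<open>\<gg>\<ll>\<close> is the algebra of noncommutative polynomials in the \<open>E\<^sub>a\<^sub>b\<close>,
  i.e. the monoid algebra over the free monoid of words. The wrapper type \<open>word\<close> carries
  the monoid structure (written additively, as \<open>Poly_Mapping\<close> requires).
\<close>

datatype word = Word (letters: "(nat \<times> nat) list")

instantiation word :: monoid_add
begin
definition zero_word :: word where "zero_word = Word []"
definition plus_word :: "word \<Rightarrow> word \<Rightarrow> word" where
  "plus_word u v = Word (letters u @ letters v)"
instance by standard (simp_all add: zero_word_def plus_word_def)
end

type_synonym tensor = "word \<Rightarrow>\<^sub>0 complex"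

definition word_parity :: "nat \<Rightarrow> nat \<Rightarrow> word \<Rightarrow> bit" where
  "word_parity p q w = (\<Sum>(a, b)\<leftarrow>letters w. parity p q a + parity p q b)"

definition tensor_alg :: "nat \<Rightarrow> nat \<Rightarrow> nat \<Rightarrow> tensor ring" where
  "tensor_alg p q n = ring_of_type_algebra
     \<lparr>carrier := {t. \<forall>w \<in> Poly_Mapping.keys t. set (letters w) \<subseteq> gl_ix p q n}\<rparr>"

definition gen :: "nat \<Rightarrow> nat \<Rightarrow> tensor" where
  "gen a b = Poly_Mapping.single (Word [(a, b)]) 1"

definition bracket_rels :: "nat \<Rightarrow> nat \<Rightarrow> nat \<Rightarrow> tensor set" where
  "bracket_rels p q n =
     {let s = minus1_pow ((parity p q a + parity p q b) * (parity p q c + parity p q d)) in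
      gen a b * gen c d - s * (gen c d * gen a b) -
      ((if b = c then gen a d else 0) - s * (if d = a then gen c b else 0))
      | a b c d. (a, b) \<in> gl_ix p q n \<and> (c, d) \<in> gl_ix p q n}"

definition bracket_ideal :: "nat \<Rightarrow> nat \<Rightarrow> nat \<Rightarrow> tensor set" where
  "bracket_ideal p q n = Idl\<^bsub>tensor_alg p q n\<^esub> (bracket_rels p q n)"

definition Ugl :: "nat \<Rightarrow> nat \<Rightarrow> nat \<Rightarrow> tensor set ring" where
  "Ugl p q n = tensor_alg p q n Quot bracket_ideal p q n"

definition Ucls :: "nat \<Rightarrow> nat \<Rightarrow> nat \<Rightarrow> tensor \<Rightarrow> tensor set" where
  "Ucls p q n t = bracket_ideal p q n +>\<^bsub>tensor_alg p q n\<^esub> t"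

definition Uscalar :: "nat \<Rightarrow> nat \<Rightarrow> nat \<Rightarrow> complex \<Rightarrow> tensor set" where
  "Uscalar p q n c = Ucls p q n (Poly_Mapping.single 0 c)"

definition Ugrade :: "nat \<Rightarrow> nat \<Rightarrow> nat \<Rightarrow> bit \<Rightarrow> tensor set set" where
  "Ugrade p q n i = Ucls p q n `
     {t \<in> carrier (tensor_alg p q n). \<forall>w \<in> Poly_Mapping.keys t. word_parity p q w = i}"


section \<open>The generalized Verma module\<close>

text \<open>
  \<open>U(\<gg>\<ll>) \<otimes> L\<^sub>0\<close> over \<open>U(\<kk> \<oplus> \<kk>\<^sub>+)\<close> is built in the usual way: the vector space with basis the
  symbols \<open>(u, v)\<close>, modulo the subspace generated by bilinearity and balancedness.
  Here \<open>\<gg>\<ll>\<close> acts on the symbols by left multiplication on \<open>u\<close>.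
  The degree \<open>i\<close> part is spanned by symbols of homogeneous elements of total degree \<open>i\<close>;
  it becomes a grading only after passing to the quotient.
\<close>

definition free_mod :: "nat \<Rightarrow> nat \<Rightarrow> nat \<Rightarrow> 'v glmod \<Rightarrow> ((tensor set \<times> 'v) \<Rightarrow>\<^sub>0 complex) glmod" where
  "free_mod p q n M =
     \<lparr>carrier = {x. Poly_Mapping.keys x \<subseteq> carrier (Ugl p q n) \<times> carrier M},
      monoid.mult = undefined, one = undefined, zero = 0, add = (+),
      module.smult = (\<lambda>c. Poly_Mapping.map ((*) c)),
      act = (\<lambda>a b x. \<Sum>(u, v) \<in> Poly_Mapping.keys x.
        Poly_Mapping.single (Ucls p q n (gen a b) \<otimes>\<^bsub>Ugl p q n\<^esub> u, v) (Poly_Mapping.lookup x (u, v))),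
      grade = (\<lambda>i. {x. Poly_Mapping.keys x \<subseteq> (\<Union>j. Ugrade p q n j \<times> grade M (i - j))})\<rparr>"

definition tensor_symbol :: "tensor set \<Rightarrow> 'v \<Rightarrow> ((tensor set \<times> 'v) \<Rightarrow>\<^sub>0 complex)" where
  "tensor_symbol u v = Poly_Mapping.single (u, v) 1"

definition bilinear_rels ::
    "nat \<Rightarrow> nat \<Rightarrow> nat \<Rightarrow> 'v glmod \<Rightarrow> ((tensor set \<times> 'v) \<Rightarrow>\<^sub>0 complex) set" where
  "bilinear_rels p q n M =
     {tensor_symbol (u \<oplus>\<^bsub>Ugl p q n\<^esub> u') v - tensor_symbol u v - tensor_symbol u' v | u u' v.
        u \<in> carrier (Ugl p q n) \<and> u' \<in> carrier (Ugl p q n) \<and> v \<in> carrier M} \<union>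
     {tensor_symbol u (v \<oplus>\<^bsub>M\<^esub> v') - tensor_symbol u v - tensor_symbol u v' | u v v'.
        u \<in> carrier (Ugl p q n) \<and> v \<in> carrier M \<and> v' \<in> carrier M} \<union>
     {tensor_symbol (Uscalar p q n c \<otimes>\<^bsub>Ugl p q n\<^esub> u) v - c \<odot>\<^bsub>free_mod p q n M\<^esub> tensor_symbol u v | c u v.
        u \<in> carrier (Ugl p q n) \<and> v \<in> carrier M} \<union>
     {tensor_symbol u (c \<odot>\<^bsub>M\<^esub> v) - c \<odot>\<^bsub>free_mod p q n M\<^esub> tensor_symbol u v | c u v.
        u \<in> carrier (Ugl p q n) \<and> v \<in> carrier M}"

text \<open>The \<open>\<kk>\<close>-module \<open>M\<close> is regarded as a \<open>\<kk> \<oplus> \<kk>\<^sub>+\<close>-module, with \<open>\<kk>\<^sub>+\<close> acting by zero.\<close>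

definition inflated_act :: "nat \<Rightarrow> nat \<Rightarrow> nat \<Rightarrow> 'v glmod \<Rightarrow> nat \<Rightarrow> nat \<Rightarrow> 'v \<Rightarrow> 'v" where
  "inflated_act p q n M a b v = (if (a, b) \<in> kplus_ix p q n then \<zero>\<^bsub>M\<^esub> else act M a b v)"

text \<open>
  Since the \<open>E\<^sub>a\<^sub>b\<close> in \<open>\<kk> \<oplus> \<kk>\<^sub>+\<close> generate \<open>U(\<kk> \<oplus> \<kk>\<^sub>+)\<close>, balancedness over
  this algebra amounts to balancedness for these generators.
\<close>

definition balanced_rels ::
    "nat \<Rightarrow> nat \<Rightarrow> nat \<Rightarrow> 'v glmod \<Rightarrow> ((tensor set \<times> 'v) \<Rightarrow>\<^sub>0 complex) set" where
  "balanced_rels p q n M =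
     {tensor_symbol (u \<otimes>\<^bsub>Ugl p q n\<^esub> Ucls p q n (gen a b)) v - tensor_symbol u (inflated_act p q n M a b v)
      | a b u v. (a, b) \<in> k_ix p q n \<union> kplus_ix p q n \<and>
        u \<in> carrier (Ugl p q n) \<and> v \<in> carrier M}"

definition tensor_rels ::
    "nat \<Rightarrow> nat \<Rightarrow> nat \<Rightarrow> 'v glmod \<Rightarrow> ((tensor set \<times> 'v) \<Rightarrow>\<^sub>0 complex) set" where
  "tensor_rels p q n M =
     \<Inter>{N. submodule N CC (free_mod p q n M) \<and> bilinear_rels p q n M \<union> balanced_rels p q n M \<subseteq> N}"

definition induced ::
    "nat \<Rightarrow> nat \<Rightarrow> nat \<Rightarrow> 'v glmod \<Rightarrow> ((tensor set \<times> 'v) \<Rightarrow>\<^sub>0 complex) set glmod" where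
  "induced p q n M = quot (free_mod p q n M) (tensor_rels p q n M)"


section \<open>Unitarity\<close>

text \<open>
  Anti-linearity in the first argument follows from linearity in the second one and Hermitian
  symmetry. The order on complex numbers is the one for which \<open>0 < z\<close> entails that \<open>z\<close> is real.
\<close>

definition pos_def_hermitian_form :: "'v glmod \<Rightarrow> ('v \<Rightarrow> 'v \<Rightarrow> complex) \<Rightarrow> bool" where
  "pos_def_hermitian_form M B \<longleftrightarrow>
     (\<forall>u \<in> carrier M. \<forall>v \<in> carrier M. \<forall>w \<in> carrier M. B u (v \<oplus>\<^bsub>M\<^esub> w) = B u v + B u w) \<and>
     (\<forall>u \<in> carrier M. \<forall>v \<in> carrier M. \<forall>c. B u (c \<odot>\<^bsub>M\<^esub> v) = c * B u v) \<and>
     (\<forall>u \<in> carrier M. \<forall>v \<in> carrier M. B v u = cnj (B u v)) \<and>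
     (\<forall>v \<in> carrier M. v \<noteq> \<zero>\<^bsub>M\<^esub> \<longrightarrow> 0 < B v v)"

definition type1_unitary :: "nat \<Rightarrow> nat \<Rightarrow> nat \<Rightarrow> 'v glmod \<Rightarrow> bool" where
  "type1_unitary p q n M \<longleftrightarrow>
     (\<exists>B. pos_def_hermitian_form M B \<and>
       (\<forall>(a, b) \<in> k_ix p q n. \<forall>v \<in> carrier M. \<forall>w \<in> carrier M.
          B (act M a b v) w = B v (act M b a w)))"

definition unitary :: "nat \<Rightarrow> nat \<Rightarrow> nat \<Rightarrow> 'v glmod \<Rightarrow> bool" where
  "unitary p q n M \<longleftrightarrow>
     (\<exists>B. pos_def_hermitian_form M B \<and>
       (\<forall>(a, b) \<in> gl_ix p q n. \<forall>v \<in> carrier M. \<forall>w \<in> carrier M.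
          B (act M a b v) w =
          B v (if (a, b) \<in> k_ix p q n then act M b a w else \<ominus>\<^bsub>M\<^esub> act M b a w)))"

end

theory Submission
  imports Defs "HOL-Computational_Algebra.Fundamental_Theorem_Algebra"
begin

text \<open>
  Put \<open>\<Omega> = \<Sum> E\<^sub>a\<^sub>i E\<^sub>i\<^sub>a\<close>, summed over \<open>i \<le> p < a\<close>. The Casimir operators of \<open>\<gg>\<ll>\<close> and of \<open>\<kk>\<close>
  differ by \<open>2 \<Omega>\<close> and a Cartan term, and the former acts on \<open>L(\<Lambda>)\<close> by the scalar \<open>(\<Lambda>, \<Lambda> + 2\<rho>)\<close>. Hence
  a \<open>\<kk>\<close>-highest weight vector \<open>u\<close> of weight \<open>\<xi>\<close> satisfies \<open>2 \<Omega> u = (\<Lambda> - \<xi>, \<Lambda> + \<xi> + 2\<rho>) u\<close>. For a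
  contravariant Hermitian form, \<open>\<langle>u, \<Omega> u\<rangle> = - \<Sum> \<langle>E\<^sub>i\<^sub>a u, E\<^sub>i\<^sub>a u\<rangle>\<close>. If the form is positive definite, the
  right-hand side is at most 0, and so is \<open>(\<Lambda> - \<xi>, \<Lambda> + \<xi> + 2\<rho>)\<close>: this is \<open>bil_nonpos_if_unitary\<close>.

  For the converse, a contravariant form is first constructed on \<open>L(\<Lambda>)\<close>. The module is the direct sum
  of its bottom, a copy of \<open>L\<^sub>0(\<Lambda>)\<close>, and the span \<open>Z\<close> of the nonempty words in \<open>\<kk>\<^sub>-\<close> applied to the bottom. Let
  \<open>pr\<close> be the projection to the bottom, and \<open>w\<^sup>\<star>\<close> the adjoint of a word \<open>w\<close>. The form is
  \<open>\<langle>x, w l\<rangle> = \<langle>pr (w\<^sup>\<star> x), l\<rangle>\<close>; that this depends on \<open>w l\<close> only follows from the identity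
  \<open>\<langle>l, pr (w\<^sup>\<star> l')\<rangle> = \<langle>pr (w l), l'\<rangle>\<close> for \<open>l\<close> and \<open>l'\<close> in the bottom (\<open>adjoint\<close>), which is proved by moving the letters
  from \<open>\<kk>\<^sub>-\<close> to the left. Its radical is a proper graded submodule, hence 0
  (\<open>form_nondegenerate\<close>).

  Positivity is proved weight by weight, by induction on the height of \<open>\<Lambda> - \<xi>\<close>. On the bottom the form
  is the given one. If \<open>v \<noteq> 0\<close> lies in \<open>Z\<close>, then \<open>\<langle>v, - \<Omega> v\<rangle> = \<Sum> \<langle>E\<^sub>i\<^sub>a v, E\<^sub>i\<^sub>a v\<rangle>\<close> is positive: the vectors
  \<open>E\<^sub>i\<^sub>a v\<close> have smaller height, and they do not all vanish because the form is nondegenerate. So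
  \<open>- \<Omega>\<close> is selfadjoint for a scalar product on a finite-dimensional weight space, hence
  diagonalizable, and the form is positive if the eigenvalues of \<open>- \<Omega>\<close> are. Since \<open>\<Omega>\<close> commutes with
  \<open>\<kk>\<close>, each eigenspace reaches a \<open>\<kk>\<close>-highest weight vector, on which the eigenvalue is
  \<open>- (\<Lambda> - \<xi>, \<Lambda> + \<xi> + 2\<rho>) / 2\<close>, and this is nonnegative by hypothesis and nonzero by definiteness
  (\<open>form_pos_Z\<close>, \<open>form_pos\<close>).

  These arguments are carried out for operators on a vector space type. The second half of the
  theory realizes the quotient of the generalized Verma module in such a type and identifies its
  bottom with \<open>L\<^sub>0(\<Lambda>)\<close>.
\<close>

section \<open>Eigenvectors and Hermitian forms\<close>

text \<open>
  The scalars are complex so that every operator with an annihilating polynomial has eigenvectors.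
\<close>

locale complex_space = vector_space scale
  for scale :: "complex \<Rightarrow> 'v::ab_group_add \<Rightarrow> 'v" (infixr "*s" 75)
begin

text \<open>
  Induction on \<open>G\<close>: the operator \<open>D - \<mu>\<close> kills one of the generators, preserves the span of the others,
  and multiplies \<open>v\<close> by \<open>l - \<mu> \<noteq> 0\<close>.
\<close>

lemma eigenvector_in_finite_span_of_others_is_zero:
  assumes "Vector_Spaces.linear scale scale D"
    and "finite G" and "\<And>g. g \<in> G \<Longrightarrow> \<exists>\<mu>. \<mu> \<noteq> l \<and> D g = \<mu> *s g"
    and "v \<in> span G" and "D v = l *s v"
  shows "v = 0"
  using assms(2-)
proof (induction G arbitrary: v rule: finite_induct)
  case empty
  then show ?case by simp
next
  case (insert g G)
  interpret D: Vector_Spaces.linear scale scale D by fact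
  from insert.prems(1) obtain \<mu> where \<mu>: "\<mu> \<noteq> l" "D g = \<mu> *s g" by blast
  from insert.prems(2) obtain k where k: "v - k *s g \<in> span G"
    by (auto simp: span_breakdown_eq)
  have stable: "D w \<in> span G" if "w \<in> span G" for w
    using that
  proof (induction rule: span_induct_alt)
    case base
    then show ?case by (simp add: span_zero)
  next
    case (step c x y)
    then obtain \<nu> where "D x = \<nu> *s x" using insert.prems(1)[of x] by auto
    then have "c *s D x \<in> span G"
      using step.hyps(1) by (simp add: span_scale span_base)
    with step show ?case by (simp add: D.add D.scale span_add)
  qed
  have "D (v - k *s g) - \<mu> *s (v - k *s g) \<in> span G"
    by (rule span_diff[OF stable[OF k] span_scale[OF k]])
  also have "D (v - k *s g) - \<mu> *s (v - k *s g) = (l - \<mu>) *s v"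
    using insert.prems \<mu> by (simp add: D.diff D.scale algebra_simps)
  finally have "(l - \<mu>) *s v = 0"
    using insert.prems by (intro insert.IH) (auto simp: D.scale mult.commute)
  with \<mu> show ?case by simp
qed

lemma eigenvector_in_span_of_others_is_zero:
  assumes D: "Vector_Spaces.linear scale scale D"
    and G: "\<And>g. g \<in> G \<Longrightarrow> \<exists>\<mu>. \<mu> \<noteq> l \<and> D g = \<mu> *s g"
    and v: "v \<in> span G" "D v = l *s v"
  shows "v = 0"
proof -
  from v(1) obtain T r where T: "finite T" "T \<subseteq> G" "v = (\<Sum>a\<in>T. r a *s a)"
    unfolding span_explicit by blast
  from T(3) have "v \<in> span T"
    using span_sum[of T "\<lambda>a. r a *s a" T] span_scale span_base by metis
  then show ?thesis
    using eigenvector_in_finite_span_of_others_is_zero[OF D T(1), of l v] T(2) G v(2) by blast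
qed

text \<open>
  The components with other eigenvalues add up to an eigenvector for \<open>l\<close>, which is 0 by the previous
  lemma. Eigenvalues are attached to indices because the zero vector has every eigenvalue.
\<close>

lemma eigenvector_in_span_of_eigenvectors:
  assumes D: "Vector_Spaces.linear scale scale D"
    and f: "\<And>i. i \<in> W \<Longrightarrow> D (f i) = e i *s f i"
    and v: "v \<in> span (f ` W)" "D v = l *s v"
  shows "v \<in> span (f ` {i \<in> W. e i = l})"
proof -
  interpret D: Vector_Spaces.linear scale scale D by fact
  have "f ` W = f ` {i \<in> W. e i = l} \<union> f ` {i \<in> W. e i \<noteq> l}" by auto
  with v(1) obtain x y where xy: "v = x + y" "x \<in> span (f ` {i \<in> W. e i = l})"
    "y \<in> span (f ` {i \<in> W. e i \<noteq> l})"
    using span_Un[of "f ` {i \<in> W. e i = l}" "f ` {i \<in> W. e i \<noteq> l}"] by auto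
  have "D x = l *s x"
    using xy(2)
  proof (induction rule: span_induct_alt)
    case (step c a b)
    then show ?case using f by (auto simp: D.add D.scale algebra_simps)
  qed simp
  then have "D y = l *s y"
    using v(2) xy(1) by (simp add: D.add algebra_simps)
  then have "y = 0"
    using xy(3) f by (intro eigenvector_in_span_of_others_is_zero[OF D, of "f ` {i \<in> W. e i \<noteq> l}"]) auto
  with xy show ?thesis by simp
qed

definition poly_op :: "complex poly \<Rightarrow> ('v \<Rightarrow> 'v) \<Rightarrow> 'v \<Rightarrow> 'v" where
  "poly_op P T v = (\<Sum>i\<le>degree P. scale (coeff P i) ((T ^^ i) v))"

lemma poly_op_eq:
  fixes P :: "complex poly"
  shows "degree P \<le> N \<Longrightarrow> poly_op P T v = (\<Sum>i\<le>N. scale (coeff P i) ((T ^^ i) v))"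
  unfolding poly_op_def by (intro sum.mono_neutral_left) (auto simp: coeff_eq_0)

lemma poly_op_linear_factor:
  assumes "Vector_Spaces.linear scale scale T"
  shows "poly_op ([:- \<mu>, 1:] * Q) T v = poly_op Q T (T v - scale \<mu> v)"
proof -
  interpret T: Vector_Spaces.linear scale scale T by fact
  define N where "N = degree Q"
  have pow: "(T ^^ i) (x - y) = (T ^^ i) x - (T ^^ i) y" "(T ^^ i) (scale c x) = scale c ((T ^^ i) x)" for i c x y
    by (induction i) (auto simp: T.diff T.scale)
  have deg: "degree ([:- \<mu>, 1:] * Q) \<le> Suc N"
    using degree_mult_le[of "[:- \<mu>, 1:]" Q] by (simp add: N_def)
  have "poly_op Q T (T v - scale \<mu> v) =
      (\<Sum>i\<le>N. scale (coeff Q i) ((T ^^ Suc i) v)) - (\<Sum>i\<le>N. scale (\<mu> * coeff Q i) ((T ^^ i) v))"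
    unfolding poly_op_def N_def
    by (simp add: pow sum_subtractf scale_right_diff_distrib funpow_swap1 mult.commute)
  also have "(\<Sum>i\<le>N. scale (coeff Q i) ((T ^^ Suc i) v))
      = (\<Sum>i\<le>Suc N. scale (coeff (pCons 0 Q) i) ((T ^^ i) v))"
    by (subst sum.atMost_Suc_shift) simp
  also have "(\<Sum>i\<le>N. scale (\<mu> * coeff Q i) ((T ^^ i) v)) = (\<Sum>i\<le>Suc N. scale (\<mu> * coeff Q i) ((T ^^ i) v))"
    by (simp add: coeff_eq_0 N_def)
  also have "(\<Sum>i\<le>Suc N. scale (coeff (pCons 0 Q) i) ((T ^^ i) v)) - \<dots>
      = (\<Sum>i\<le>Suc N. scale (coeff ([:- \<mu>, 1:] * Q) i) ((T ^^ i) v))"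
    unfolding sum_subtractf[symmetric]
    by (intro sum.cong refl) (simp add: scale_left_diff_distrib[symmetric])
  also have "\<dots> = poly_op ([:- \<mu>, 1:] * Q) T v"
    using poly_op_eq[OF deg] by simp
  finally show ?thesis by simp
qed

text \<open>
  More iterates than the dimension are linearly dependent. Dependence speaks of the set of iterates,
  so two equal iterates have to be treated separately.
\<close>

lemma finite_dim_annihilating_poly:
  assumes "finite A" and "\<And>i. (T ^^ i) v \<in> span A"
  shows "\<exists>P. P \<noteq> 0 \<and> poly_op P T v = 0"
proof -
  define N where "N = card A"
  show ?thesis
  proof (cases "inj_on (\<lambda>i. (T ^^ i) v) {..N}")
    case False
    then obtain i j where ij: "i < j" "(T ^^ i) v = (T ^^ j) v"
      unfolding inj_on_def by (metis linorder_neqE_nat)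
    define P where "P = monom (1::complex) j - monom 1 i"
    have "coeff P j = 1" using ij by (simp add: P_def)
    moreover have "degree P \<le> j"
      unfolding P_def using ij by (intro degree_diff_le) (auto simp: degree_monom_le intro: order.trans[OF degree_monom_le])
    moreover have "(\<Sum>k\<le>j. scale (coeff P k) ((T ^^ k) v)) = 0"
    proof -
      have "scale (coeff P k) ((T ^^ k) v) =
          (if k = j then (T ^^ j) v else 0) - (if k = i then (T ^^ i) v else 0)" for k
        using ij by (auto simp: P_def)
      then show ?thesis using ij by (simp add: sum_subtractf)
    qed
    ultimately show ?thesis by (intro exI[of _ P]) (auto simp: poly_op_eq)
  next
    case True
    let ?B = "(\<lambda>i. (T ^^ i) v) ` {..N}"
    have "card ?B = Suc N" using True by (simp add: card_image)
    then have "dependent ?B"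
      using independent_span_bound[OF assms(1), of ?B] assms(2) by (auto simp: N_def)
    then obtain t u where tu: "finite t" "t \<subseteq> ?B" "(\<Sum>w\<in>t. scale (u w) w) = 0" "\<exists>w\<in>t. u w \<noteq> 0"
      unfolding dependent_explicit by blast
    define c where "c i = (if i \<le> N \<and> (T ^^ i) v \<in> t then u ((T ^^ i) v) else 0)" for i
    define P where "P = Abs_poly c"
    have cP: "coeff P = c"
      unfolding P_def
      by (rule Abs_poly_inverse) (auto simp: c_def eventually_cofinite intro: finite_subset[of _ "{..N}"])
    have "degree P \<le> N"
      by (rule degree_le) (auto simp: cP c_def)
    then have "poly_op P T v = (\<Sum>i\<le>N. scale (c i) ((T ^^ i) v))"
      by (simp add: poly_op_eq cP)
    also have "\<dots> = (\<Sum>w\<in>?B. scale (if w \<in> t then u w else 0) w)"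
      by (subst sum.reindex[OF True]) (auto simp: c_def intro!: sum.cong)
    also have "\<dots> = (\<Sum>w\<in>t. scale (u w) w)"
      using tu by (intro sum.mono_neutral_cong_right) auto
    finally have "poly_op P T v = 0" using tu by simp
    moreover have "P \<noteq> 0"
    proof
      assume "P = 0"
      then have "c i = 0" for i using cP by (metis coeff_0)
      moreover obtain i where "i \<le> N" "(T ^^ i) v \<in> t" "u ((T ^^ i) v) \<noteq> 0"
        using tu(2,4) by blast
      ultimately show False unfolding c_def by (metis (full_types))
    qed
    ultimately show ?thesis by blast
  qed
qed

end

text \<open>
  The form is controlled on the subspace \<open>L\<close>; its values elsewhere are arbitrary.
\<close>

locale hermitian_form = complex_space scale
  for scale :: "complex \<Rightarrow> 'v::ab_group_add \<Rightarrow> 'v" (infixr "*s" 75) +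
  fixes L :: "'v set" and form :: "'v \<Rightarrow> 'v \<Rightarrow> complex"
  assumes subspace_L: "subspace L"
    and form_add: "\<lbrakk>u \<in> L; v \<in> L; w \<in> L\<rbrakk> \<Longrightarrow> form u (v + w) = form u v + form u w"
    and form_scale: "\<lbrakk>u \<in> L; v \<in> L\<rbrakk> \<Longrightarrow> form u (k *s v) = k * form u v"
    and form_herm: "\<lbrakk>u \<in> L; v \<in> L\<rbrakk> \<Longrightarrow> form v u = cnj (form u v)"
begin

lemma L_closed [simp, intro]:
  "0 \<in> L" "u \<in> L \<Longrightarrow> v \<in> L \<Longrightarrow> u + v \<in> L" "u \<in> L \<Longrightarrow> v \<in> L \<Longrightarrow> u - v \<in> L" "u \<in> L \<Longrightarrow> k *s u \<in> L"
  "u \<in> L \<Longrightarrow> - u \<in> L"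
  "(\<And>i. i \<in> A \<Longrightarrow> f i \<in> L) \<Longrightarrow> sum f A \<in> L"
  using subspace_L by (auto simp: subspace_0 subspace_add subspace_diff subspace_scale subspace_neg subspace_sum)

lemma form_add_left: "\<lbrakk>u \<in> L; v \<in> L; w \<in> L\<rbrakk> \<Longrightarrow> form (v + w) u = form v u + form w u"
  using form_herm[of u "v + w"] form_herm[of u v] form_herm[of u w] by (simp add: form_add)

lemma form_scale_left: "\<lbrakk>u \<in> L; v \<in> L\<rbrakk> \<Longrightarrow> form (k *s v) u = cnj k * form v u"
  using form_herm[of u "k *s v"] form_herm[of u v] by (simp add: form_scale)

lemma form_zero [simp]: "u \<in> L \<Longrightarrow> form u 0 = 0" "u \<in> L \<Longrightarrow> form 0 u = 0"
  using form_scale[of u 0 0] form_scale_left[of u 0 0] by auto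

lemma form_minus [simp]: "\<lbrakk>u \<in> L; v \<in> L\<rbrakk> \<Longrightarrow> form u (- v) = - form u v"
  "\<lbrakk>u \<in> L; v \<in> L\<rbrakk> \<Longrightarrow> form (- v) u = - form v u"
  using form_scale[of u v "-1"] form_scale_left[of u v "-1"] by auto

lemma form_diff: "\<lbrakk>u \<in> L; v \<in> L; w \<in> L\<rbrakk> \<Longrightarrow> form u (v - w) = form u v - form u w"
  using form_add[of u v "- w"] by simp

lemma form_diff_left: "\<lbrakk>u \<in> L; v \<in> L; w \<in> L\<rbrakk> \<Longrightarrow> form (v - w) u = form v u - form w u"
  using form_add_left[of u v "- w"] by simp

lemma form_sum: "\<lbrakk>u \<in> L; \<And>i. i \<in> A \<Longrightarrow> f i \<in> L\<rbrakk> \<Longrightarrow> form u (sum f A) = (\<Sum>i\<in>A. form u (f i))"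
  by (induction A rule: infinite_finite_induct) (auto simp: form_add)

lemma form_sum_left: "\<lbrakk>u \<in> L; \<And>i. i \<in> A \<Longrightarrow> f i \<in> L\<rbrakk> \<Longrightarrow> form (sum f A) u = (\<Sum>i\<in>A. form (f i) u)"
  by (induction A rule: infinite_finite_induct) (auto simp: form_add_left)

text \<open>
  Pythagoras: \<open>form v v\<close> is the sum of its values on the components of \<open>v\<close>.
\<close>

lemma pos_on_orthogonal_sum:
  assumes V: "\<And>i. subspace (V i)" "\<And>i. V i \<subseteq> L"
    and orth: "\<And>i j x y. i \<noteq> j \<Longrightarrow> x \<in> V i \<Longrightarrow> y \<in> V j \<Longrightarrow> form x y = 0"
    and pos: "\<And>i x. x \<in> V i \<Longrightarrow> x \<noteq> 0 \<Longrightarrow> 0 < form x x"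
    and v: "v \<in> span (\<Union>i. V i)" "v \<noteq> 0"
  shows "0 < form v v"
proof -
  have "\<exists>J f. finite J \<and> (\<forall>i. f i \<in> V i) \<and> v = (\<Sum>i\<in>J. f i)"
    using v(1)
  proof (induction rule: span_induct_alt)
    case base
    show ?case by (rule exI[of _ "{}"], rule exI[of _ "\<lambda>_. 0"]) (auto simp: V subspace_0)
  next
    case (step c x y)
    then obtain J f j where *: "finite J" "\<forall>i. f i \<in> V i" "y = (\<Sum>i\<in>J. f i)" "x \<in> V j" by auto
    have "y = (\<Sum>i\<in>insert j J. (if i \<in> J then f i else 0))"
      using * by (subst sum.mono_neutral_cong_right[of "insert j J" J _ f]) auto
    then have "c *s x + y = (\<Sum>i\<in>insert j J. (if i \<in> J then f i else 0) + (if i = j then c *s x else 0))"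
      using * by (simp add: sum.distrib insert_absorb add.commute)
    then show ?case
      using * V(1) by (intro exI[of _ "insert j J"]
          exI[of _ "\<lambda>i. (if i \<in> J then f i else 0) + (if i = j then c *s x else 0)"])
        (auto simp: subspace_add subspace_scale subspace_0)
  qed
  then obtain J f where f: "finite J" "\<And>i. f i \<in> V i" "v = (\<Sum>i\<in>J. f i)" by blast
  have fL: "f i \<in> L" for i using f(2) V(2) by blast
  have "form v v = (\<Sum>i\<in>J. \<Sum>j\<in>J. form (f i) (f j))"
    unfolding f(3) by (subst sum.swap) (simp add: form_sum form_sum_left fL)
  also have "\<dots> = (\<Sum>i\<in>J. \<Sum>j\<in>J. if j = i then form (f i) (f i) else 0)"
    using orth[OF _ f(2) f(2)] by (intro sum.cong refl) auto
  also have "\<dots> = (\<Sum>i\<in>J. form (f i) (f i))"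
    using f(1) by simp
  finally have eq: "form v v = (\<Sum>i\<in>J. form (f i) (f i))" .
  obtain j where j: "j \<in> J" "f j \<noteq> 0"
    using v(2) f(3) by (metis sum.neutral)
  have nonneg: "0 \<le> form (f i) (f i)" for i
    using pos[OF f(2)[of i]] fL[of i] by (cases "f i = 0") (auto simp: less_imp_le)
  have "0 < (\<Sum>i\<in>J. form (f i) (f i))"
    using f(1) j pos[OF f(2)[of j] j(2)] nonneg by (intro sum_pos2[of J j]) auto
  with eq show ?thesis by simp
qed

text \<open>
  The form \<open>(u, v) \<mapsto> form u (T v)\<close> is a scalar product on \<open>S\<close> for which \<open>T\<close> is selfadjoint. So \<open>S\<close> is the
  sum of the eigenspaces of \<open>T\<close>, which are orthogonal for \<open>form\<close>, and on the eigenspace of \<open>\<mu>\<close> the form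
  is \<open>1 / \<mu>\<close> times that scalar product.
\<close>

lemma pos_if_selfadjoint_eigenvalues_pos:
  assumes T: "Vector_Spaces.linear scale scale T"
    and S: "subspace S" "S \<subseteq> L" "\<And>v. v \<in> S \<Longrightarrow> T v \<in> S"
    and adj: "\<And>u v. u \<in> S \<Longrightarrow> v \<in> S \<Longrightarrow> form (T u) v = form u (T v)"
    and posT: "\<And>v. v \<in> S \<Longrightarrow> v \<noteq> 0 \<Longrightarrow> 0 < form v (T v)"
    and eig: "\<And>v \<mu>. v \<in> S \<Longrightarrow> v \<noteq> 0 \<Longrightarrow> T v = \<mu> *s v \<Longrightarrow> 0 < \<mu>"
    and fin: "finite A" "S \<subseteq> span A"
    and v: "v \<in> S" "v \<noteq> 0"
  shows "0 < form v v"
proof -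
  interpret T: Vector_Spaces.linear scale scale T by fact
  note [simp, intro] = subspace_0[OF S(1)] subspace_add[OF S(1)] subspace_diff[OF S(1)]
    subspace_scale[OF S(1)] S(3)
  have SL: "v \<in> S \<Longrightarrow> v \<in> L" for v using S(2) by blast
  define Eig where "Eig \<mu> = {v \<in> S. T v = \<mu> *s v}" for \<mu>
  have sub: "subspace (Eig \<mu>)" for \<mu>
    unfolding Eig_def by (rule subspaceI) (auto simp: T.add T.scale algebra_simps)
  have EigS: "u \<in> S" if "u \<in> span (\<Union>\<mu>. Eig \<mu>)" for u
    using that span_minimal[OF _ S(1), of "\<Union>\<mu>. Eig \<mu>"] by (auto simp: Eig_def)
  have real: "cnj \<mu> = \<mu>" if "u \<in> Eig \<mu>" "u \<noteq> 0" for u \<mu>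
    using eig[of u \<mu>] that by (auto simp: Eig_def less_complex_def complex_eq_iff)
  \<comment> \<open>the form \<open>(u, v) \<mapsto> form u (T v)\<close> is definite and \<open>T\<close> is selfadjoint for it\<close>
  have semisimple: "T u = \<mu> *s u" if u: "u \<in> S" "T (T u - \<mu> *s u) = \<mu> *s (T u - \<mu> *s u)" for u \<mu>
  proof (rule ccontr)
    define w where "w = T u - \<mu> *s u"
    assume "T u \<noteq> \<mu> *s u"
    then have w: "w \<noteq> 0" "w \<in> S" "T w = \<mu> *s w" "w \<in> Eig \<mu>"
      using u by (auto simp: w_def Eig_def)
    have "form w (T w) = \<mu> * form (T u - \<mu> *s u) w"
      using w by (simp add: form_scale SL flip: w_def)
    also have "form (T u - \<mu> *s u) w = form u (T w) - \<mu> * form u w"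
      using w u real[OF w(4,1)] adj[OF u(1) w(2)] by (simp add: form_diff_left form_scale_left SL)
    also have "\<dots> = 0" using w u by (simp add: form_scale SL)
    finally show False using posT[OF w(2,1)] by simp
  qed
  have diag: "v \<in> span (\<Union>\<mu>. Eig \<mu>)" if "P \<noteq> 0" "poly_op P T v = 0" "v \<in> S" for P v
    using that
  proof (induction "degree P" arbitrary: P v)
    case 0
    then obtain k where "P = [:k:]" by (metis degree_eq_zeroE)
    with 0 show ?case by (auto simp: poly_op_def span_zero)
  next
    case (Suc d)
    have "\<not> constant (poly P)" using Suc.hyps(2) by (simp add: constant_degree)
    then obtain \<mu> where "poly P \<mu> = 0" using fundamental_theorem_of_algebra by blast
    then obtain Q where Q: "P = [:- \<mu>, 1:] * Q" by (auto simp: poly_eq_0_iff_dvd dvd_def)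
    have "Q \<noteq> 0" using Q Suc by auto
    then have "degree P = Suc (degree Q)" unfolding Q by (subst degree_mult_eq) auto
    moreover have "poly_op Q T (T v - \<mu> *s v) = 0"
      using Suc.prems(2) unfolding Q poly_op_linear_factor[OF T] .
    ultimately have "T v - \<mu> *s v \<in> span (\<Union>\<mu>. Eig \<mu>)"
      using Suc.hyps(2) Suc.prems(3) \<open>Q \<noteq> 0\<close> by (intro Suc.hyps(1)[of Q]) auto
    then have "\<exists>y \<in> span (\<Union>\<mu>. Eig \<mu>). (T v - \<mu> *s v) - (T y - \<mu> *s y) \<in> Eig \<mu>"
    proof (induction rule: span_induct_alt)
      case base
      show ?case by (rule bexI[of _ 0]) (auto simp: span_zero sub subspace_0)
    next
      case (step c x z)
      then obtain y \<nu> where y: "y \<in> span (\<Union>\<mu>. Eig \<mu>)" "z - (T y - \<mu> *s y) \<in> Eig \<mu>"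
        "x \<in> Eig \<nu>" by auto
      show ?case
      proof (cases "\<nu> = \<mu>")
        case True
        have "(c *s x + z) - (T y - \<mu> *s y) = c *s x + (z - (T y - \<mu> *s y))" by simp
        then show ?thesis using y True sub by (metis subspace_add subspace_scale)
      next
        case False
        then obtain k where k: "k * (\<nu> - \<mu>) = c"
          by (metis eq_iff_diff_eq_0 nonzero_divide_eq_eq)
        \<comment> \<open>\<open>T - \<mu>\<close> acts on \<open>x\<close> by \<open>\<nu> - \<mu> \<noteq> 0\<close>, so a multiple of \<open>x\<close> is a preimage of \<open>c *s x\<close>\<close>
        define y' where "y' = k *s x + y"
        have "T x = \<nu> *s x" using y by (simp add: Eig_def)
        then have "T y' - \<mu> *s y' = (k * (\<nu> - \<mu>)) *s x + (T y - \<mu> *s y)"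
          by (simp add: y'_def T.add T.scale algebra_simps)
        also note k
        finally have "(c *s x + z) - (T y' - \<mu> *s y') = z - (T y - \<mu> *s y)" by simp
        moreover have "y' \<in> span (\<Union>\<mu>. Eig \<mu>)"
          using y unfolding y'_def by (intro span_add span_scale) (auto intro: span_base)
        ultimately show ?thesis by (metis y(2))
      qed
    qed
    then obtain y where y: "y \<in> span (\<Union>\<mu>. Eig \<mu>)" "(T v - \<mu> *s v) - (T y - \<mu> *s y) \<in> Eig \<mu>" by blast
    have "(T v - \<mu> *s v) - (T y - \<mu> *s y) = T (v - y) - \<mu> *s (v - y)"
      by (simp add: T.diff scale_right_diff_distrib)
    with y(2) have "T (v - y) - \<mu> *s (v - y) \<in> Eig \<mu>" by simp
    then have e: "T (T (v - y) - \<mu> *s (v - y)) = \<mu> *s (T (v - y) - \<mu> *s (v - y))"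
      unfolding Eig_def by blast
    have "v - y \<in> S" by (rule subspace_diff[OF S(1) Suc.prems(3) EigS[OF y(1)]])
    from semisimple[OF this e] have "T (v - y) = \<mu> *s (v - y)" .
    with \<open>v - y \<in> S\<close> have "v - y \<in> span (\<Union>\<mu>. Eig \<mu>)"
      unfolding Eig_def by (intro span_base) blast
    from span_add[OF this y(1)] show ?case by simp
  qed
  have "(T ^^ i) v \<in> S" for i by (induction i) (use v in auto)
  then obtain P where "P \<noteq> 0" "poly_op P T v = 0"
    using finite_dim_annihilating_poly[OF fin(1), of T v] fin(2) by blast
  then have "v \<in> span (\<Union>\<mu>. Eig \<mu>)" using diag v by blast
  then show ?thesis
  proof (rule pos_on_orthogonal_sum[rotated 4])
    fix \<mu> \<nu> x y assume *: "\<mu> \<noteq> \<nu>" "x \<in> Eig \<mu>" "y \<in> Eig \<nu>"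
    then have "cnj \<mu> * form x y = \<nu> * form x y"
      using adj[of x y] by (auto simp: Eig_def form_scale form_scale_left SL)
    then show "form x y = 0" using real[OF *(2)] * SL by (cases "x = 0") (auto simp: Eig_def)
  next
    fix \<mu> x assume *: "x \<in> Eig \<mu>" "x \<noteq> 0"
    then have "0 < \<mu>" "0 < \<mu> * form x x"
      using eig[of x \<mu>] posT[of x] by (auto simp: Eig_def form_scale SL)
    then show "0 < form x x"
      by (auto simp: less_complex_def zero_less_mult_iff)
  qed (use sub v in \<open>auto simp: Eig_def SL\<close>)
qed

end

section \<open>Signs and the Weyl vector\<close>

lemma minus1_pow_square [simp]: "minus1_pow x * minus1_pow x = (1 :: complex)"
  by (simp add: minus1_pow_def)

lemma sum_parity_sign:
  "(\<Sum>b = 1..k. minus1_pow (parity p q b) :: complex)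
     = (if k \<le> p + q then of_nat k else 2 * of_nat (p + q) - of_nat k)"
proof (induction k)
  case (Suc k)
  then show ?case
    by (cases "k = p + q") (auto simp: minus1_pow_def parity_def)
qed simp

text \<open>
  This is the coefficient with which \<open>E\<^sub>a\<^sub>a\<close> appears when the Casimir operator is written with raising
  operators on the right.
\<close>

lemma two_rho_eq_sign_sums:
  assumes "a \<in> {1..p + q + n}"
  shows "(\<Sum>b \<in> {1..p + q + n}. if a < b then minus1_pow (parity p q b) else 0)
     - (\<Sum>b \<in> {1..p + q + n}. if b < a then minus1_pow (parity p q b) else 0)
     = minus1_pow (parity p q a) * (2 * rho p q n a)"
proof -
  let ?s = "\<lambda>b. minus1_pow (parity p q b) :: complex"
  have "(\<Sum>b \<in> {1..p + q + n}. if a < b then ?s b else 0) = (\<Sum>b \<in> {1..p + q + n} - {1..a}. ?s b)"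
    by (rule sum.mono_neutral_cong_right) auto
  also have "\<dots> = (\<Sum>b = 1..p + q + n. ?s b) - (\<Sum>b = 1..a. ?s b)"
    using assms by (intro sum_diff) auto
  finally have 1: "(\<Sum>b \<in> {1..p + q + n}. if a < b then ?s b else 0) = \<dots>" .
  have 2: "(\<Sum>b \<in> {1..p + q + n}. if b < a then ?s b else 0) = (\<Sum>b = 1..a - 1. ?s b)"
    using assms by (intro sum.mono_neutral_cong_right) auto
  have total: "(\<Sum>b = 1..p + q + n. ?s b) = of_nat (p + q) - of_nat n"
    unfolding sum_parity_sign by (cases "n = 0") simp_all
  show ?thesis
  proof (cases "a \<le> p + q")
    case True
    with assms have "(\<Sum>b = 1..a. ?s b) = of_nat a" "(\<Sum>b = 1..a - 1. ?s b) = of_nat a - 1"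
      unfolding sum_parity_sign by (auto simp: of_nat_diff)
    moreover have "?s a = 1" "2 * rho p q n a = of_nat (p + q) - of_nat n - 2 * of_nat a + 1"
      using True assms by (simp_all add: minus1_pow_def parity_def rho_def Let_def)
    ultimately show ?thesis unfolding 1 2 total by simp
  next
    case False
    then obtain \<mu> where \<mu>: "a = p + q + Suc \<mu>"
      using less_imp_Suc_add[of "p + q" a] by auto
    have "(\<Sum>b = 1..a. ?s b) = of_nat (p + q) - of_nat (Suc \<mu>)"
      "(\<Sum>b = 1..a - 1. ?s b) = of_nat (p + q) - of_nat \<mu>"
      unfolding sum_parity_sign \<mu> by (cases "\<mu> = 0"; simp)+
    moreover have "?s a = - 1" "2 * rho p q n a = of_nat (p + q) + of_nat n - 2 * of_nat (Suc \<mu>) + 1"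
      using assms unfolding \<mu> by (simp_all add: minus1_pow_def parity_def rho_def Let_def)
    ultimately show ?thesis unfolding 1 2 total by simp
  qed
qed

lemma bil_eq_signed_sum:
  "bil p q n x y = (\<Sum>a \<in> {1..p + q + n}. minus1_pow (parity p q a) * (x a * y a))"
proof -
  let ?t = "\<lambda>a. minus1_pow (parity p q a) * (x a * y a)"
  have "sum ?t {1..p + q + n} = sum ?t {1..p + q} + sum ?t {p + q + 1..p + q + n}"
    by (subst sum.union_disjoint[symmetric]) (auto intro: arg_cong[where f = "sum ?t"])
  also have "sum ?t {p + q + 1..p + q + n} = (\<Sum>\<mu> = 1..n. ?t (p + q + \<mu>))"
    by (rule sum.reindex_bij_witness[of _ "\<lambda>\<mu>. p + q + \<mu>" "\<lambda>a. a - (p + q)"]) auto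
  finally show ?thesis
    by (simp add: bil_def minus1_pow_def parity_def sum_negf)
qed


section \<open>Operators satisfying the relations of the general linear superalgebra\<close>

text \<open>
  The relations hold on the whole type, without conditions on the vector; modules enter as subspaces.
\<close>

locale gl_operators = complex_space scale
  for scale :: "complex \<Rightarrow> 'v::ab_group_add \<Rightarrow> 'v" (infixr "*s" 75) +
  fixes p q n :: nat and E :: "nat \<Rightarrow> nat \<Rightarrow> 'v \<Rightarrow> 'v"
  assumes E_add: "E a b (v + w) = E a b v + E a b w"
    and E_scale: "E a b (k *s v) = k *s E a b v"
    and E_bracket: "\<lbrakk>(a, b) \<in> gl_ix p q n; (c, d) \<in> gl_ix p q n\<rbrakk> \<Longrightarrow>
      E a b (E c d v) =
        minus1_pow ((parity p q a + parity p q b) * (parity p q c + parity p q d)) *s E c d (E a b v)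
        + (if b = c then E a d v else 0)
        - minus1_pow ((parity p q a + parity p q b) * (parity p q c + parity p q d))
          *s (if d = a then E c b v else 0)"
begin

abbreviation ix :: "nat set" where "ix \<equiv> {1..p + q + n}"

abbreviation sgn_of :: "nat \<Rightarrow> complex" where "sgn_of a \<equiv> minus1_pow (parity p q a)"

abbreviation sgn4 :: "nat \<Rightarrow> nat \<Rightarrow> nat \<Rightarrow> nat \<Rightarrow> complex" where
  "sgn4 a b c d \<equiv> minus1_pow ((parity p q a + parity p q b) * (parity p q c + parity p q d))"

lemma linear_E: "Vector_Spaces.linear scale scale (E a b)"
  unfolding Vector_Spaces.linear_iff using vector_space_axioms by (auto simp: E_add E_scale)

lemma E_zero [simp]: "E a b 0 = 0"
  using E_scale[of a b 0 0] by simp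

lemma E_minus [simp]: "E a b (- v) = - E a b v"
  using E_scale[of a b "-1" v] by simp

lemma E_diff: "E a b (v - w) = E a b v - E a b w"
  using E_add[of a b v "- w"] by simp

lemma E_sum: "E a b (sum f A) = (\<Sum>i\<in>A. E a b (f i))"
  by (induction A rule: infinite_finite_induct) (auto simp: E_add)

lemma E_in_span:
  assumes "v \<in> span G" and "\<And>g. g \<in> G \<Longrightarrow> E a b g \<in> N" and "subspace N"
  shows "E a b v \<in> N"
  using assms(1)
proof (induction rule: span_induct_alt)
  case (step c x y)
  then show ?case using assms(2)[of x] assms(3) by (simp add: E_add E_scale subspace_add subspace_scale)
qed (use assms(3) in \<open>simp add: subspace_0\<close>)

lemma E_diag:
  assumes "c \<in> ix" "(a, b) \<in> gl_ix p q n"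
  shows "E c c (E a b v) = E a b (E c c v) + (if c = a then E a b v else 0) - (if c = b then E a b v else 0)"
proof -
  have "parity p q c + parity p q c = 0"
    by (cases "parity p q c") auto
  then show ?thesis
    using E_bracket[of c c a b v] assms by (auto simp: minus1_pow_def gl_ix_def)
qed

fun act_word :: "(nat \<times> nat) list \<Rightarrow> 'v \<Rightarrow> 'v" where
  "act_word [] v = v"
| "act_word ((a, b) # w) v = E a b (act_word w v)"

lemma act_word_append: "act_word (w @ w') v = act_word w (act_word w' v)"
  by (induction w) auto

lemma act_word_add: "act_word w (u + v) = act_word w u + act_word w v"
  and act_word_scale: "act_word w (k *s v) = k *s act_word w v"
  by (induction w) (auto simp: E_add E_scale)

lemma act_word_zero [simp]: "act_word w 0 = 0"
  using act_word_scale[of w 0 0] by simp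

lemma act_word_diff: "act_word w (u - v) = act_word w u - act_word w v"
  using act_word_add[of w "u - v" v] by (simp add: algebra_simps)

definition words_on :: "(nat \<times> nat) set \<Rightarrow> 'v set \<Rightarrow> 'v set" where
  "words_on S G = {act_word w y | w y. w \<in> lists S \<and> y \<in> G}"

lemma words_onI: "w \<in> lists S \<Longrightarrow> y \<in> G \<Longrightarrow> act_word w y \<in> words_on S G"
  unfolding words_on_def by blast

lemma span_words_on_letter_stable:
  assumes "v \<in> span (words_on S G)" and "(a, b) \<in> S"
  shows "E a b v \<in> span (words_on S G)"
proof (rule E_in_span[OF assms(1)])
  fix g assume "g \<in> words_on S G"
  then obtain w y where "w \<in> lists S" "y \<in> G" "g = act_word w y"
    unfolding words_on_def by blast
  then show "E a b g \<in> span (words_on S G)"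
    using words_onI[of "(a, b) # w" S y G] assms(2) by (auto intro: span_base)
qed simp

text \<open>
  A letter outside \<open>S\<close> is moved to the right, where it meets an element of \<open>G\<close>; the brackets that
  appear on the way act on shorter words.
\<close>

lemma span_words_on_stable:
  assumes S: "S \<subseteq> gl_ix p q n"
    and G: "\<And>a b y. (a, b) \<in> gl_ix p q n - S \<Longrightarrow> y \<in> G \<Longrightarrow> E a b y \<in> span G"
    and v: "v \<in> span (words_on S G)" and ab: "(a, b) \<in> gl_ix p q n"
  shows "E a b v \<in> span (words_on S G)"
proof (rule E_in_span[OF v])
  have G_sub: "span G \<subseteq> span (words_on S G)"
    using words_onI[of "[]" S _ G] by (intro span_mono) auto
  have "E a b (act_word w y) \<in> span (words_on S G)"
    if "w \<in> lists S" "y \<in> G" "(a, b) \<in> gl_ix p q n" for w y a b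
    using that
  proof (induction w arbitrary: a b rule: list.induct)
    case Nil
    show ?case
    proof (cases "(a, b) \<in> S")
      case True
      then show ?thesis
        using Nil words_onI[of "[(a, b)]" S y G] by (auto intro: span_base)
    next
      case False
      then show ?thesis using Nil G[of a b y] G_sub by auto
    qed
  next
    case (Cons cd w)
    obtain c d where cd: "cd = (c, d)" by force
    with Cons.prems(1) have cdS: "(c, d) \<in> S" "w \<in> lists S" by simp_all
    with S have cd_ix: "(c, d) \<in> gl_ix p q n" by blast
    have ix: "(a, d) \<in> gl_ix p q n" "(c, b) \<in> gl_ix p q n"
      using cd_ix Cons.prems(3) by (auto simp: gl_ix_def)
    have "E c d (E a b (act_word w y)) \<in> span (words_on S G)"
      by (rule span_words_on_letter_stable[OF Cons.IH[OF cdS(2) Cons.prems(2,3)] cdS(1)])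
    moreover have "E a d (act_word w y) \<in> span (words_on S G)" "E c b (act_word w y) \<in> span (words_on S G)"
      using Cons.IH[OF cdS(2) Cons.prems(2)] ix by auto
    ultimately show ?case
      unfolding cd act_word.simps E_bracket[OF Cons.prems(3) cd_ix]
      by (intro span_diff[OF span_add] span_scale) (simp_all add: span_zero)
  qed
  then show "E a b g \<in> span (words_on S G)" if "g \<in> words_on S G" for g
    using that ab unfolding words_on_def by auto
qed simp

text \<open>
  The Casimir operator and its part \<open>\<Omega>\<close> between \<open>\<kk>\<^sub>-\<close> and \<open>\<kk>\<^sub>+\<close> are of this form, for different ranges of
  indices.
\<close>

definition quadratic :: "nat set \<Rightarrow> nat set \<Rightarrow> 'v \<Rightarrow> 'v" where
  "quadratic A B v = (\<Sum>a\<in>A. \<Sum>b\<in>B. sgn_of b *s E a b (E b a v))"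

text \<open>
  Moving \<open>E\<^sub>c\<^sub>d\<close> through a summand produces four further terms. After summation they cancel in pairs, if
  neither \<open>A\<close> nor \<open>B\<close> separates \<open>c\<close> from \<open>d\<close>.
\<close>

lemma quadratic_commutes:
  assumes AB: "A \<subseteq> ix" "B \<subseteq> ix" and cd: "(c, d) \<in> gl_ix p q n"
    and A: "c \<in> A \<longleftrightarrow> d \<in> A" and B: "c \<in> B \<longleftrightarrow> d \<in> B"
  shows "E c d (quadratic A B v) = quadratic A B (E c d v)"
proof -
  have fin: "finite A" "finite B" using AB by (auto intro: finite_subset)
  have delta1: "(\<Sum>a\<in>A. \<Sum>b\<in>B. if x = a then f a b else 0) = (if x \<in> A then \<Sum>b\<in>B. f x b else 0)"
    for x and f :: "nat \<Rightarrow> nat \<Rightarrow> 'v"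
  proof -
    have "(\<Sum>b\<in>B. if x = a then f a b else 0) = (if x = a then \<Sum>b\<in>B. f a b else 0)" for a by auto
    then show ?thesis using fin by simp
  qed
  have delta2: "(\<Sum>a\<in>A. \<Sum>b\<in>B. if x = b then f a b else 0) = (if x \<in> B then \<Sum>a\<in>A. f a x else 0)"
    for x and f :: "nat \<Rightarrow> nat \<Rightarrow> 'v"
    using fin by (cases "x \<in> B") auto
  have sgn1: "sgn4 c d a b * sgn4 c d b a = 1" for a b
    by (metis add.commute minus1_pow_square)
  have sgn2: "sgn_of c * sgn4 c d a c = sgn_of d * sgn4 c d a d" for a
    by (auto simp: minus1_pow_def parity_def)
  have summand: "sgn_of b *s E c d (E a b (E b a v)) = sgn_of b *s E a b (E b a (E c d v))
      + (if d = a then sgn_of b *s E c b (E b d v) else 0)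
      - (if c = b then (sgn_of c * sgn4 c d a c) *s E a d (E c a v) else 0)
      + (if d = b then (sgn_of d * sgn4 c d a d) *s E a d (E c a v) else 0)
      - (if c = a then sgn_of b *s E c b (E b d v) else 0)"
    if "a \<in> A" "b \<in> B" for a b
  proof -
    have ix: "(a, b) \<in> gl_ix p q n" "(b, a) \<in> gl_ix p q n"
      using that AB by (auto simp: gl_ix_def)
    have s: "sgn4 c d b a = sgn4 c d a b" by (metis add.commute)
    show ?thesis
      unfolding E_bracket[OF cd ix(1)] E_bracket[OF cd ix(2)] s
      by (auto simp: E_add E_diff E_scale algebra_simps s)
  qed
  have "E c d (quadratic A B v) = (\<Sum>a\<in>A. \<Sum>b\<in>B. sgn_of b *s E c d (E a b (E b a v)))"
    by (simp add: quadratic_def E_sum E_scale)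
  also have "\<dots> = (\<Sum>a\<in>A. \<Sum>b\<in>B. sgn_of b *s E a b (E b a (E c d v))
      + (if d = a then sgn_of b *s E c b (E b d v) else 0)
      - (if c = b then (sgn_of c * sgn4 c d a c) *s E a d (E c a v) else 0)
      + (if d = b then (sgn_of d * sgn4 c d a d) *s E a d (E c a v) else 0)
      - (if c = a then sgn_of b *s E c b (E b d v) else 0))"
    by (intro sum.cong refl summand)
  also have "\<dots> = quadratic A B (E c d v)
      + (if d \<in> A then \<Sum>b\<in>B. sgn_of b *s E c b (E b d v) else 0)
      - (if c \<in> B then \<Sum>a\<in>A. (sgn_of c * sgn4 c d a c) *s E a d (E c a v) else 0)
      + (if d \<in> B then \<Sum>a\<in>A. (sgn_of d * sgn4 c d a d) *s E a d (E c a v) else 0)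
      - (if c \<in> A then \<Sum>b\<in>B. sgn_of b *s E c b (E b d v) else 0)"
    by (simp only: sum.distrib sum_subtractf quadratic_def delta1 delta2)
  also have "\<dots> = quadratic A B (E c d v)"
    by (simp only: A B sgn2) simp
  finally show ?thesis .
qed

definition cas :: "'v \<Rightarrow> 'v" where "cas = quadratic ix ix"

definition Om :: "'v \<Rightarrow> 'v" where "Om = quadratic {p + 1..p + q + n} {1..p}"

lemma Om_eq: "Om v = (\<Sum>a = p + 1..p + q + n. \<Sum>i = 1..p. E a i (E i a v))"
  by (simp add: Om_def quadratic_def minus1_pow_def parity_def)

lemma quadratic_linear: "quadratic A B (u + v) = quadratic A B u + quadratic A B v"
  "quadratic A B (k *s v) = k *s quadratic A B v"
  by (simp_all add: quadratic_def E_add E_scale scale_right_distrib sum.distrib scale_sum_right mult.commute)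

lemma linear_Om: "Vector_Spaces.linear scale scale Om"
  unfolding Vector_Spaces.linear_iff Om_def using vector_space_axioms by (auto simp: quadratic_linear)

lemma cas_commutes: "(c, d) \<in> gl_ix p q n \<Longrightarrow> E c d (cas v) = cas (E c d v)"
  unfolding cas_def by (rule quadratic_commutes) (auto simp: gl_ix_def)

lemma Om_commutes: "(c, d) \<in> k_ix p q n \<Longrightarrow> E c d (Om v) = Om (E c d v)"
  unfolding Om_def by (rule quadratic_commutes) (auto simp: gl_ix_def k_ix_def)

text \<open>
  For \<open>a < b\<close> the product \<open>E\<^sub>a\<^sub>b E\<^sub>b\<^sub>a\<close> is reordered into \<open>E\<^sub>b\<^sub>a E\<^sub>a\<^sub>b\<close> plus Cartan terms, which add up to the
  contribution of \<open>2\<rho>\<close>. The products with \<open>E\<^sub>a\<^sub>b\<close> in \<open>\<kk>\<close> kill \<open>u\<close>; those with \<open>E\<^sub>a\<^sub>b\<close> in \<open>\<kk>\<^sub>+\<close> appear twice.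
\<close>

lemma cas_on_k_highest_weight_vector:
  assumes wt: "\<And>a. a \<in> ix \<Longrightarrow> E a a u = \<xi> a *s u"
    and high: "\<And>a b. (a, b) \<in> k_ix p q n \<Longrightarrow> a < b \<Longrightarrow> E a b u = 0"
  shows "cas u = bil p q n \<xi> (\<lambda>a. \<xi> a + 2 * rho p q n a) *s u + 2 *s Om u"
proof -
  \<comment> \<open>\<open>W a b\<close> is the summand of \<open>\<Omega> u\<close>, and \<open>k a b\<close> the scalar left over by the reordering\<close>
  define W where "W a b = (if b \<le> p \<and> p < a then E a b (E b a u) else 0)" for a b
  define k where "k a b = (if a = b then sgn_of a * (\<xi> a * \<xi> a) else 0)
    + ((if a < b then sgn_of b * \<xi> a else 0) - (if a < b then sgn_of a * \<xi> b else 0))" for a b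
  have summand: "sgn_of b *s E a b (E b a u) = W a b + W b a + k a b *s u"
    if ab: "a \<in> ix" "b \<in> ix" for a b
  proof -
    have low: "sgn_of b *s E a b (E b a u) = W a b" if "b < a" "a \<in> ix" "b \<in> ix" for a b
    proof (cases "b \<le> p \<and> p < a")
      case True
      then show ?thesis using that by (auto simp: W_def minus1_pow_def parity_def)
    next
      case False
      then have "(b, a) \<in> k_ix p q n" using that by (auto simp: k_ix_def gl_ix_def)
      then show ?thesis using that high False by (auto simp: W_def)
    qed
    consider "a = b" | "b < a" | "a < b" by linarith
    then show ?thesis
    proof cases
      case 1
      then show ?thesis using wt[OF ab(1)] by (auto simp: W_def k_def E_scale)
    next
      case 2
      then show ?thesis using low[of b a] ab by (auto simp: W_def k_def)
    next
      case 3
      have "sgn4 a b b a = sgn_of a * sgn_of b"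
        by (auto simp: minus1_pow_def parity_def)
      then have "E a b (E b a u) = (sgn_of a * sgn_of b) *s E b a (E a b u) + \<xi> a *s u
          - (sgn_of a * sgn_of b) *s (\<xi> b *s u)"
        using E_bracket[of a b b a u] ab wt by (simp add: gl_ix_def)
      then have "sgn_of b *s E a b (E b a u) = (sgn_of b * (sgn_of a * sgn_of b)) *s E b a (E a b u)
          + (sgn_of b * \<xi> a) *s u - (sgn_of b * (sgn_of a * sgn_of b) * \<xi> b) *s u"
        by (simp add: scale_right_diff_distrib scale_right_distrib mult.assoc)
      also have "sgn_of b * (sgn_of a * sgn_of b) = sgn_of a"
        by (simp add: minus1_pow_def)
      also have "sgn_of a *s E b a (E a b u) = W b a"
        using low[of a b] 3 ab by simp
      finally show ?thesis using 3 by (auto simp: W_def k_def algebra_simps)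
    qed
  qed
  have W: "(\<Sum>a\<in>ix. \<Sum>b\<in>ix. W a b) = Om u"
  proof -
    have "(\<Sum>b\<in>ix. W a b) = (if p < a then \<Sum>b = 1..p. E a b (E b a u) else 0)" for a
      by (auto simp: W_def intro!: sum.mono_neutral_cong_right sum.neutral)
    then have "(\<Sum>a\<in>ix. \<Sum>b\<in>ix. W a b) = (\<Sum>a\<in>ix. if p < a then \<Sum>b = 1..p. E a b (E b a u) else 0)"
      by (simp only:)
    also have "\<dots> = Om u"
      unfolding Om_eq by (intro sum.mono_neutral_cong_right) auto
    finally show ?thesis .
  qed
  have "cas u = (\<Sum>a\<in>ix. \<Sum>b\<in>ix. W a b) + (\<Sum>a\<in>ix. \<Sum>b\<in>ix. W b a) + (\<Sum>a\<in>ix. \<Sum>b\<in>ix. k a b *s u)"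
    unfolding cas_def quadratic_def by (simp add: summand sum.distrib)
  also have "(\<Sum>a\<in>ix. \<Sum>b\<in>ix. W b a) = (\<Sum>a\<in>ix. \<Sum>b\<in>ix. W a b)"
    by (rule sum.swap)
  also have "(\<Sum>a\<in>ix. \<Sum>b\<in>ix. k a b *s u) = (\<Sum>a\<in>ix. \<Sum>b\<in>ix. k a b) *s u"
    by (simp add: scale_sum_left)
  also have "(\<Sum>a\<in>ix. \<Sum>b\<in>ix. k a b) = bil p q n \<xi> (\<lambda>a. \<xi> a + 2 * rho p q n a)"
  proof -
    have "(\<Sum>a\<in>ix. \<Sum>b\<in>ix. k a b) = (\<Sum>a\<in>ix. \<Sum>b\<in>ix. if a = b then sgn_of a * (\<xi> a * \<xi> a) else 0)
       + ((\<Sum>a\<in>ix. \<Sum>b\<in>ix. if a < b then sgn_of b * \<xi> a else 0)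
       - (\<Sum>a\<in>ix. \<Sum>b\<in>ix. if a < b then sgn_of a * \<xi> b else 0))"
      by (simp add: k_def sum.distrib sum_subtractf del: sum.delta sum.delta')
    also have "(\<Sum>a\<in>ix. \<Sum>b\<in>ix. if a < b then sgn_of a * \<xi> b else 0)
        = (\<Sum>a\<in>ix. \<Sum>b\<in>ix. if b < a then sgn_of b * \<xi> a else 0)"
      by (rule sum.swap)
    also have "(\<Sum>a\<in>ix. \<Sum>b\<in>ix. if a = b then sgn_of a * (\<xi> a * \<xi> a) else 0)
        = (\<Sum>a\<in>ix. sgn_of a * (\<xi> a * \<xi> a))"
      by (intro sum.cong refl) (subst sum.delta', auto)
    also have "(\<Sum>a\<in>ix. \<Sum>b\<in>ix. if a < b then sgn_of b * \<xi> a else 0)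
       - (\<Sum>a\<in>ix. \<Sum>b\<in>ix. if b < a then sgn_of b * \<xi> a else 0)
       = (\<Sum>a\<in>ix. \<xi> a * ((\<Sum>b\<in>ix. if a < b then sgn_of b else 0) - (\<Sum>b\<in>ix. if b < a then sgn_of b else 0)))"
      by (simp add: sum_distrib_left right_diff_distrib sum_subtractf if_distrib mult.commute cong: if_cong)
    also have "\<dots> = (\<Sum>a\<in>ix. \<xi> a * (sgn_of a * (2 * rho p q n a)))"
      by (intro sum.cong refl) (subst two_rho_eq_sign_sums, assumption, rule refl)
    also have "(\<Sum>a\<in>ix. sgn_of a * (\<xi> a * \<xi> a)) + \<dots> = bil p q n \<xi> (\<lambda>a. \<xi> a + 2 * rho p q n a)"
      unfolding bil_eq_signed_sum sum.distrib[symmetric] by (intro sum.cong refl) (simp add: algebra_simps)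
    finally show ?thesis .
  qed
  also have "(\<Sum>a\<in>ix. \<Sum>b\<in>ix. W a b) + (\<Sum>a\<in>ix. \<Sum>b\<in>ix. W a b) = 2 *s Om u"
    using scale_left_distrib[of 1 1 "Om u"] unfolding W by simp
  finally show ?thesis by (simp only: add.commute)
qed

end

section \<open>Weights, degrees and heights\<close>

text \<open>
  Here \<open>L\<close> is the simple module and \<open>M\<close> its bottom, a simple \<open>\<kk>\<close>-module killed by \<open>\<kk>\<^sub>+\<close>. The involution \<open>\<gamma>\<close> is 1
  on even and -1 on odd vectors, so that graded subspaces are the ones stable under \<open>\<gamma>\<close>.
\<close>

locale simple_hw_module = gl_operators scale p q n E
  for scale :: "complex \<Rightarrow> 'v::ab_group_add \<Rightarrow> 'v" (infixr "*s" 75)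
    and p q n :: nat and E :: "nat \<Rightarrow> nat \<Rightarrow> 'v \<Rightarrow> 'v" +
  fixes \<gamma> :: "'v \<Rightarrow> 'v" and L M :: "'v set" and \<Lambda> :: "nat \<Rightarrow> complex" and vac :: 'v
  assumes \<gamma>_add: "\<gamma> (v + w) = \<gamma> v + \<gamma> w" and \<gamma>_scale: "\<gamma> (k *s v) = k *s \<gamma> v"
    and \<gamma>_\<gamma>: "v \<in> L \<Longrightarrow> \<gamma> (\<gamma> v) = v"
    and E_\<gamma>: "(a, b) \<in> gl_ix p q n \<Longrightarrow>
      E a b (\<gamma> v) = minus1_pow (parity p q a + parity p q b) *s \<gamma> (E a b v)"
    and subspace_L: "subspace L"
    and E_L: "(a, b) \<in> gl_ix p q n \<Longrightarrow> v \<in> L \<Longrightarrow> E a b v \<in> L"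
    and \<gamma>_L: "v \<in> L \<Longrightarrow> \<gamma> v \<in> L"
    and simple_L: "\<lbrakk>subspace N; N \<subseteq> L; \<And>a b v. (a, b) \<in> gl_ix p q n \<Longrightarrow> v \<in> N \<Longrightarrow> E a b v \<in> N;
        \<And>v. v \<in> N \<Longrightarrow> \<gamma> v \<in> N\<rbrakk> \<Longrightarrow> N = {0} \<or> N = L"
    and subspace_M: "subspace M" and M_L: "M \<subseteq> L"
    and k_M: "(a, b) \<in> k_ix p q n \<Longrightarrow> v \<in> M \<Longrightarrow> E a b v \<in> M"
    and kplus_M: "(a, b) \<in> kplus_ix p q n \<Longrightarrow> v \<in> M \<Longrightarrow> E a b v = 0"
    and \<gamma>_M: "v \<in> M \<Longrightarrow> \<gamma> v \<in> M"
    and simple_M: "\<lbrakk>subspace N; N \<subseteq> M; \<And>a b v. (a, b) \<in> k_ix p q n \<Longrightarrow> v \<in> N \<Longrightarrow> E a b v \<in> N;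
        \<And>v. v \<in> N \<Longrightarrow> \<gamma> v \<in> N\<rbrakk> \<Longrightarrow> N = {0} \<or> N = M"
    and \<Lambda>_weight: "\<Lambda> \<in> weights p q n"
    and vac: "vac \<in> M" "vac \<noteq> 0"
    and vac_weight: "a \<in> ix \<Longrightarrow> E a a vac = \<Lambda> a *s vac"
    and vac_high: "(a, b) \<in> k_ix p q n \<Longrightarrow> a < b \<Longrightarrow> E a b vac = 0"
begin

definition kminus_ix :: "(nat \<times> nat) set" where
  "kminus_ix = {(a, b) \<in> gl_ix p q n. p < a \<and> b \<le> p}"

definition lower_ix :: "(nat \<times> nat) set" where
  "lower_ix = {(a, b) \<in> gl_ix p q n. b < a}"

lemma gl_ix_cases:
  assumes "(a, b) \<in> gl_ix p q n"
  obtains "(a, b) \<in> k_ix p q n" | "(a, b) \<in> kplus_ix p q n" | "(a, b) \<in> kminus_ix"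
  using assms unfolding k_ix_def kplus_ix_def kminus_ix_def by fastforce

lemma ix_sub: "k_ix p q n \<subseteq> gl_ix p q n" "kplus_ix p q n \<subseteq> gl_ix p q n" "kminus_ix \<subseteq> gl_ix p q n"
  "lower_ix \<subseteq> gl_ix p q n"
  unfolding k_ix_def kplus_ix_def kminus_ix_def lower_ix_def by auto

lemma k_in_gl: "(a, b) \<in> k_ix p q n \<Longrightarrow> (a, b) \<in> gl_ix p q n"
  and kminus_in_gl: "(a, b) \<in> kminus_ix \<Longrightarrow> (a, b) \<in> gl_ix p q n"
  using ix_sub by auto

lemma diag_in_k: "a \<in> ix \<Longrightarrow> (a, a) \<in> k_ix p q n"
  by (auto simp: k_ix_def gl_ix_def)

lemma M_in_L: "v \<in> M \<Longrightarrow> v \<in> L"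
  using M_L by blast

lemma act_word_L: "w \<in> lists (gl_ix p q n) \<Longrightarrow> v \<in> L \<Longrightarrow> act_word w v \<in> L"
  by (induction w rule: list.induct) (auto intro: E_L)

lemma words_on_L: "S \<subseteq> gl_ix p q n \<Longrightarrow> G \<subseteq> L \<Longrightarrow> words_on S G \<subseteq> L"
  unfolding words_on_def using act_word_L lists_mono[of S "gl_ix p q n"] by blast

lemma \<gamma>_zero [simp]: "\<gamma> 0 = 0"
  using \<gamma>_scale[of 0 0] by simp

lemma \<gamma>_E: "(a, b) \<in> gl_ix p q n \<Longrightarrow>
    \<gamma> (E a b v) = minus1_pow (parity p q a + parity p q b) *s E a b (\<gamma> v)"
  by (simp add: E_\<gamma>)

lemma act_word_\<gamma>:
  assumes "w \<in> lists (gl_ix p q n)"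
  shows "\<exists>s. \<gamma> (act_word w v) = s *s act_word w (\<gamma> v)"
  using assms
proof (induction w rule: list.induct)
  case Nil
  then show ?case by (intro exI[of _ 1]) simp
next
  case (Cons ab w)
  obtain a b where ab: "ab = (a, b)" by force
  with Cons.prems have gl: "(a, b) \<in> gl_ix p q n" and w: "w \<in> lists (gl_ix p q n)" by simp_all
  from Cons.IH[OF w] obtain s where "\<gamma> (act_word w v) = s *s act_word w (\<gamma> v)" by blast
  then have "\<gamma> (act_word (ab # w) v) =
      (minus1_pow (parity p q a + parity p q b) * s) *s act_word (ab # w) (\<gamma> v)"
    using gl by (simp add: ab \<gamma>_E E_scale)
  then show ?case by blast
qed

lemma \<gamma>_in_span:
  assumes "v \<in> span G" and "\<And>g. g \<in> G \<Longrightarrow> \<gamma> g \<in> N" and "subspace N"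
  shows "\<gamma> v \<in> N"
  using assms(1)
proof (induction rule: span_induct_alt)
  case (step c x y)
  then show ?case using assms(2)[of x] assms(3) by (simp add: \<gamma>_add \<gamma>_scale subspace_add subspace_scale)
qed (use assms(3) in \<open>simp add: subspace_0\<close>)

lemma \<gamma>_words_on:
  assumes S: "S \<subseteq> gl_ix p q n" and G: "\<And>y. y \<in> G \<Longrightarrow> \<gamma> y \<in> G" and v: "v \<in> span (words_on S G)"
  shows "\<gamma> v \<in> span (words_on S G)"
proof (rule \<gamma>_in_span[OF v])
  fix g assume "g \<in> words_on S G"
  then obtain w y where wy: "w \<in> lists S" "y \<in> G" "g = act_word w y" unfolding words_on_def by blast
  moreover from wy(1) have "w \<in> lists (gl_ix p q n)" using S lists_mono by blast
  ultimately obtain s where "\<gamma> g = s *s act_word w (\<gamma> y)" using act_word_\<gamma> by blast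
  then show "\<gamma> g \<in> span (words_on S G)"
    using words_onI[of w S "\<gamma> y" G] wy G by (auto intro: span_scale span_base)
qed simp

text \<open>
  The span is a nonzero graded submodule of the simple module \<open>L\<close>.
\<close>

lemma span_words_on_eq_L:
  assumes S: "S \<subseteq> gl_ix p q n"
    and G: "G \<subseteq> L" "\<And>y. y \<in> G \<Longrightarrow> \<gamma> y \<in> G" "\<exists>y\<in>G. y \<noteq> 0"
      "\<And>a b y. (a, b) \<in> gl_ix p q n - S \<Longrightarrow> y \<in> G \<Longrightarrow> E a b y \<in> span G"
  shows "span (words_on S G) = L"
proof -
  have "span (words_on S G) = {0} \<or> span (words_on S G) = L"
  proof (rule simple_L)
    show "span (words_on S G) \<subseteq> L"
      using words_on_L[OF S G(1)] subspace_L by (rule span_minimal)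
    show "E a b v \<in> span (words_on S G)"
      if "(a, b) \<in> gl_ix p q n" "v \<in> span (words_on S G)" for a b v
      using span_words_on_stable[OF S G(4) that(2,1)] .
    show "\<gamma> v \<in> span (words_on S G)" if "v \<in> span (words_on S G)" for v
      using \<gamma>_words_on[OF S G(2) that] .
  qed simp
  moreover have "span (words_on S G) \<noteq> {0}"
    using G(3) words_onI[of "[]" S _ G] span_base by fastforce
  ultimately show ?thesis by blast
qed

lemma L_eq_kminus_words: "span (words_on kminus_ix M) = L"
proof (rule span_words_on_eq_L)
  fix a b y assume "(a, b) \<in> gl_ix p q n - kminus_ix" "y \<in> M"
  then show "E a b y \<in> span M"
    using k_M[of a b y] kplus_M[of a b y] by (auto elim!: gl_ix_cases[of a b] intro: span_base span_zero)
qed (use ix_sub M_L \<gamma>_M vac in auto)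

text \<open>
  The highest weight vector need not be homogeneous, but the span of these two vectors is graded.
\<close>

definition vacua :: "'v set" where "vacua = {vac, \<gamma> vac}"

lemma vacua_M: "vacua \<subseteq> M"
  using vac \<gamma>_M by (auto simp: vacua_def)

lemma vacua_weight: "y \<in> vacua \<Longrightarrow> a \<in> ix \<Longrightarrow> E a a y = \<Lambda> a *s y"
  using diag_in_k[of a] vac_weight[of a] E_\<gamma>[of a a vac]
  by (auto simp: vacua_def k_ix_def \<gamma>_scale minus1_pow_def)

lemma vacua_high:
  assumes "y \<in> vacua" "(a, b) \<in> gl_ix p q n" "a < b"
  shows "E a b y = 0"
proof -
  have "E a b vac = 0"
    using assms(2)
  proof (cases rule: gl_ix_cases)
    case 3
    then show ?thesis using assms(3) by (simp add: kminus_ix_def)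
  qed (use vac_high kplus_M vac assms(3) in auto)
  then show ?thesis using assms E_\<gamma>[OF assms(2), of vac] by (auto simp: vacua_def)
qed

lemma L_eq_lower_words: "span (words_on lower_ix vacua) = L"
proof (rule span_words_on_eq_L)
  fix a b y assume *: "(a, b) \<in> gl_ix p q n - lower_ix" "y \<in> vacua"
  then consider "a < b" | "a = b" "a \<in> ix"
    using linorder_less_linear[of a b] by (auto simp: lower_ix_def gl_ix_def)
  then show "E a b y \<in> span vacua"
  proof cases
    case 1
    then show ?thesis using vacua_high[of y a b] * by (simp add: span_zero)
  next
    case 2
    then show ?thesis using vacua_weight[of y a] * by (simp add: span_scale span_base)
  qed
qed (use ix_sub vacua_M M_L vac \<gamma>_\<gamma> in \<open>auto simp: vacua_def M_in_L\<close>)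

text \<open>The weight of the vector that the word makes out of a highest weight vector.\<close>

fun word_weight :: "(nat \<times> nat) list \<Rightarrow> nat \<Rightarrow> complex" where
  "word_weight [] c = \<Lambda> c"
| "word_weight ((a, b) # w) c = word_weight w c + (if c = a then 1 else 0) - (if c = b then 1 else 0)"

lemma word_weight:
  assumes "w \<in> lists (gl_ix p q n)" "y \<in> vacua" "c \<in> ix"
  shows "E c c (act_word w y) = word_weight w c *s act_word w y"
  using assms(1)
proof (induction w rule: list.induct)
  case Nil
  then show ?case using assms vacua_weight by simp
next
  case (Cons ab w)
  obtain a b where ab: "ab = (a, b)" by force
  with Cons.prems have gl: "(a, b) \<in> gl_ix p q n" and w: "w \<in> lists (gl_ix p q n)" by simp_all
  show ?case
    using Cons.IH[OF w] E_diag[OF assms(3) gl]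
    by (auto simp: ab E_scale scale_left_distrib scale_left_diff_distrib)
qed

lemma word_weight_in_weights:
  "w \<in> lists (gl_ix p q n) \<Longrightarrow> word_weight w \<in> weights p q n"
proof (induction w rule: list.induct)
  case Nil
  then show ?case using \<Lambda>_weight by (simp add: weights_def)
next
  case (Cons ab w)
  then show ?case by (cases ab) (auto simp: weights_def gl_ix_def)
qed

definition wt_space :: "(nat \<Rightarrow> complex) \<Rightarrow> 'v set" where
  "wt_space \<xi> = {v \<in> L. \<forall>a \<in> ix. E a a v = \<xi> a *s v}"

lemma subspace_wt_space: "subspace (wt_space \<xi>)"
  unfolding wt_space_def
  by (rule subspaceI)
    (auto simp: E_add E_scale scale_right_distrib subspace_L subspace_0 subspace_add subspace_scale mult.commute)

lemma wt_space_L: "v \<in> wt_space \<xi> \<Longrightarrow> v \<in> L"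
  by (simp add: wt_space_def)

lemma L_sub_sum_of_wt_spaces: "L \<subseteq> span (\<Union>\<xi>\<in>weights p q n. wt_space \<xi>)"
proof -
  have "words_on lower_ix vacua \<subseteq> (\<Union>\<xi>\<in>weights p q n. wt_space \<xi>)"
  proof
    fix v assume "v \<in> words_on lower_ix vacua"
    then obtain w y where wy: "w \<in> lists lower_ix" "y \<in> vacua" "v = act_word w y"
      unfolding words_on_def by blast
    then have w: "w \<in> lists (gl_ix p q n)" using ix_sub(4) lists_mono by blast
    have "v \<in> wt_space (word_weight w)"
      using wy w act_word_L[OF w, of y] vacua_M M_in_L word_weight[OF w wy(2)] by (auto simp: wt_space_def)
    then show "v \<in> (\<Union>\<xi>\<in>weights p q n. wt_space \<xi>)"
      using word_weight_in_weights[OF w] by blast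
  qed
  then show ?thesis unfolding L_eq_lower_words[symmetric] by (rule span_mono)
qed

definition shift :: "nat \<Rightarrow> nat \<Rightarrow> (nat \<Rightarrow> complex) \<Rightarrow> nat \<Rightarrow> complex" where
  "shift a b \<xi> c = \<xi> c + (if c = a then 1 else 0) - (if c = b then 1 else 0)"

lemma E_wt_space:
  assumes "(a, b) \<in> gl_ix p q n" "v \<in> wt_space \<xi>"
  shows "E a b v \<in> wt_space (shift a b \<xi>)"
  using assms E_L[of a b v] E_diag[OF _ assms(1)]
  by (auto simp: wt_space_def shift_def E_scale scale_left_distrib scale_left_diff_distrib)

lemma shift_in_weights: "(a, b) \<in> gl_ix p q n \<Longrightarrow> \<xi> \<in> weights p q n \<Longrightarrow> shift a b \<xi> \<in> weights p q n"
  by (auto simp: weights_def gl_ix_def shift_def)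

text \<open>
  This is the height of \<open>\<Lambda> - \<xi>\<close>, its number of simple roots for the standard Borel subalgebra.
\<close>

definition level :: "(nat \<Rightarrow> complex) \<Rightarrow> complex" where
  "level \<xi> = (\<Sum>a\<in>ix. of_nat a * (\<xi> a - \<Lambda> a))"

lemma level_shift:
  assumes "(a, b) \<in> gl_ix p q n"
  shows "level (shift a b \<xi>) = level \<xi> + of_nat a - of_nat b"
proof -
  have "level (shift a b \<xi>) = (\<Sum>c\<in>ix. of_nat c * (\<xi> c - \<Lambda> c)
      + (if a = c then of_nat a else 0) - (if b = c then of_nat b else 0))"
    unfolding level_def shift_def by (intro sum.cong refl) (auto simp: algebra_simps)
  also have "\<dots> = level \<xi> + of_nat a - of_nat b"
    using assms by (simp add: sum.distrib sum_subtractf level_def gl_ix_def)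
  finally show ?thesis .
qed

fun word_height :: "(nat \<times> nat) list \<Rightarrow> nat" where
  "word_height [] = 0"
| "word_height ((a, b) # w) = word_height w + (a - b)"

lemma level_word_weight:
  "w \<in> lists lower_ix \<Longrightarrow> level (word_weight w) = of_nat (word_height w)"
proof (induction w rule: list.induct)
  case Nil
  then show ?case by (simp add: level_def)
next
  case (Cons ab w)
  obtain a b where ab: "ab = (a, b)" by force
  with Cons.prems have "(a, b) \<in> lower_ix" "w \<in> lists lower_ix" by simp_all
  moreover from this have "(a, b) \<in> gl_ix p q n" "b < a" by (auto simp: lower_ix_def)
  moreover have "word_weight ((a, b) # w) = shift a b (word_weight w)"
    by (auto simp: shift_def fun_eq_iff)
  ultimately show ?case
    using Cons.IH by (simp add: ab level_shift of_nat_diff del: word_weight.simps)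
qed

lemma word_height_ge_length: "w \<in> lists lower_ix \<Longrightarrow> length w \<le> word_height w"
proof (induction w rule: list.induct)
  case (Cons ab w)
  then show ?case by (cases ab) (auto simp: lower_ix_def)
qed simp

lemma finite_words_of_height: "finite {w \<in> lists lower_ix. word_height w = h}"
proof (rule finite_subset)
  show "{w \<in> lists lower_ix. word_height w = h} \<subseteq> {w. set w \<subseteq> gl_ix p q n \<and> length w \<le> h}"
    using word_height_ge_length ix_sub(4) by fastforce
  show "finite {w. set w \<subseteq> gl_ix p q n \<and> length w \<le> h}"
    by (rule finite_lists_length_le) (simp add: gl_ix_def)
qed

text \<open>
  \<open>L\<close> is spanned by the words in lowering operators, which are eigenvectors of \<open>D\<close>; only those with the
  eigenvalue of \<open>v\<close> contribute to \<open>v\<close>.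
\<close>

lemma weight_vector_in_span_of_words:
  assumes D: "Vector_Spaces.linear scale scale D"
    and e: "\<And>w y. w \<in> lists lower_ix \<Longrightarrow> y \<in> vacua \<Longrightarrow> D (act_word w y) = e w *s act_word w y"
    and v: "v \<in> L" "D v = l *s v"
  shows "v \<in> span {act_word w y | w y. w \<in> lists lower_ix \<and> y \<in> vacua \<and> e w = l}"
proof -
  let ?f = "\<lambda>(w, y). act_word w y"
  have W: "words_on lower_ix vacua = ?f ` (lists lower_ix \<times> vacua)"
    unfolding words_on_def by auto
  have f: "D (?f i) = e (fst i) *s ?f i" if "i \<in> lists lower_ix \<times> vacua" for i
    using that e[of "fst i" "snd i"] by (cases i) (simp del: in_lists_conv_set)
  have "v \<in> span (?f ` (lists lower_ix \<times> vacua))"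
    using v L_eq_lower_words W by simp
  then have "v \<in> span (?f ` {i \<in> lists lower_ix \<times> vacua. e (fst i) = l})"
    using eigenvector_in_span_of_eigenvectors[OF D, where f = ?f and e = "\<lambda>i. e (fst i)"] f v by blast
  moreover have "?f ` {i \<in> lists lower_ix \<times> vacua. e (fst i) = l} =
      {act_word w y | w y. w \<in> lists lower_ix \<and> y \<in> vacua \<and> e w = l}"
    by force
  ultimately show ?thesis by simp
qed

lemma weight_vector_has_word_eigenvalue:
  assumes D: "Vector_Spaces.linear scale scale D"
    and e: "\<And>w y. w \<in> lists lower_ix \<Longrightarrow> y \<in> vacua \<Longrightarrow> D (act_word w y) = e w *s act_word w y"
    and v: "v \<in> L" "D v = l *s v" "v \<noteq> 0"
  shows "\<exists>w. e w = l"
proof (rule ccontr)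
  assume no: "\<nexists>w. e w = l"
  have "v \<in> span {act_word w y | w y. w \<in> lists lower_ix \<and> y \<in> vacua \<and> e w = l}"
    by (rule weight_vector_in_span_of_words[OF D e v(1,2)])
  also have "{act_word w y | w y. w \<in> lists lower_ix \<and> y \<in> vacua \<and> e w = l} = {}"
    using no by blast
  finally show False using v(3) by simp
qed

text \<open>
  The element of the Cartan subalgebra, up to a constant, that measures the level of a weight.
\<close>

definition height_op :: "'v \<Rightarrow> 'v" where
  "height_op v = (\<Sum>a\<in>ix. of_nat a *s (E a a v - \<Lambda> a *s v))"

lemma height_op_eq:
  assumes "\<And>a. a \<in> ix \<Longrightarrow> E a a v = \<xi> a *s v"
  shows "height_op v = level \<xi> *s v"
proof -
  have "height_op v = (\<Sum>a\<in>ix. (of_nat a * (\<xi> a - \<Lambda> a)) *s v)"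
    unfolding height_op_def by (intro sum.cong refl) (simp add: assms scale_left_diff_distrib[symmetric])
  then show ?thesis by (simp add: level_def scale_sum_left)
qed

lemma linear_height_op: "Vector_Spaces.linear scale scale height_op"
  unfolding Vector_Spaces.linear_iff height_op_def using vector_space_axioms
  by (auto simp: E_add E_scale scale_right_distrib scale_right_diff_distrib sum.distrib sum_subtractf
      scale_sum_right mult_ac)

text \<open>
  Each letter has height at least 1, so finitely many words have height \<open>h\<close>: weight spaces are
  finite-dimensional.
\<close>

lemma wt_space_sub_span:
  assumes "level \<xi> = of_nat h"
  shows "wt_space \<xi> \<subseteq> span ((\<lambda>(w, y). act_word w y) ` ({w \<in> lists lower_ix. word_height w = h} \<times> vacua))"
proof
  fix v assume v: "v \<in> wt_space \<xi>"
  have "v \<in> span {act_word w y | w y. w \<in> lists lower_ix \<and> y \<in> vacua \<and> complex_of_nat (word_height w) = of_nat h}"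
  proof (rule weight_vector_in_span_of_words[OF linear_height_op])
    fix w y assume w: "w \<in> lists lower_ix" "y \<in> vacua"
    then have "w \<in> lists (gl_ix p q n)" using ix_sub(4) lists_mono by blast
    then show "height_op (act_word w y) = of_nat (word_height w) *s act_word w y"
      using height_op_eq[of "act_word w y" "word_weight w"] word_weight level_word_weight w by simp
  next
    show "height_op v = of_nat h *s v"
      using height_op_eq[of v \<xi>] v assms by (simp add: wt_space_def)
  qed (use v in \<open>simp add: wt_space_def\<close>)
  also have "{act_word w y | w y. w \<in> lists lower_ix \<and> y \<in> vacua \<and> complex_of_nat (word_height w) = of_nat h}
    = (\<lambda>(w, y). act_word w y) ` ({w \<in> lists lower_ix. word_height w = h} \<times> vacua)"
    by force
  finally show "v \<in> span \<dots>" .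
qed

lemma level_nat:
  assumes v: "v \<in> wt_space \<xi>" "v \<noteq> 0"
  obtains h where "level \<xi> = of_nat h"
proof -
  have "\<exists>w. complex_of_nat (word_height w) = level \<xi>"
  proof (rule weight_vector_has_word_eigenvalue[OF linear_height_op])
    fix w y assume w: "w \<in> lists lower_ix" "y \<in> vacua"
    then have "w \<in> lists (gl_ix p q n)" using ix_sub(4) lists_mono by blast
    then show "height_op (act_word w y) = of_nat (word_height w) *s act_word w y"
      using height_op_eq[of "act_word w y" "word_weight w"] word_weight level_word_weight w by simp
  next
    show "height_op v = level \<xi> *s v"
      using height_op_eq[of v \<xi>] v by (simp add: wt_space_def)
  qed (use v in \<open>simp_all add: wt_space_def\<close>)
  then show ?thesis using that by metis
qed

lemma word_weight_real:
  assumes "\<And>a. \<Lambda> a \<in> \<real>" shows "word_weight w c \<in> \<real>"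
proof (induction w rule: list.induct)
  case (Cons ab w)
  then show ?case by (cases ab) auto
qed (use assms in auto)

lemma weights_real:
  assumes real: "\<And>a. \<Lambda> a \<in> \<real>" and v: "v \<in> wt_space \<xi>" "v \<noteq> 0" and a: "a \<in> ix"
  shows "\<xi> a \<in> \<real>"
proof -
  have "\<exists>w. word_weight w a = \<xi> a"
  proof (rule weight_vector_has_word_eigenvalue[OF linear_E[of a a]])
    fix w y assume w: "w \<in> lists lower_ix" "y \<in> vacua"
    then have "w \<in> lists (gl_ix p q n)" using ix_sub(4) lists_mono by blast
    then show "E a a (act_word w y) = word_weight w a *s act_word w y"
      using word_weight w a by simp
  qed (use v a in \<open>auto simp: wt_space_def\<close>)
  then show ?thesis using word_weight_real[OF real] by metis
qed

text \<open>
  Raising operators lower the level, which is a natural number on nonzero weight spaces, so applying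
  them to \<open>v\<close> has to end at a vector that they all kill.
\<close>

lemma k_highest_weight_vector_exists:
  assumes N: "\<And>a b v. (a, b) \<in> k_ix p q n \<Longrightarrow> v \<in> N \<Longrightarrow> E a b v \<in> N"
    and v: "v \<in> N" "v \<in> wt_space \<xi>" "v \<noteq> 0" "\<xi> \<in> weights p q n"
  shows "\<exists>\<zeta> u. \<zeta> \<in> weights p q n \<and> u \<in> N \<and> u \<in> wt_space \<zeta> \<and> u \<noteq> 0 \<and>
    (\<forall>a b. (a, b) \<in> k_ix p q n \<longrightarrow> a < b \<longrightarrow> E a b u = 0)"
proof -
  obtain h where "level \<xi> = of_nat h" using level_nat v by blast
  then show ?thesis using v
  proof (induction h arbitrary: v \<xi> rule: less_induct)
    case (less h)
    show ?case
    proof (cases "\<forall>a b. (a, b) \<in> k_ix p q n \<longrightarrow> a < b \<longrightarrow> E a b v = 0")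
      case True
      with less.prems show ?thesis by blast
    next
      case False
      then obtain a b where ab: "(a, b) \<in> k_ix p q n" "a < b" "E a b v \<noteq> 0" by blast
      have w: "E a b v \<in> wt_space (shift a b \<xi>)"
        using E_wt_space less.prems(3) k_in_gl[OF ab(1)] by blast
      obtain h' where h': "level (shift a b \<xi>) = of_nat h'" using level_nat[OF w ab(3)] by blast
      with less.prems(1) have "of_nat h' + of_nat b = (of_nat h + of_nat a :: complex)"
        by (simp add: level_shift[OF k_in_gl[OF ab(1)]] flip: h')
      then have "h' + b = h + a" by (metis of_nat_add of_nat_eq_iff)
      with ab(2) have "h' < h" by simp
      from less.IH[OF this h' N[OF ab(1) less.prems(2)] w ab(3)]
      show ?thesis using shift_in_weights[OF k_in_gl[OF ab(1)] less.prems(5)] by blast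
    qed
  qed
qed

section \<open>The projection to the bottom degree\<close>

text \<open>
  The grading by the number of letters from \<open>\<kk>\<^sub>-\<close>: each of them lowers the eigenvalue of this operator by
  1, while \<open>\<kk>\<close> preserves it.
\<close>

definition degree_op :: "'v \<Rightarrow> 'v" where "degree_op v = (\<Sum>i = 1..p. E i i v)"

lemma linear_degree_op: "Vector_Spaces.linear scale scale degree_op"
  unfolding Vector_Spaces.linear_iff degree_op_def using vector_space_axioms
  by (auto simp: E_add E_scale sum.distrib scale_sum_right)

lemma degree_op_E:
  assumes "(a, b) \<in> gl_ix p q n"
  shows "degree_op (E a b v) = E a b (degree_op v) + (if a \<le> p then E a b v else 0) - (if b \<le> p then E a b v else 0)"
proof -
  have "degree_op (E a b v) = (\<Sum>i = 1..p. E a b (E i i v) + (if i = a then E a b v else 0) - (if i = b then E a b v else 0))"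
    unfolding degree_op_def using assms by (intro sum.cong refl E_diag) (auto simp: gl_ix_def)
  also have "\<dots> = E a b (degree_op v) + (if a \<le> p then E a b v else 0) - (if b \<le> p then E a b v else 0)"
    using assms by (simp add: degree_op_def E_sum sum.distrib sum_subtractf gl_ix_def)
  finally show ?thesis .
qed

definition top_degree :: complex where "top_degree = (\<Sum>i = 1..p. \<Lambda> i)"

text \<open>
  The operator commutes with \<open>\<kk>\<close> and has \<open>vac\<close> as an eigenvector, so the eigenspace is all of the
  simple \<open>\<kk>\<close>-module \<open>M\<close>.
\<close>

lemma degree_op_M:
  assumes "v \<in> M" shows "degree_op v = top_degree *s v"
proof -
  interpret D: Vector_Spaces.linear scale scale degree_op by (rule linear_degree_op)
  define N where "N = {v \<in> M. degree_op v = top_degree *s v}"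
  have "N = {0} \<or> N = M"
  proof (rule simple_M)
    show "subspace N"
      unfolding N_def
      by (rule subspaceI) (auto simp: D.add D.scale scale_right_distrib subspace_M subspace_0 subspace_add subspace_scale mult.commute)
    show "E a b v \<in> N" if "(a, b) \<in> k_ix p q n" "v \<in> N" for a b v
      using that k_M[of a b v] degree_op_E[OF k_in_gl[OF that(1)], of v]
      by (auto simp: N_def E_scale k_ix_def)
    show "\<gamma> v \<in> N" if "v \<in> N" for v
    proof -
      have "degree_op (\<gamma> v) = (\<Sum>i = 1..p. \<gamma> (E i i v))"
        unfolding degree_op_def
        by (intro sum.cong refl, subst E_\<gamma>) (auto simp: gl_ix_def minus1_pow_def)
      also have "\<dots> = \<gamma> (degree_op v)"
      proof -
        have "(\<Sum>i\<in>A. \<gamma> (E i i v)) = \<gamma> (\<Sum>i\<in>A. E i i v)" for A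
          by (induction A rule: infinite_finite_induct) (auto simp: \<gamma>_add)
        then show ?thesis by (simp add: degree_op_def)
      qed
      finally show ?thesis using that \<gamma>_M by (simp add: N_def \<gamma>_scale)
    qed
  qed (auto simp: N_def)
  moreover have "vac \<in> N"
    using vac vac_weight by (simp add: N_def degree_op_def top_degree_def scale_sum_left)
  ultimately show ?thesis using vac(2) assms by (auto simp: N_def)
qed

text \<open>
  The part of positive degree, the complement of the bottom.
\<close>

definition Z :: "'v set" where
  "Z = span {act_word w y | w y. w \<in> lists kminus_ix \<and> w \<noteq> [] \<and> y \<in> M}"

lemma subspace_Z: "subspace Z"
  by (simp add: Z_def)

lemma degree_op_act_word:
  "w \<in> lists kminus_ix \<Longrightarrow> y \<in> M \<Longrightarrow>
    degree_op (act_word w y) = (top_degree - of_nat (length w)) *s act_word w y"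
proof (induction w rule: list.induct)
  case Nil
  then show ?case using degree_op_M by simp
next
  case (Cons ab w)
  obtain a b where ab: "ab = (a, b)" by force
  with Cons.prems have *: "(a, b) \<in> kminus_ix" "w \<in> lists kminus_ix" by simp_all
  note IH = Cons.IH[OF *(2) Cons.prems(2)]
  from *(1) have "degree_op (E a b (act_word w y)) = E a b (degree_op (act_word w y)) - E a b (act_word w y)"
    using degree_op_E[of a b "act_word w y"] by (auto simp: kminus_ix_def)
  then show ?case
    by (simp add: ab IH E_scale E_diff scale_left_diff_distrib scale_left_distrib)
qed

text \<open>
  The words that span \<open>Z\<close> have degrees different from that of \<open>M\<close>.
\<close>

lemma M_inter_Z:
  assumes "v \<in> M" "v \<in> Z" shows "v = 0"
proof (rule eigenvector_in_span_of_others_is_zero[OF linear_degree_op])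
  show "v \<in> span {act_word w y | w y. w \<in> lists kminus_ix \<and> w \<noteq> [] \<and> y \<in> M}"
    using assms(2) by (simp add: Z_def)
  show "degree_op v = top_degree *s v" by (rule degree_op_M[OF assms(1)])
  fix g assume "g \<in> {act_word w y | w y. w \<in> lists kminus_ix \<and> w \<noteq> [] \<and> y \<in> M}"
  then obtain w y where wy: "w \<in> lists kminus_ix" "w \<noteq> []" "y \<in> M" "g = act_word w y" by blast
  from wy(2) have "top_degree - of_nat (length w) \<noteq> top_degree" by simp
  with degree_op_act_word[OF wy(1,3)] wy(4)
  show "\<exists>\<mu>. \<mu> \<noteq> top_degree \<and> degree_op g = \<mu> *s g" by blast
qed

lemma Z_L: "v \<in> Z \<Longrightarrow> v \<in> L"
proof -
  have "{act_word w y | w y. w \<in> lists kminus_ix \<and> w \<noteq> [] \<and> y \<in> M} \<subseteq> L"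
    unfolding L_eq_kminus_words[symmetric] by (intro order.trans[OF _ span_superset]) (auto simp: words_on_def)
  then show "v \<in> Z \<Longrightarrow> v \<in> L" unfolding Z_def using span_minimal subspace_L by blast
qed

lemma kminus_L_Z:
  assumes "(a, b) \<in> kminus_ix" "v \<in> L" shows "E a b v \<in> Z"
proof (rule E_in_span[OF _ _ subspace_Z])
  show "v \<in> span (words_on kminus_ix M)" using assms L_eq_kminus_words by simp
  fix g assume "g \<in> words_on kminus_ix M"
  then obtain w y where "w \<in> lists kminus_ix" "y \<in> M" "g = act_word w y" unfolding words_on_def by blast
  then show "E a b g \<in> Z"
    unfolding Z_def using assms(1) by (intro span_base CollectI exI[of _ "(a, b) # w"] exI[of _ y]) simp
qed

text \<open>
  Commuting \<open>E\<^sub>a\<^sub>b\<close> with the first letter of a word, which is in \<open>\<kk>\<^sub>-\<close>, leaves a letter from \<open>\<kk>\<^sub>-\<close> in front of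
  all terms.
\<close>

lemma k_Z:
  assumes "(a, b) \<in> k_ix p q n" "v \<in> Z" shows "E a b v \<in> Z"
proof (rule E_in_span[OF _ _ subspace_Z])
  show "v \<in> span {act_word w y | w y. w \<in> lists kminus_ix \<and> w \<noteq> [] \<and> y \<in> M}"
    using assms(2) by (simp add: Z_def)
  fix g assume "g \<in> {act_word w y | w y. w \<in> lists kminus_ix \<and> w \<noteq> [] \<and> y \<in> M}"
  then obtain w y where wy: "w \<in> lists kminus_ix" "w \<noteq> []" "y \<in> M" "g = act_word w y" by blast
  then obtain c d w' where w: "w = (c, d) # w'" by (metis list.exhaust prod.exhaust)
  with wy have cd: "(c, d) \<in> kminus_ix" "w' \<in> lists kminus_ix" by simp_all
  have L: "act_word w' y \<in> L"
    using act_word_L[of w' y] lists_mono[OF ix_sub(3)] cd M_in_L wy by blast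
  have "b = c \<Longrightarrow> (a, d) \<in> kminus_ix" "d = a \<Longrightarrow> (c, b) \<in> kminus_ix"
    using cd assms(1) by (auto simp: kminus_ix_def k_ix_def gl_ix_def)
  then have "(if b = c then E a d (act_word w' y) else 0) \<in> Z" "(if d = a then E c b (act_word w' y) else 0) \<in> Z"
    using kminus_L_Z[OF _ L] subspace_0[OF subspace_Z] by auto
  moreover have "E c d (E a b (act_word w' y)) \<in> Z"
    using kminus_L_Z cd E_L[OF k_in_gl[OF assms(1)] L] by blast
  ultimately show "E a b g \<in> Z"
    unfolding wy(4) w act_word.simps E_bracket[OF k_in_gl[OF assms(1)] kminus_in_gl[OF cd(1)]]
    by (intro subspace_diff[OF subspace_Z subspace_add[OF subspace_Z]] subspace_scale[OF subspace_Z])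
qed

lemma \<gamma>_Z: "v \<in> Z \<Longrightarrow> \<gamma> v \<in> Z"
proof (rule \<gamma>_in_span[OF _ _ subspace_Z])
  show "v \<in> Z \<Longrightarrow> v \<in> span {act_word w y | w y. w \<in> lists kminus_ix \<and> w \<noteq> [] \<and> y \<in> M}"
    by (simp add: Z_def)
  fix g assume "g \<in> {act_word w y | w y. w \<in> lists kminus_ix \<and> w \<noteq> [] \<and> y \<in> M}"
  then obtain w y where wy: "w \<in> lists kminus_ix" "w \<noteq> []" "y \<in> M" "g = act_word w y" by blast
  then have "w \<in> lists (gl_ix p q n)" using lists_mono[OF ix_sub(3)] by blast
  then obtain s where "\<gamma> g = s *s act_word w (\<gamma> y)" using act_word_\<gamma> wy by blast
  moreover have "act_word w (\<gamma> y) \<in> Z" unfolding Z_def using wy \<gamma>_M by (intro span_base) blast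
  ultimately show "\<gamma> g \<in> Z" by (simp add: subspace_scale subspace_Z)
qed

text \<open>
  The projection of \<open>L = M \<oplus> Z\<close> to \<open>M\<close>.
\<close>

definition pr :: "'v \<Rightarrow> 'v" where "pr v = (THE y. y \<in> M \<and> v - y \<in> Z)"

lemma pr_eqI: "y \<in> M \<Longrightarrow> v - y \<in> Z \<Longrightarrow> pr v = y"
  unfolding pr_def
proof (rule the_equality)
  fix x assume "y \<in> M" "v - y \<in> Z" "x \<in> M \<and> v - x \<in> Z"
  then have "x - y \<in> M" "x - y \<in> Z"
    using subspace_diff[OF subspace_M, of x y] subspace_diff[OF subspace_Z, of "v - y" "v - x"] by auto
  then show "x = y" using M_inter_Z[of "x - y"] by simp
qed simp

lemma pr:
  assumes "v \<in> L" shows pr_M: "pr v \<in> M" and pr_Z: "v - pr v \<in> Z"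
proof -
  have "v \<in> span (words_on kminus_ix M)" using assms L_eq_kminus_words by simp
  then have "\<exists>y. y \<in> M \<and> v - y \<in> Z"
  proof (induction rule: span_induct_alt)
    case base
    then show ?case using subspace_M subspace_Z by (intro exI[of _ 0]) (simp add: subspace_0)
  next
    case (step c x v)
    then obtain y where y: "y \<in> M" "v - y \<in> Z" by blast
    from step obtain w u where wu: "w \<in> lists kminus_ix" "u \<in> M" "x = act_word w u" unfolding words_on_def by blast
    show ?case
    proof (cases "w = []")
      case True
      then show ?thesis
        using y wu by (intro exI[of _ "c *s x + y"]) (simp add: subspace_add subspace_scale subspace_M)
    next
      case False
      then have "x \<in> Z" using wu unfolding Z_def by (intro span_base) blast
      then have "c *s x + (v - y) \<in> Z" using y by (simp add: subspace_add subspace_scale subspace_Z)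
      then show ?thesis using y by (intro exI[of _ y]) (simp add: algebra_simps)
    qed
  qed
  then obtain y where y: "y \<in> M" "v - y \<in> Z" by blast
  with pr_eqI[OF y] show "pr v \<in> M" "v - pr v \<in> Z" by simp_all
qed

lemma pr_on_M [simp]: "v \<in> M \<Longrightarrow> pr v = v"
  by (rule pr_eqI) (simp_all add: subspace_0 subspace_Z)

lemma pr_on_Z [simp]: "v \<in> Z \<Longrightarrow> pr v = 0"
  by (rule pr_eqI) (simp_all add: subspace_0 subspace_M)

lemma pr_add: "u \<in> L \<Longrightarrow> v \<in> L \<Longrightarrow> pr (u + v) = pr u + pr v"
  using pr[of u] pr[of v] subspace_add[OF subspace_Z, of "u - pr u" "v - pr v"]
  by (intro pr_eqI) (auto simp: subspace_add subspace_M algebra_simps)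

lemma pr_scale: "u \<in> L \<Longrightarrow> pr (k *s u) = k *s pr u"
  using pr[of u] subspace_scale[OF subspace_Z, of "u - pr u" k]
  by (intro pr_eqI) (auto simp: subspace_scale subspace_M scale_right_diff_distrib)

lemma pr_diff: "u \<in> L \<Longrightarrow> v \<in> L \<Longrightarrow> pr (u - v) = pr u - pr v"
  using pr[of u] pr[of v] subspace_diff[OF subspace_Z, of "u - pr u" "v - pr v"]
  by (intro pr_eqI) (auto simp: subspace_diff subspace_M algebra_simps)

lemma pr_k: "(a, b) \<in> k_ix p q n \<Longrightarrow> v \<in> L \<Longrightarrow> pr (E a b v) = E a b (pr v)"
  using pr[of v] k_Z[of a b "v - pr v"] k_M[of a b "pr v"] by (intro pr_eqI) (auto simp: E_diff)

lemma pr_kminus: "(a, b) \<in> kminus_ix \<Longrightarrow> v \<in> L \<Longrightarrow> pr (E a b v) = 0"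
  using kminus_L_Z by simp

lemma pr_\<gamma>: "v \<in> L \<Longrightarrow> pr (\<gamma> v) = \<gamma> (pr v)"
  using pr[of v] \<gamma>_Z[of "v - pr v"] \<gamma>_M[of "pr v"] \<gamma>_add[of "v - pr v" "pr v"]
  by (intro pr_eqI) (auto simp: algebra_simps)

lemma pr_Om: "v \<in> L \<Longrightarrow> pr (Om v) = 0"
proof -
  assume v: "v \<in> L"
  have "E a i (E i a v) \<in> Z" if "a \<in> {p + 1..p + q + n}" "i \<in> {1..p}" for a i
    using that v by (intro kminus_L_Z E_L) (auto simp: kminus_ix_def gl_ix_def)
  then show ?thesis unfolding Om_eq by (intro pr_on_Z subspace_sum[OF subspace_Z]) auto
qed

lemma pr_wt_space: "v \<in> wt_space \<xi> \<Longrightarrow> pr v \<in> wt_space \<xi>"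
  using pr_M[of v] M_in_L pr_k[OF diag_in_k, of _ v] by (auto simp: wt_space_def pr_scale)

lemma Om_L: "v \<in> L \<Longrightarrow> Om v \<in> L"
  unfolding Om_eq by (intro subspace_sum[OF subspace_L] E_L) (auto simp: gl_ix_def)

text \<open>
  The Casimir operator is central, and on a highest weight vector, which \<open>\<Omega>\<close> kills, its value is known.
\<close>

lemma cas_L:
  assumes "v \<in> L" shows "cas v = bil p q n \<Lambda> (\<lambda>a. \<Lambda> a + 2 * rho p q n a) *s v"
proof -
  define k where "k = bil p q n \<Lambda> (\<lambda>a. \<Lambda> a + 2 * rho p q n a)"
  have Om: "Om y = 0" if "y \<in> M" for y
    unfolding Om_eq using that by (intro sum.neutral ballI) (auto simp: kplus_M kplus_ix_def gl_ix_def)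
  have "cas y = k *s y" if "y \<in> vacua" for y
    using cas_on_k_highest_weight_vector[of y \<Lambda>] vacua_weight[OF that] vacua_high[OF that] Om[of y]
      vacua_M that k_in_gl by (auto simp: k_def)
  then have words: "cas (act_word w y) = k *s act_word w y" if "y \<in> vacua" "w \<in> lists lower_ix" for w y
    using that(2)
  proof (induction w rule: list.induct)
    case (Cons ab w)
    obtain a b where ab: "ab = (a, b)" by force
    with Cons.prems have "(a, b) \<in> gl_ix p q n" "w \<in> lists lower_ix" by (simp_all add: lower_ix_def)
    then show ?case using Cons by (simp add: ab cas_commutes[symmetric] E_scale)
  qed (use that in simp)
  have "v \<in> span (words_on lower_ix vacua)" using assms L_eq_lower_words by simp
  then have "cas v = k *s v"
  proof (induction rule: span_induct_alt)
    case base
    show ?case using quadratic_linear(2)[of ix ix 0 0] by (simp add: cas_def)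
  next
    case (step c x y)
    then have "cas x = k *s x"
      using words unfolding words_on_def by blast
    moreover have "cas (c *s x + y) = c *s cas x + cas y"
      by (simp add: cas_def quadratic_linear)
    ultimately show ?case
      using step by (simp add: scale_right_distrib mult.commute)
  qed
  then show ?thesis by (simp add: k_def)
qed

lemma bil_difference:
  "bil p q n (\<lambda>a. \<Lambda> a - \<xi> a) (\<lambda>a. \<Lambda> a + \<xi> a + 2 * rho p q n a)
    = bil p q n \<Lambda> (\<lambda>a. \<Lambda> a + 2 * rho p q n a) - bil p q n \<xi> (\<lambda>a. \<xi> a + 2 * rho p q n a)"
  unfolding bil_eq_signed_sum sum_subtractf[symmetric] by (intro sum.cong refl) (simp add: algebra_simps)

lemma Om_on_k_highest_weight_vector:
  assumes "u \<in> wt_space \<xi>" and "\<And>a b. (a, b) \<in> k_ix p q n \<Longrightarrow> a < b \<Longrightarrow> E a b u = 0"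
  shows "Om u = (bil p q n (\<lambda>a. \<Lambda> a - \<xi> a) (\<lambda>a. \<Lambda> a + \<xi> a + 2 * rho p q n a) / 2) *s u"
proof -
  have "2 *s Om u = bil p q n (\<lambda>a. \<Lambda> a - \<xi> a) (\<lambda>a. \<Lambda> a + \<xi> a + 2 * rho p q n a) *s u"
    using cas_on_k_highest_weight_vector[of u \<xi>] cas_L[of u] assms
    by (simp add: wt_space_def bil_difference scale_left_diff_distrib)
  then have "(1 / 2) *s (2 *s Om u) = (1 / 2) *s (bil p q n (\<lambda>a. \<Lambda> a - \<xi> a) (\<lambda>a. \<Lambda> a + \<xi> a + 2 * rho p q n a) *s u)"
    by simp
  then show ?thesis by simp
qed

end

section \<open>The contravariant form\<close>

lemma cnj_minus1_pow [simp]: "cnj (minus1_pow x) = minus1_pow x"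
  by (simp add: minus1_pow_def)

text \<open>
  The bottom carries the positive definite form of a type-1 unitary \<open>\<kk>\<close>-module.
\<close>

locale unitary_bottom = simple_hw_module scale p q n E \<gamma> L M \<Lambda> vac + B: hermitian_form scale M B
  for scale :: "complex \<Rightarrow> 'v::ab_group_add \<Rightarrow> 'v" (infixr "*s" 75)
    and p q n :: nat and E :: "nat \<Rightarrow> nat \<Rightarrow> 'v \<Rightarrow> 'v" and \<gamma> :: "'v \<Rightarrow> 'v" and L M :: "'v set"
    and \<Lambda> :: "nat \<Rightarrow> complex" and vac :: 'v and B :: "'v \<Rightarrow> 'v \<Rightarrow> complex" +
  assumes B_pos: "v \<in> M \<Longrightarrow> v \<noteq> 0 \<Longrightarrow> 0 < B v v"
    and B_k: "(a, b) \<in> k_ix p q n \<Longrightarrow> u \<in> M \<Longrightarrow> v \<in> M \<Longrightarrow> B (E a b u) v = B u (E b a v)"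
    and \<Lambda>_real: "\<Lambda> a \<in> \<real>"
begin

definition block_sgn :: "nat \<Rightarrow> complex" where "block_sgn a = (if a \<le> p then 1 else - 1)"

text \<open>
  The adjoint of \<open>E\<^sub>a\<^sub>b\<close>, the operator of \<open>(E\<^sub>a\<^sub>b)\<^sup>\<star>\<close>: the sign is -1 exactly if \<open>E\<^sub>a\<^sub>b\<close> is not in \<open>\<kk>\<close>.
\<close>

definition st :: "nat \<Rightarrow> nat \<Rightarrow> 'v \<Rightarrow> 'v" where
  "st a b v = (block_sgn a * block_sgn b) *s E b a v"

lemma block_sgn_square [simp]: "block_sgn a * block_sgn a = 1" "block_sgn a * (block_sgn a * x) = x"
  by (auto simp: block_sgn_def)

lemma cnj_block_sgn [simp]: "cnj (block_sgn a) = block_sgn a"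
  by (simp add: block_sgn_def)

lemma st_add: "st a b (u + v) = st a b u + st a b v"
  and st_scale: "st a b (k *s v) = k *s st a b v"
  by (simp_all add: st_def E_add E_scale scale_right_distrib mult.commute)

lemma swap_ix: "(a, b) \<in> gl_ix p q n \<Longrightarrow> (b, a) \<in> gl_ix p q n"
  "(a, b) \<in> k_ix p q n \<Longrightarrow> (b, a) \<in> k_ix p q n"
  "(a, b) \<in> kplus_ix p q n \<Longrightarrow> (b, a) \<in> kminus_ix"
  "(a, b) \<in> kminus_ix \<Longrightarrow> (b, a) \<in> kplus_ix p q n"
  by (auto simp: gl_ix_def k_ix_def kplus_ix_def kminus_ix_def)

lemma st_L: "(a, b) \<in> gl_ix p q n \<Longrightarrow> v \<in> L \<Longrightarrow> st a b v \<in> L"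
  unfolding st_def by (intro subspace_scale[OF subspace_L] E_L) (auto simp: gl_ix_def)

lemma st_k: "(a, b) \<in> k_ix p q n \<Longrightarrow> st a b v = E b a v"
  by (auto simp: st_def block_sgn_def k_ix_def)

lemma st_bracket:
  assumes "(a, b) \<in> gl_ix p q n" "(c, d) \<in> gl_ix p q n"
  shows "st a b (st c d v) = sgn4 c d a b *s st c d (st a b v)
    + (if d = a then st c b v else 0) - sgn4 c d a b *s (if b = c then st a d v else 0)"
proof -
  let ?k = "block_sgn a * block_sgn b * (block_sgn c * block_sgn d)"
  have s: "sgn4 b a d c = sgn4 c d a b" by (metis add.commute mult.commute)
  have "st a b (st c d v) = ?k *s E b a (E d c v)" "st c d (st a b v) = ?k *s E d c (E b a v)"
    by (simp_all add: st_def E_scale mult.commute)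
  moreover have "(if d = a then st c b v else 0) = ?k *s (if a = d then E b c v else 0)"
    "(if b = c then st a d v else 0) = ?k *s (if c = b then E d a v else 0)"
    by (auto simp: st_def block_sgn_def)
  ultimately show ?thesis
    unfolding E_bracket[OF swap_ix(1)[OF assms(1)] swap_ix(1)[OF assms(2)], of v] s
    by (simp only: scale_right_distrib scale_right_diff_distrib scale_scale mult.commute)
qed

text \<open>
  The adjoint of a word: the adjoints of the letters in reverse order.
\<close>

fun star_word :: "(nat \<times> nat) list \<Rightarrow> 'v \<Rightarrow> 'v" where
  "star_word [] v = v"
| "star_word ((a, b) # w) v = star_word w (st a b v)"

lemma star_word_append: "star_word (w @ w') v = star_word w' (star_word w v)"
  by (induction w arbitrary: v) auto

lemma star_word_add: "star_word w (u + v) = star_word w u + star_word w v"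
  and star_word_scale: "star_word w (k *s v) = k *s star_word w v"
  by (induction w arbitrary: u v) (auto simp: st_add st_scale)

lemma star_word_zero [simp]: "star_word w 0 = 0"
  using star_word_scale[of w 0 0] by simp

lemma star_word_diff: "star_word w (u - v) = star_word w u - star_word w v"
  using star_word_add[of w "u - v" v] by (simp add: algebra_simps)

lemma star_word_L: "w \<in> lists (gl_ix p q n) \<Longrightarrow> v \<in> L \<Longrightarrow> star_word w v \<in> L"
proof (induction w arbitrary: v rule: list.induct)
  case (Cons ab w)
  then show ?case by (cases ab) (simp add: st_L)
qed simp

fun flip_word :: "(nat \<times> nat) list \<Rightarrow> (nat \<times> nat) list" where
  "flip_word [] = []"
| "flip_word ((a, b) # w) = flip_word w @ [(b, a)]"

fun word_sgn :: "(nat \<times> nat) list \<Rightarrow> complex" where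
  "word_sgn [] = 1"
| "word_sgn ((a, b) # w) = block_sgn a * block_sgn b * word_sgn w"

lemma star_word_eq: "star_word w v = word_sgn w *s act_word (flip_word w) v"
proof (induction w arbitrary: v rule: list.induct)
  case (Cons ab w)
  obtain a b where ab: "ab = (a, b)" by force
  show ?case
    unfolding ab star_word.simps Cons.IH flip_word.simps word_sgn.simps act_word_append st_def act_word_scale
    by (simp add: mult.commute)
qed simp

lemma star_flip_word: "star_word (flip_word w) v = word_sgn w *s act_word w v"
proof (induction w arbitrary: v rule: list.induct)
  case (Cons ab w)
  obtain a b where ab: "ab = (a, b)" by force
  show ?case
    unfolding ab flip_word.simps star_word_append Cons.IH star_word.simps st_def E_scale act_word.simps word_sgn.simps
    by (simp add: mult_ac)
qed simp

lemma flip_word_gl: "w \<in> lists (gl_ix p q n) \<Longrightarrow> flip_word w \<in> lists (gl_ix p q n)"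
proof (induction w rule: list.induct)
  case (Cons ab w)
  then show ?case by (cases ab) (auto simp: gl_ix_def)
qed simp

lemma cnj_word_sgn [simp]: "cnj (word_sgn w) = word_sgn w"
proof (induction w rule: list.induct)
  case (Cons ab w)
  then show ?case by (cases ab) simp
qed simp

text \<open>
  The projected words have the adjoints that the contravariance of a form would force upon them.
\<close>

definition adjoint_ok :: "(nat \<times> nat) list \<Rightarrow> bool" where
  "adjoint_ok w \<longleftrightarrow> (\<forall>l\<in>M. \<forall>l'\<in>M. B l (pr (star_word w l')) = B (pr (act_word w l)) l')"

lemma adjoint_ok_combine:
  assumes w: "w1 \<in> lists (gl_ix p q n)" "w2 \<in> lists (gl_ix p q n)" "w3 \<in> lists (gl_ix p q n)"
    and ok: "adjoint_ok w1" "adjoint_ok w2" "adjoint_ok w3"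
    and r: "cnj r1 = r1" "cnj r2 = r2" "cnj r3 = r3"
    and act: "\<And>v. act_word w v = r1 *s act_word w1 v + r2 *s act_word w2 v - r3 *s act_word w3 v"
    and star: "\<And>v. star_word w v = r1 *s star_word w1 v + r2 *s star_word w2 v - r3 *s star_word w3 v"
  shows "adjoint_ok w"
  unfolding adjoint_ok_def
proof (intro ballI)
  fix l l' assume l: "l \<in> M" "l' \<in> M"
  have pr_lin: "pr (r1 *s x + r2 *s y - r3 *s z) = r1 *s pr x + r2 *s pr y - r3 *s pr z"
    if "x \<in> L" "y \<in> L" "z \<in> L" for x y z
    using that by (simp add: pr_add pr_diff pr_scale subspace_add[OF subspace_L] subspace_scale[OF subspace_L])
  have aL: "act_word w1 l \<in> L" "act_word w2 l \<in> L" "act_word w3 l \<in> L"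
    by (intro act_word_L w M_in_L l)+
  have sL: "star_word w1 l' \<in> L" "star_word w2 l' \<in> L" "star_word w3 l' \<in> L"
    by (intro star_word_L w M_in_L l)+
  have e: "B l (pr (star_word v l')) = B (pr (act_word v l)) l'" if "adjoint_ok v" for v
    using that l unfolding adjoint_ok_def by blast
  note aM = aL[THEN pr_M] and sM = sL[THEN pr_M]
  have "B l (pr (star_word w l')) =
      r1 * B l (pr (star_word w1 l')) + r2 * B l (pr (star_word w2 l')) - r3 * B l (pr (star_word w3 l'))"
    unfolding star pr_lin[OF sL] using sM l(1) by (simp add: B.form_add B.form_diff B.form_scale)
  also have "\<dots> = B (pr (act_word w l)) l'"
    unfolding act pr_lin[OF aL] e[OF ok(1)] e[OF ok(2)] e[OF ok(3)] using aM l(2)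
    by (simp add: B.form_add_left B.form_diff_left B.form_scale_left r)
  finally show "B l (pr (star_word w l')) = B (pr (act_word w l)) l'" .
qed

text \<open>
  At the left end of a word, a letter from \<open>\<kk>\<^sub>-\<close> makes both sides vanish: on one side because \<open>pr\<close> kills
  \<open>Z\<close>, on the other because its adjoint in \<open>\<kk>\<^sub>+\<close> kills the bottom. Moving it one step to the left
  produces brackets, which are shorter words, with the same coefficients for the adjoint words.
\<close>

lemma adjoint_ok_move_kminus:
  assumes ab: "(a, b) \<in> kminus_ix"
    and shorter: "\<And>w. w \<in> lists (gl_ix p q n) \<Longrightarrow> length w \<le> length (w1 @ w2) \<Longrightarrow> adjoint_ok w"
    and w: "w1 \<in> lists (gl_ix p q n)" "w2 \<in> lists (gl_ix p q n)"
  shows "adjoint_ok (w1 @ (a, b) # w2)"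
  using w shorter
proof (induction w1 arbitrary: w2 rule: rev_induct)
  case Nil
  have "B l (pr (star_word w2 (st a b l'))) = B (pr (E a b (act_word w2 l))) l'"
    if "l \<in> M" "l' \<in> M" for l l'
  proof -
    have "st a b l' = 0" using kplus_M[OF swap_ix(4)[OF ab] that(2)] by (simp add: st_def)
    moreover have "pr (E a b (act_word w2 l)) = 0"
      using ab that Nil by (intro pr_kminus act_word_L M_in_L)
    ultimately show ?thesis using that by (simp add: subspace_0 subspace_Z)
  qed
  then show ?case by (simp add: adjoint_ok_def)
next
  case (snoc cd w1)
  obtain c d where cd: "cd = (c, d)" by force
  from snoc.prems have ix: "(c, d) \<in> gl_ix p q n" "(a, b) \<in> gl_ix p q n"
    and w: "w1 \<in> lists (gl_ix p q n)" "w2 \<in> lists (gl_ix p q n)"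
    using kminus_in_gl[OF ab] by (auto simp: cd)
  from ix have ix': "(c, b) \<in> gl_ix p q n" "(a, d) \<in> gl_ix p q n" by (auto simp: gl_ix_def)
  have ok: "adjoint_ok (w1 @ (a, b) # (c, d) # w2)"
    using snoc.prems(3) ix w by (intro snoc.IH) auto
  have ok': "adjoint_ok (w1 @ (c, b) # w2)" "adjoint_ok (w1 @ (a, d) # w2)"
    using ix' w by (auto intro!: snoc.prems(3))
  show ?case
  proof (rule adjoint_ok_combine[where ?r1.0 = "sgn4 c d a b" and ?r2.0 = "if d = a then 1 else 0"
        and ?r3.0 = "sgn4 c d a b * (if b = c then 1 else 0)", OF _ _ _ ok ok'])
    fix v
    show "act_word ((w1 @ [cd]) @ (a, b) # w2) v = sgn4 c d a b *s act_word (w1 @ (a, b) # (c, d) # w2) v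
      + (if d = a then 1 else 0) *s act_word (w1 @ (c, b) # w2) v
      - (sgn4 c d a b * (if b = c then 1 else 0)) *s act_word (w1 @ (a, d) # w2) v"
      using E_bracket[OF ix, of "act_word w2 v"]
      by (simp add: act_word_append cd act_word_add act_word_diff act_word_scale)
    show "star_word ((w1 @ [cd]) @ (a, b) # w2) v = sgn4 c d a b *s star_word (w1 @ (a, b) # (c, d) # w2) v
      + (if d = a then 1 else 0) *s star_word (w1 @ (c, b) # w2) v
      - (sgn4 c d a b * (if b = c then 1 else 0)) *s star_word (w1 @ (a, d) # w2) v"
      using st_bracket[OF ix(2,1), of "star_word w1 v"]
      by (simp add: star_word_append cd star_word_add star_word_diff star_word_scale)
  qed (use w ix ix' in auto)
qed

text \<open>
  Induction on the length, by the last letter: a letter from \<open>\<kk>\<close> is absorbed into \<open>l\<close> by the invariance of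
  \<open>B\<close>, one from \<open>\<kk>\<^sub>+\<close> makes both sides vanish, and one from \<open>\<kk>\<^sub>-\<close> is moved to the left end.
\<close>

lemma adjoint_ok: "w \<in> lists (gl_ix p q n) \<Longrightarrow> adjoint_ok w"
proof (induction "length w" arbitrary: w rule: less_induct)
  case less
  show ?case
  proof (cases w rule: rev_cases)
    case Nil
    then show ?thesis by (simp add: adjoint_ok_def)
  next
    case (snoc w' ab)
    obtain a b where ab: "ab = (a, b)" by force
    with less.prems snoc have gl: "(a, b) \<in> gl_ix p q n" and w': "w' \<in> lists (gl_ix p q n)" by auto
    have ok: "adjoint_ok w'" using less.hyps[of w'] snoc w' by simp
    from gl show ?thesis
    proof (cases rule: gl_ix_cases)
      case 1
      have "B l (pr (star_word w l')) = B (pr (act_word w l)) l'" if l: "l \<in> M" "l' \<in> M" for l l'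
      proof -
        have L: "star_word w' l' \<in> L" using w' l by (intro star_word_L M_in_L)
        have "B l (pr (star_word w l')) = B l (E b a (pr (star_word w' l')))"
          using L 1 by (simp add: snoc ab star_word_append st_k[OF 1] pr_k[OF swap_ix(2)[OF 1]])
        also have "\<dots> = B (E a b l) (pr (star_word w' l'))"
          using B_k[OF 1 l(1)] pr_M[OF L] by simp
        also have "\<dots> = B (pr (act_word w l)) l'"
          using ok k_M[OF 1 l(1)] l by (simp add: adjoint_ok_def snoc ab act_word_append)
        finally show ?thesis .
      qed
      then show ?thesis by (simp add: adjoint_ok_def)
    next
      case 2
      have "B l (pr (star_word w l')) = B (pr (act_word w l)) l'" if l: "l \<in> M" "l' \<in> M" for l l'
      proof -
        have L: "star_word w' l' \<in> L" using w' l by (intro star_word_L M_in_L)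
        have "pr (star_word w l') = 0"
          using L kminus_L_Z[OF swap_ix(3)[OF 2] L]
          by (simp add: snoc ab star_word_append st_def subspace_scale subspace_Z)
        then show ?thesis
          using kplus_M[OF 2 l(1)] l by (simp add: snoc ab act_word_append subspace_0 subspace_Z)
      qed
      then show ?thesis by (simp add: adjoint_ok_def)
    next
      case 3
      have "adjoint_ok (w' @ (a, b) # [])"
        by (rule adjoint_ok_move_kminus[OF 3]) (use less.hyps snoc w' in auto)
      then show ?thesis by (simp add: snoc ab)
    qed
  qed
qed

lemma adjoint:
  "w \<in> lists (gl_ix p q n) \<Longrightarrow> l \<in> M \<Longrightarrow> l' \<in> M \<Longrightarrow> B l (pr (star_word w l')) = B (pr (act_word w l)) l'"
  using adjoint_ok by (simp add: adjoint_ok_def)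

text \<open>
  The form is built one argument at a time: \<open>f\<close> is the functional \<open>y \<mapsto> \<langle>x, y\<rangle>\<close>. Its values on words are
  prescribed, and since the words span \<open>L\<close> there is at most one such \<open>f\<close>.
\<close>

definition represents :: "'v \<Rightarrow> ('v \<Rightarrow> complex) \<Rightarrow> bool" where
  "represents x f \<longleftrightarrow> (\<forall>u\<in>L. \<forall>v\<in>L. f (u + v) = f u + f v) \<and> (\<forall>k. \<forall>v\<in>L. f (k *s v) = k * f v) \<and>
     (\<forall>w\<in>lists (gl_ix p q n). \<forall>l\<in>M. f (act_word w l) = B (pr (star_word w x)) l)"

lemma L_induct [consumes 1, case_names zero add]:
  assumes "v \<in> L" and "P 0"
    and "\<And>k w l v. w \<in> lists kminus_ix \<Longrightarrow> w \<in> lists (gl_ix p q n) \<Longrightarrow> l \<in> M \<Longrightarrow> v \<in> L \<Longrightarrow> P v \<Longrightarrow>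
      P (k *s act_word w l + v)"
  shows "P v"
proof -
  have "v \<in> L \<and> P v"
    using assms(1) unfolding L_eq_kminus_words[symmetric]
  proof (induction rule: span_induct_alt)
    case base
    then show ?case using assms(2) by (simp add: span_zero)
  next
    case (step c x y)
    then obtain w l where w: "w \<in> lists kminus_ix" "l \<in> M" "x = act_word w l" unfolding words_on_def by blast
    then have "w \<in> lists (gl_ix p q n)" using lists_mono[OF ix_sub(3)] by blast
    then show ?case
      using step w assms(3)[of w l y c] span_add[OF span_scale[OF span_base[OF step.hyps(1)]], of y c]
      by (simp add: L_eq_kminus_words)
  qed
  then show ?thesis by blast
qed

lemma represents_unique:
  assumes "represents x f" "represents x g" "v \<in> L" shows "f v = g v"
  using assms(3)
proof (induction rule: L_induct)
  case zero
  have "f (0 *s 0) = 0 * f 0" "g (0 *s 0) = 0 * g 0"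
    using assms(1,2) subspace_0[OF subspace_L] unfolding represents_def by blast+
  then show ?case by simp
next
  case (add k w l v)
  have "act_word w l \<in> L" "k *s act_word w l \<in> L"
    using add act_word_L M_in_L subspace_scale[OF subspace_L] by blast+
  with add assms show ?case unfolding represents_def by metis
qed

lemma represents_add:
  assumes "represents x f" "represents y g" "x \<in> L" "y \<in> L"
  shows "represents (k *s x + y) (\<lambda>v. cnj k * f v + g v)"
proof -
  have "B (pr (star_word w (k *s x + y))) l = cnj k * B (pr (star_word w x)) l + B (pr (star_word w y)) l"
    if "w \<in> lists (gl_ix p q n)" "l \<in> M" for w l
    using that assms
    by (simp add: star_word_add star_word_scale pr_add pr_scale star_word_L subspace_scale[OF subspace_L]
        B.form_add_left B.form_scale_left pr_M subspace_scale[OF subspace_M])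
  then show ?thesis using assms(1,2) unfolding represents_def by (auto simp: algebra_simps)
qed

text \<open>
  If \<open>x\<close> is a word applied to the bottom, the functional is given by the same formula with the
  arguments exchanged. The two formulas agree on words by \<open>adjoint\<close>, applied to the word \<open>w'\<^sup>\<star> w\<close>.
\<close>

lemma represents_act_word:
  assumes w: "w \<in> lists (gl_ix p q n)" and l: "l \<in> M"
  shows "represents (act_word w l) (\<lambda>v. B l (pr (star_word w v)))"
  unfolding represents_def
proof (intro conjI ballI allI)
  fix u v assume "u \<in> L" "v \<in> L"
  then show "B l (pr (star_word w (u + v))) = B l (pr (star_word w u)) + B l (pr (star_word w v))"
    using w l by (simp add: star_word_add pr_add star_word_L B.form_add pr_M)
next
  fix k v assume "v \<in> L"
  then show "B l (pr (star_word w (k *s v))) = k * B l (pr (star_word w v))"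
    using w l by (simp add: star_word_scale pr_scale star_word_L B.form_scale pr_M)
next
  fix w' l' assume w': "w' \<in> lists (gl_ix p q n)" and l': "l' \<in> M"
  let ?w = "flip_word w' @ w"
  have gl: "?w \<in> lists (gl_ix p q n)" using flip_word_gl[OF w'] w by simp
  have L: "act_word w' l' \<in> L" "act_word w l \<in> L" "act_word ?w l \<in> L"
    by (intro act_word_L M_in_L w w' l l' gl)+
  have sq: "word_sgn w' * word_sgn w' = 1"
  proof (induction w' rule: list.induct)
    case (Cons ab w')
    then show ?case by (cases ab) (auto simp: block_sgn_def)
  qed simp
  have "B l (pr (star_word ?w l')) = word_sgn w' * B l (pr (star_word w (act_word w' l')))"
    using L w l by (simp add: star_word_append star_flip_word star_word_scale pr_scale star_word_L B.form_scale pr_M)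
  moreover have "star_word w' (act_word w l) = word_sgn w' *s act_word ?w l"
    by (simp add: star_word_eq act_word_append)
  then have "B (pr (star_word w' (act_word w l))) l' = word_sgn w' * B (pr (act_word ?w l)) l'"
    using L l' by (simp add: pr_scale B.form_scale_left pr_M)
  ultimately have "B (pr (star_word w' (act_word w l))) l' =
      (word_sgn w' * word_sgn w') * B l (pr (star_word w (act_word w' l')))"
    using adjoint[OF gl l l'] by simp
  then show "B l (pr (star_word w (act_word w' l'))) = B (pr (star_word w' (act_word w l))) l'"
    unfolding sq by simp
qed

lemma represents_exists: "x \<in> L \<Longrightarrow> \<exists>f. represents x f"
proof (induction rule: L_induct)
  case zero
  show ?case
    by (rule exI[of _ "\<lambda>_. 0"]) (simp add: represents_def subspace_0 subspace_M)
next
  case (add k w l v)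
  then obtain f where f: "represents v f" by blast
  from represents_add[OF represents_act_word f] add show ?case
    using act_word_L M_in_L by blast
qed

definition form :: "'v \<Rightarrow> 'v \<Rightarrow> complex" where "form x = (SOME f. represents x f)"

lemma form_represents: "x \<in> L \<Longrightarrow> represents x (form x)"
  unfolding form_def by (rule someI_ex[OF represents_exists])

lemma form_eqI: "represents x f \<Longrightarrow> x \<in> L \<Longrightarrow> v \<in> L \<Longrightarrow> form x v = f v"
  using represents_unique form_represents by blast

lemma form_act_word: "x \<in> L \<Longrightarrow> w \<in> lists (gl_ix p q n) \<Longrightarrow> l \<in> M \<Longrightarrow> form x (act_word w l) = B (pr (star_word w x)) l"
  using form_represents[of x] unfolding represents_def by blast

lemma form_act_word_left:
  "w \<in> lists (gl_ix p q n) \<Longrightarrow> l \<in> M \<Longrightarrow> v \<in> L \<Longrightarrow> form (act_word w l) v = B l (pr (star_word w v))"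
  using form_eqI[OF represents_act_word] act_word_L M_in_L by blast

sublocale F: hermitian_form scale L form
proof
  show "subspace L" by (rule subspace_L)
  fix u v w k
  assume u: "u \<in> L"
  then show "v \<in> L \<Longrightarrow> w \<in> L \<Longrightarrow> form u (v + w) = form u v + form u w" "v \<in> L \<Longrightarrow> form u (k *s v) = k * form u v"
    using form_represents[of u] unfolding represents_def by blast+
next
  fix u v assume "u \<in> L" "v \<in> L"
  then show "form v u = cnj (form u v)"
  proof (induction u rule: L_induct)
    case zero
    have "represents v (form v)" using form_represents zero by blast
    then have "form v (0 *s 0) = 0 * form v 0" unfolding represents_def using subspace_0[OF subspace_L] by blast
    moreover have "form 0 v = 0"
      using form_eqI[of 0 "\<lambda>_. 0" v] zero subspace_0[OF subspace_L]
      by (simp add: represents_def subspace_0 subspace_M)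
    ultimately show ?case by simp
  next
    case (add k w l u)
    let ?x = "act_word w l"
    have x: "?x \<in> L" "k *s ?x \<in> L" using add act_word_L M_in_L subspace_scale[OF subspace_L] by blast+
    have "form v (k *s ?x + u) = k * form v ?x + form v u"
      using form_represents[OF add.prems] x add.hyps unfolding represents_def by auto
    also have "\<dots> = k * B (pr (star_word w v)) l + cnj (form u v)"
      using add x by (simp add: form_act_word)
    also have "B (pr (star_word w v)) l = cnj (B l (pr (star_word w v)))"
      using add by (intro B.form_herm pr_M star_word_L)
    also have "B l (pr (star_word w v)) = form ?x v"
      using add by (simp add: form_act_word_left)
    also have "k * cnj (form ?x v) + cnj (form u v) = cnj (form (k *s ?x + u) v)"
      using form_eqI[OF represents_add[OF form_represents form_represents], of ?x u k v] x add
        subspace_add[OF subspace_L] by simp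
    finally show ?case .
  qed
qed

text \<open>
  Both sides are functionals of \<open>y\<close> with the values on words that characterize \<open>form (E a b x)\<close>.
\<close>

lemma form_contravariant:
  assumes ab: "(a, b) \<in> gl_ix p q n" and x: "x \<in> L" and y: "y \<in> L"
  shows "form (E a b x) y = form x (st a b y)"
proof (rule form_eqI[OF _ E_L[OF ab x] y])
  show "represents (E a b x) (\<lambda>y. form x (st a b y))"
    unfolding represents_def
  proof (intro conjI ballI allI)
    fix w l assume wl: "w \<in> lists (gl_ix p q n)" "l \<in> M"
    let ?e = "block_sgn a * block_sgn b"
    have "form x (st a b (act_word w l)) = ?e * form x (act_word ((b, a) # w) l)"
      using wl x E_L[OF swap_ix(1)[OF ab] act_word_L[OF wl(1) M_in_L[OF wl(2)]]]
      by (simp add: st_def F.form_scale)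
    also have "form x (act_word ((b, a) # w) l) = B (pr (star_word w (st b a x))) l"
      using form_act_word[OF x, of "(b, a) # w" l] wl swap_ix(1)[OF ab] by simp
    also have "star_word w (st b a x) = ?e *s star_word w (E a b x)"
      by (simp add: st_def star_word_scale mult.commute)
    also have "?e * B (pr (?e *s star_word w (E a b x))) l = ?e * ?e * B (pr (star_word w (E a b x))) l"
      using wl x ab by (simp add: pr_scale star_word_L E_L B.form_scale_left pr_M)
    also have "?e * ?e = 1" by (simp add: ac_simps)
    finally show "form x (st a b (act_word w l)) = B (pr (star_word w (E a b x))) l" by simp
  qed (use ab x in \<open>simp_all add: st_add st_scale F.form_add F.form_scale st_L\<close>)
qed

lemma form_k: "(a, b) \<in> k_ix p q n \<Longrightarrow> x \<in> L \<Longrightarrow> y \<in> L \<Longrightarrow> form (E a b x) y = form x (E b a y)"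
  using form_contravariant[OF k_in_gl] st_k by simp

lemma form_non_k:
  assumes "(a, b) \<in> gl_ix p q n" "(a, b) \<notin> k_ix p q n" "x \<in> L" "y \<in> L"
  shows "form (E a b x) y = - form x (E b a y)"
proof -
  have "block_sgn a * block_sgn b = - 1"
    using assms(1,2) by (auto simp: block_sgn_def k_ix_def)
  then show ?thesis
    using form_contravariant[OF assms(1,3,4)] assms(3) E_L[OF swap_ix(1)[OF assms(1)] assms(4)]
    by (simp add: st_def)
qed

lemma form_M: "x \<in> L \<Longrightarrow> l \<in> M \<Longrightarrow> form x l = B (pr x) l"
  using form_act_word[of x "[]" l] by simp

lemma form_M_Z:
  assumes "y \<in> M" "z \<in> Z" shows "form y z = 0"
proof -
  have y: "y \<in> L" using assms M_in_L by blast
  have "z \<in> Z \<and> form y z = 0"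
    using assms(2) unfolding Z_def
  proof (induction rule: span_induct_alt)
    case base
    then show ?case using y by (simp add: span_zero)
  next
    case (step c x z)
    then obtain w0 l where w0: "w0 \<in> lists kminus_ix" "w0 \<noteq> []" "l \<in> M" "x = act_word w0 l" by blast
    obtain a b w where "w0 = (a, b) # w" using w0(2) by (cases w0) auto
    with w0 have w: "(a, b) # w \<in> lists kminus_ix" "l \<in> M" "x = act_word ((a, b) # w) l" by blast+
    have gl: "(a, b) # w \<in> lists (gl_ix p q n)" using w(1) lists_mono[OF ix_sub(3)] by blast
    have "(a, b) \<in> kminus_ix" using w(1) by simp
    then have "st a b y = 0" using kplus_M[OF swap_ix(4) assms(1)] by (simp add: st_def)
    then have "form y x = 0"
      unfolding w(3) using form_act_word[OF y gl w(2)] w(2) by (simp add: subspace_0 subspace_Z)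
    moreover have "x \<in> L" unfolding w(3) using gl w(2) by (intro act_word_L M_in_L)
    moreover have "z \<in> L" using step Z_L unfolding Z_def by blast
    moreover have "c *s x + z \<in> span {act_word w y |w y. w \<in> lists kminus_ix \<and> w \<noteq> [] \<and> y \<in> M}"
      using step by (intro span_add span_scale) (auto intro: span_base)
    ultimately show ?case using step y by (simp add: F.form_add F.form_scale)
  qed
  then show ?thesis by blast
qed

lemma act_word_of_\<gamma>:
  assumes "w \<in> lists (gl_ix p q n)"
  shows "\<exists>s. act_word w (\<gamma> v) = s *s \<gamma> (act_word w v)"
  using assms
proof (induction w rule: list.induct)
  case Nil
  then show ?case by (intro exI[of _ 1]) simp
next
  case (Cons ab w)
  obtain a b where ab: "ab = (a, b)" by force
  with Cons.prems have gl: "(a, b) \<in> gl_ix p q n" and w: "w \<in> lists (gl_ix p q n)" by simp_all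
  from Cons.IH[OF w] obtain s where "act_word w (\<gamma> v) = s *s \<gamma> (act_word w v)" by blast
  then have "act_word (ab # w) (\<gamma> v) =
      (s * minus1_pow (parity p q a + parity p q b)) *s \<gamma> (act_word (ab # w) v)"
    using gl by (simp add: ab E_\<gamma> E_scale)
  then show ?case by blast
qed

text \<open>
  The vectors all of whose images project to 0 form a graded submodule, which misses \<open>vac\<close> and hence is
  0. It contains the radical because \<open>B\<close> is definite.
\<close>

lemma form_nondegenerate:
  assumes "x \<in> L" "\<And>y. y \<in> L \<Longrightarrow> form x y = 0" shows "x = 0"
proof -
  define N where "N = {x \<in> L. \<forall>w\<in>lists (gl_ix p q n). pr (star_word w x) = 0}"
  have "N = {0} \<or> N = L"
  proof (rule simple_L)
    show "subspace N"
      unfolding N_def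
      by (rule subspaceI)
        (auto simp: star_word_add star_word_scale pr_add pr_scale star_word_L
          subspace_0 subspace_L subspace_add subspace_scale subspace_Z)
    show "E a b v \<in> N" if ab: "(a, b) \<in> gl_ix p q n" and v: "v \<in> N" for a b v
    proof -
      have "pr (star_word w (E a b v)) = 0" if w: "w \<in> lists (gl_ix p q n)" for w
      proof -
        have "E a b v = (block_sgn a * block_sgn b) *s st b a v" by (simp add: st_def ac_simps)
        moreover have "(b, a) # w \<in> lists (gl_ix p q n)"
          using w swap_ix(1)[OF ab] by simp
        then have "pr (star_word ((b, a) # w) v) = 0"
          using v unfolding N_def by blast
        ultimately show ?thesis
          using v ab w swap_ix(1)[OF ab] by (simp add: N_def star_word_scale pr_scale star_word_L st_L)
      qed
      then show ?thesis using v ab E_L by (simp add: N_def)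
    qed
    show "\<gamma> v \<in> N" if v: "v \<in> N" for v
    proof -
      have vL: "v \<in> L" using v by (simp add: N_def)
      have "pr (star_word w (\<gamma> v)) = 0" if w: "w \<in> lists (gl_ix p q n)" for w
      proof -
        obtain s where s: "act_word (flip_word w) (\<gamma> v) = s *s \<gamma> (act_word (flip_word w) v)"
          using act_word_of_\<gamma>[OF flip_word_gl[OF w]] by blast
        have "star_word w (\<gamma> v) = s *s \<gamma> (star_word w v)"
          by (simp add: star_word_eq s \<gamma>_scale mult.commute)
        then show ?thesis
          using v w star_word_L[OF w vL] \<gamma>_L by (simp add: N_def pr_scale pr_\<gamma>)
      qed
      then show ?thesis using vL \<gamma>_L by (simp add: N_def)
    qed
  qed (auto simp: N_def)
  moreover have "vac \<notin> N"
    using vac by (auto simp: N_def intro!: bexI[of _ "[]"])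
  ultimately have N: "N = {0}" using vac M_in_L by blast
  have "pr (star_word w x) = 0" if w: "w \<in> lists (gl_ix p q n)" for w
  proof (rule ccontr)
    define y where "y = pr (star_word w x)"
    assume "pr (star_word w x) \<noteq> 0"
    then have "y \<in> M" "y \<noteq> 0" using pr_M star_word_L[OF w assms(1)] by (auto simp: y_def)
    moreover have "B y y = 0"
      using form_act_word[OF assms(1) w, of y] assms(2) act_word_L[OF w] M_in_L \<open>y \<in> M\<close> by (simp add: y_def)
    ultimately show False using B_pos[of y] by simp
  qed
  then have "x \<in> N" using assms by (simp add: N_def)
  with N show ?thesis by simp
qed

lemma form_Om:
  assumes "u \<in> L" "v \<in> L"
  shows "form u (Om v) = - (\<Sum>a = p + 1..p + q + n. \<Sum>i = 1..p. form (E i a u) (E i a v))"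
proof -
  have "form u (E a i (E i a v)) = - form (E i a u) (E i a v)"
    if "a \<in> {p + 1..p + q + n}" "i \<in> {1..p}" for a i
  proof -
    have "(i, a) \<in> gl_ix p q n" "(i, a) \<notin> k_ix p q n" using that by (auto simp: gl_ix_def k_ix_def)
    then show ?thesis using form_non_k[of i a u "E i a v"] assms E_L by simp
  qed
  then have eq: "(\<Sum>i = 1..p. form u (E a i (E i a v))) = - (\<Sum>i = 1..p. form (E i a u) (E i a v))"
    if "a \<in> {p + 1..p + q + n}" for a
    using that by (simp add: sum_negf)
  have mem: "E a i (E i a v) \<in> L" if "a \<in> {p + 1..p + q + n}" "i \<in> {1..p}" for a i
    using that assms by (intro E_L) (auto simp: gl_ix_def)
  have "form u (Om v) = (\<Sum>a = p + 1..p + q + n. form u (\<Sum>i = 1..p. E a i (E i a v)))"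
    unfolding Om_eq by (intro F.form_sum F.L_closed(6) assms mem)
  also have "\<dots> = (\<Sum>a = p + 1..p + q + n. \<Sum>i = 1..p. form u (E a i (E i a v)))"
    by (intro sum.cong refl F.form_sum assms mem)
  also have "\<dots> = - (\<Sum>a = p + 1..p + q + n. \<Sum>i = 1..p. form (E i a u) (E i a v))"
    by (simp only: eq sum_negf cong: sum.cong)
  finally show ?thesis .
qed

lemma form_Om_adjoint:
  assumes "u \<in> L" "v \<in> L" shows "form (Om u) v = form u (Om v)"
proof -
  have "form (Om u) v = cnj (form v (Om u))" using F.form_herm[of v "Om u"] assms Om_L by simp
  also have "\<dots> = - (\<Sum>a = p + 1..p + q + n. \<Sum>i = 1..p. cnj (form (E i a v) (E i a u)))"
    using form_Om[OF assms(2,1)] by simp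
  also have "\<dots> = - (\<Sum>a = p + 1..p + q + n. \<Sum>i = 1..p. form (E i a u) (E i a v))"
  proof -
    have "cnj (form (E i a v) (E i a u)) = form (E i a u) (E i a v)"
      if "a \<in> {p + 1..p + q + n}" "i \<in> {1..p}" for a i
      using that assms by (intro F.form_herm[symmetric] E_L) (auto simp: gl_ix_def)
    then show ?thesis by simp
  qed
  also have "\<dots> = form u (Om v)" using form_Om[OF assms] by simp
  finally show ?thesis .
qed

lemma wt_spaces_orthogonal:
  assumes "u \<in> wt_space \<xi>" "v \<in> wt_space \<zeta>" "a \<in> ix" "\<xi> a \<noteq> \<zeta> a"
  shows "form u v = 0"
proof (cases "u = 0")
  case True
  then show ?thesis using assms wt_space_L by simp
next
  case False
  then have "cnj (\<xi> a) = \<xi> a"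
    using weights_real[OF \<Lambda>_real assms(1) _ assms(3)] by (simp add: Reals_cnj_iff)
  then have "\<xi> a * form u v = \<zeta> a * form u v"
    using form_k[OF diag_in_k[OF assms(3)], of u v] assms
    by (simp add: wt_space_def F.form_scale F.form_scale_left)
  then show ?thesis using assms(4) by simp
qed

section \<open>Positivity of the contravariant form\<close>

text \<open>
  The operator \<open>- \<Omega>\<close> is selfadjoint on the weight space, and \<open>form v (- \<Omega> v)\<close> is a sum of values
  \<open>form (E\<^sub>i\<^sub>a v) (E\<^sub>i\<^sub>a v)\<close> at vectors of lower level. They do not all vanish: a vector of \<open>Z\<close> killed by \<open>\<kk>\<^sub>+\<close>
  is orthogonal to the bottom and to the image of \<open>\<kk>\<^sub>-\<close>, that is, to everything. It remains to see
  that the eigenvalues of \<open>- \<Omega>\<close> are positive, which is read off at \<open>\<kk>\<close>-highest weight vectors of the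
  eigenspaces.
\<close>

lemma form_pos_Z:
  assumes bound: "\<And>\<xi> u. \<lbrakk>\<xi> \<in> weights p q n; u \<in> wt_space \<xi>; u \<noteq> 0;
      \<And>a b. (a, b) \<in> k_ix p q n \<Longrightarrow> a < b \<Longrightarrow> E a b u = 0\<rbrakk> \<Longrightarrow>
      bil p q n (\<lambda>a. \<Lambda> a - \<xi> a) (\<lambda>a. \<Lambda> a + \<xi> a + 2 * rho p q n a) \<le> 0"
    and \<xi>: "\<xi> \<in> weights p q n" "level \<xi> = of_nat h"
    and lower: "\<And>\<zeta> g v. g < h \<Longrightarrow> \<zeta> \<in> weights p q n \<Longrightarrow> level \<zeta> = of_nat g \<Longrightarrow> v \<in> wt_space \<zeta> \<Longrightarrow>
      v \<noteq> 0 \<Longrightarrow> 0 < form v v"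
    and v: "v \<in> wt_space \<xi>" "v \<in> Z" "v \<noteq> 0"
  shows "0 < form v v"
proof -
  define S where "S = wt_space \<xi> \<inter> Z"
  interpret Om: Vector_Spaces.linear scale scale Om by (rule linear_Om)
  have T: "Vector_Spaces.linear scale scale (\<lambda>v. - Om v)"
    unfolding Vector_Spaces.linear_iff using vector_space_axioms by (auto simp: Om.add Om.scale)
  have SL: "u \<in> L" if "u \<in> S" for u using that by (auto simp: S_def intro: wt_space_L)
  have sub: "subspace S" unfolding S_def by (intro subspace_inter subspace_wt_space subspace_Z)
  have Om_wt: "Om u \<in> wt_space \<xi>" if "u \<in> wt_space \<xi>" for u
    using that Om_L by (auto simp: wt_space_def Om_commutes[OF diag_in_k] Om.scale)
  have Om_Z: "Om u \<in> Z" if "u \<in> L" for u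
    using pr_Z[OF Om_L[OF that]] pr_Om[OF that] by simp
  have kplus: "0 \<le> form (E i a u) (E i a u)" "E i a u \<noteq> 0 \<Longrightarrow> 0 < form (E i a u) (E i a u)"
    if "u \<in> S" "a \<in> {p + 1..p + q + n}" "i \<in> {1..p}" for u a i
  proof -
    have gl: "(i, a) \<in> gl_ix p q n" using that by (auto simp: gl_ix_def)
    have w: "E i a u \<in> wt_space (shift i a \<xi>)" using E_wt_space[OF gl] that by (simp add: S_def)
    show pos: "0 < form (E i a u) (E i a u)" if ne: "E i a u \<noteq> 0"
    proof -
      obtain g where g: "level (shift i a \<xi>) = of_nat g" using level_nat[OF w ne] .
      then have "of_nat g + of_nat a = (of_nat h + of_nat i :: complex)"
        using \<xi>(2) by (simp add: level_shift[OF gl] flip: g)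
      then have "g + a = h + i" by (metis of_nat_add of_nat_eq_iff)
      then have "g < h" using \<open>a \<in> _\<close> \<open>i \<in> _\<close> by simp
      from lower[OF this shift_in_weights[OF gl \<xi>(1)] g w ne] show ?thesis .
    qed
    show "0 \<le> form (E i a u) (E i a u)"
      using pos wt_space_L[OF w] by (cases "E i a u = 0") (auto simp: less_imp_le)
  qed
  have pos: "0 < form u (- Om u)" if u: "u \<in> S" "u \<noteq> 0" for u
  proof -
    have "\<exists>a i. a \<in> {p + 1..p + q + n} \<and> i \<in> {1..p} \<and> E i a u \<noteq> 0"
    proof (rule ccontr)
      assume no: "\<not> ?thesis"
      have "form u y = 0" if "y \<in> L" for y
        using that
      proof (induction rule: L_induct)
        case (add k w l y)
        have "form u (act_word w l) = 0"
        proof (cases w)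
          case Nil
          then show ?thesis using form_M[OF SL[OF u(1)] add.hyps(3)] u add.hyps(3) by (simp add: S_def)
        next
          case (Cons ab w')
          obtain a b where ab: "ab = (a, b)" by force
          with add.hyps Cons have "(a, b) \<in> kminus_ix" by simp
          then have "st a b u = 0" using no by (auto simp: st_def kminus_ix_def gl_ix_def)
          then show ?thesis
            using form_act_word[OF SL[OF u(1)] add.hyps(2,3)] add.hyps(3) by (simp add: Cons ab subspace_0 subspace_Z)
        qed
        moreover have "act_word w l \<in> L" using add.hyps by (intro act_word_L M_in_L)
        ultimately show ?case using add SL[OF u(1)] by (simp add: F.form_add F.form_scale)
      qed (use SL[OF u(1)] in simp)
      then show False using form_nondegenerate[OF SL[OF u(1)]] u(2) by blast
    qed
    then obtain a i where ai: "a \<in> {p + 1..p + q + n}" "i \<in> {1..p}" "E i a u \<noteq> 0" by blast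
    have "0 < (\<Sum>a = p + 1..p + q + n. \<Sum>i = 1..p. form (E i a u) (E i a u))"
    proof (rule sum_pos2[OF _ ai(1)])
      show "0 < (\<Sum>i = 1..p. form (E i a u) (E i a u))"
        using kplus[OF u(1) ai(1)] ai by (intro sum_pos2[OF _ ai(2)]) auto
      show "0 \<le> (\<Sum>i = 1..p. form (E i a u) (E i a u))" if "a \<in> {p + 1..p + q + n}" for a
        using kplus[OF u(1) that] by (intro sum_nonneg)
    qed simp
    then show ?thesis
      using form_Om[OF SL[OF u(1)] SL[OF u(1)]] SL[OF u(1)] Om_L by simp
  qed
  show ?thesis
  proof (rule F.pos_if_selfadjoint_eigenvalues_pos[OF T sub])
    show "S \<subseteq> L" using SL by blast
    show "- Om u \<in> S" if "u \<in> S" for u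
      using that Om_wt Om_Z[OF SL[OF that]] subspace_neg[OF sub, of "Om u"] by (simp add: S_def)
    show "form (- Om u) v = form u (- Om v)" if "u \<in> S" "v \<in> S" for u v
      using form_Om_adjoint[of u v] that SL Om_L by simp
    show "0 < \<mu>" if u: "u \<in> S" "u \<noteq> 0" "- Om u = \<mu> *s u" for u \<mu>
    proof -
      define N where "N = {u \<in> Z. - Om u = \<mu> *s u}"
      have "E a b v \<in> N" if ab: "(a, b) \<in> k_ix p q n" and v: "v \<in> N" for a b v
        using v k_Z[OF ab, of v] Om_commutes[OF ab, of v, symmetric] E_minus[of a b "Om v"]
        by (simp add: N_def E_scale del: E_minus)
      then obtain \<zeta> x where x: "\<zeta> \<in> weights p q n" "x \<in> N" "x \<in> wt_space \<zeta>" "x \<noteq> 0"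
        "\<And>a b. (a, b) \<in> k_ix p q n \<Longrightarrow> a < b \<Longrightarrow> E a b x = 0"
        using k_highest_weight_vector_exists[of N u \<xi>] u \<xi>(1) by (auto simp: N_def S_def)
      let ?b = "bil p q n (\<lambda>a. \<Lambda> a - \<zeta> a) (\<lambda>a. \<Lambda> a + \<zeta> a + 2 * rho p q n a)"
      have "\<mu> *s x = - ((?b / 2) *s x)"
        using Om_on_k_highest_weight_vector[OF x(3,5)] x(2) by (simp add: N_def)
      then have "\<mu> = - (?b / 2)" using x(4) by (metis scale_minus_left scale_right_imp_eq)
      moreover have "?b \<le> 0" using bound[OF x(1,3,4,5)] .
      ultimately have "0 \<le> \<mu>" by (auto simp: less_eq_complex_def)
      moreover have "\<mu> \<noteq> 0"
        using pos[OF u(1,2)] u SL[OF u(1)] by auto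
      ultimately show ?thesis by (simp add: order_less_le)
    qed
    show "S \<subseteq> span ((\<lambda>(w, y). act_word w y) ` ({w \<in> lists lower_ix. word_height w = h} \<times> vacua))"
      using wt_space_sub_span[OF \<xi>(2)] by (auto simp: S_def)
    show "finite ((\<lambda>(w, y). act_word w y) ` ({w \<in> lists lower_ix. word_height w = h} \<times> vacua))"
      using finite_words_of_height by (intro finite_imageI finite_cartesian_product) (simp_all add: vacua_def)
  qed (use v pos in \<open>auto simp: S_def\<close>)
qed

text \<open>
  Weight spaces are orthogonal, and within a weight space the bottom is orthogonal to \<open>Z\<close>. Both parts
  are positive, by the choice of \<open>B\<close> and by the previous lemma.
\<close>

lemma form_pos:
  assumes bound: "\<And>\<xi> u. \<lbrakk>\<xi> \<in> weights p q n; u \<in> wt_space \<xi>; u \<noteq> 0;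
      \<And>a b. (a, b) \<in> k_ix p q n \<Longrightarrow> a < b \<Longrightarrow> E a b u = 0\<rbrakk> \<Longrightarrow>
      bil p q n (\<lambda>a. \<Lambda> a - \<xi> a) (\<lambda>a. \<Lambda> a + \<xi> a + 2 * rho p q n a) \<le> 0"
    and v: "v \<in> L" "v \<noteq> 0"
  shows "0 < form v v"
proof -
  have wt: "0 < form v v" if "\<xi> \<in> weights p q n" "level \<xi> = of_nat h" "v \<in> wt_space \<xi>" "v \<noteq> 0" for h \<xi> v
    using that
  proof (induction h arbitrary: \<xi> v rule: less_induct)
    case (less h)
    define y where "y = pr v"
    define z where "z = v - pr v"
    have L: "v \<in> L" "y \<in> L" "z \<in> L" and y: "y \<in> M" and z: "z \<in> Z"
      using wt_space_L[OF less.prems(3)] pr_M[of v] pr_Z[of v] M_in_L Z_L by (auto simp: y_def z_def)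
    have zw: "z \<in> wt_space \<xi>"
      using less.prems(3) pr_wt_space subspace_wt_space subspace_diff by (auto simp: z_def)
    have "form y z = 0" using form_M_Z[OF y z] .
    moreover from this have "form z y = 0" using F.form_herm[of y z] L by simp
    ultimately have "form v v = form y y + form z z"
      using L F.form_add[of "y + z" y z] F.form_add_left[of y y z] F.form_add_left[of z y z]
      by (simp add: y_def z_def)
    moreover have "0 < form y y" if "y \<noteq> 0"
      using form_M[OF L(2) y] B_pos[OF y that] y by simp
    moreover have "0 < form z z" if "z \<noteq> 0"
    proof (rule form_pos_Z[OF _ less.prems(1,2) _ zw z that])
      show "bil p q n (\<lambda>a. \<Lambda> a - \<zeta> a) (\<lambda>a. \<Lambda> a + \<zeta> a + 2 * rho p q n a) \<le> 0"
        if "\<zeta> \<in> weights p q n" "u \<in> wt_space \<zeta>" "u \<noteq> 0"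
          "\<And>a b. (a, b) \<in> k_ix p q n \<Longrightarrow> a < b \<Longrightarrow> E a b u = 0" for \<zeta> u
        using bound[OF that] .
      show "0 < form x x"
        if "g < h" "\<zeta> \<in> weights p q n" "level \<zeta> = of_nat g" "x \<in> wt_space \<zeta>" "x \<noteq> 0" for \<zeta> g x
        using less.IH[OF that] .
    qed
    moreover have "y \<noteq> 0 \<or> z \<noteq> 0" using less.prems(4) by (auto simp: y_def z_def)
    ultimately show ?case
      using L by (cases "y = 0"; cases "z = 0") (auto intro: add_pos_pos)
  qed
  define V where "V \<xi> = (if \<xi> \<in> weights p q n then wt_space \<xi> else {0})" for \<xi>
  have VL: "V \<xi> \<subseteq> L" for \<xi>
    using wt_space_L subspace_0[OF subspace_L] by (auto simp: V_def)
  show ?thesis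
  proof (rule F.pos_on_orthogonal_sum[of V])
    show "V \<xi> \<subseteq> L" for \<xi> by (rule VL)
    show "subspace (V \<xi>)" for \<xi>
      using subspace_wt_space by (simp add: V_def)
    show "v \<in> span (\<Union>\<xi>. V \<xi>)"
    proof -
      have "(\<Union>\<xi>\<in>weights p q n. wt_space \<xi>) \<subseteq> (\<Union>\<xi>. V \<xi>)" by (auto simp: V_def)
      then show ?thesis using L_sub_sum_of_wt_spaces v(1) span_mono by blast
    qed
    show "form x y = 0" if "\<xi> \<noteq> \<zeta>" "x \<in> V \<xi>" "y \<in> V \<zeta>" for \<xi> \<zeta> x y
    proof (cases "\<xi> \<in> weights p q n \<and> \<zeta> \<in> weights p q n")
      case True
      from that(1) obtain a where a: "\<xi> a \<noteq> \<zeta> a" by auto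
      with True have "a \<in> ix" unfolding weights_def mem_Collect_eq by metis
      moreover from True that have "x \<in> wt_space \<xi>" "y \<in> wt_space \<zeta>" by (simp_all add: V_def)
      ultimately show ?thesis using wt_spaces_orthogonal a by blast
    next
      case False
      with that have "x = 0 \<or> y = 0" by (auto simp: V_def)
      moreover have "x \<in> L" "y \<in> L" using VL that by blast+
      ultimately show ?thesis by auto
    qed
    show "0 < form x x" if "x \<in> V \<xi>" "x \<noteq> 0" for \<xi> x
    proof -
      have *: "\<xi> \<in> weights p q n" "x \<in> wt_space \<xi>" using that by (auto simp: V_def split: if_splits)
      obtain h where "level \<xi> = of_nat h" using level_nat[OF *(2) \<open>x \<noteq> 0\<close>] .
      then show ?thesis using wt * \<open>x \<noteq> 0\<close> by blast
    qed
  qed (use v in auto)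
qed

end

context simple_hw_module
begin

text \<open>
  Evaluate \<open>c u (\<Omega> u)\<close> by the Casimir identity and by contravariance.
\<close>

lemma bil_nonpos_if_unitary:
  assumes "hermitian_form scale L c"
    and pos: "\<And>v. v \<in> L \<Longrightarrow> v \<noteq> 0 \<Longrightarrow> 0 < c v v"
    and adj: "\<And>a b u v. (a, b) \<in> kplus_ix p q n \<Longrightarrow> u \<in> L \<Longrightarrow> v \<in> L \<Longrightarrow> c (E a b u) v = - c u (E b a v)"
    and u: "u \<in> wt_space \<xi>" "u \<noteq> 0" "\<And>a b. (a, b) \<in> k_ix p q n \<Longrightarrow> a < b \<Longrightarrow> E a b u = 0"
  shows "bil p q n (\<lambda>a. \<Lambda> a - \<xi> a) (\<lambda>a. \<Lambda> a + \<xi> a + 2 * rho p q n a) \<le> 0"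
proof -
  interpret c: hermitian_form scale L c by fact
  let ?b = "bil p q n (\<lambda>a. \<Lambda> a - \<xi> a) (\<lambda>a. \<Lambda> a + \<xi> a + 2 * rho p q n a)"
  have uL: "u \<in> L" using u wt_space_L by blast
  have E: "E i a u \<in> L" "c u (E a i (E i a u)) = - c (E i a u) (E i a u)" "E a i (E i a u) \<in> L"
    "0 \<le> c (E i a u) (E i a u)"
    if "a \<in> {p + 1..p + q + n}" "i \<in> {1..p}" for a i
  proof -
    have ix: "(i, a) \<in> kplus_ix p q n" "(i, a) \<in> gl_ix p q n" "(a, i) \<in> gl_ix p q n"
      using that by (auto simp: kplus_ix_def gl_ix_def)
    show L: "E i a u \<in> L" "E a i (E i a u) \<in> L" using ix uL by (auto intro: E_L)
    show "c u (E a i (E i a u)) = - c (E i a u) (E i a u)" using adj[OF ix(1) uL L(1)] by simp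
    show "0 \<le> c (E i a u) (E i a u)" using pos[OF L(1)] L(1) by (cases "E i a u = 0") (auto simp: less_imp_le)
  qed
  have "?b / 2 * c u u = c u (Om u)"
    using Om_on_k_highest_weight_vector[OF u(1,3)] uL by (simp add: c.form_scale)
  also have "\<dots> = - (\<Sum>a = p + 1..p + q + n. \<Sum>i = 1..p. c (E i a u) (E i a u))"
    unfolding Om_eq using E uL by (simp add: c.form_sum sum_negf del: atLeastAtMost_iff)
  finally have eq: "?b * c u u = - 2 * (\<Sum>a = p + 1..p + q + n. \<Sum>i = 1..p. c (E i a u) (E i a u))"
    by (simp add: field_simps)
  have "0 \<le> (\<Sum>a = p + 1..p + q + n. \<Sum>i = 1..p. c (E i a u) (E i a u))"
    using E(4) by (intro sum_nonneg)
  then have "?b * c u u \<le> 0" unfolding eq by (auto simp: less_eq_complex_def)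
  moreover have "0 < c u u" using pos[OF uL u(2)] .
  ultimately show ?thesis
    by (auto simp: less_eq_complex_def less_complex_def mult_le_0_iff)
qed

end

section \<open>Supermodules\<close>

lemma supermodule_module: "supermodule p q S M \<Longrightarrow> Module.module CC M"
  unfolding supermodule_def by (rule conjunct1)

lemma supermodule_grade: "supermodule p q S M \<Longrightarrow> submodule (grade M i) CC M"
  unfolding supermodule_def by (elim conjE) (rule spec)

lemma supermodule_decomposition:
  assumes "supermodule p q S M" "v \<in> carrier M"
  shows "\<exists>!(v0, v1). v0 \<in> grade M 0 \<and> v1 \<in> grade M 1 \<and> v = v0 \<oplus>\<^bsub>M\<^esub> v1"
  using assms(1) unfolding supermodule_def by (elim conjE) (rule bspec[OF _ assms(2)])

lemma supermodule_decomposition_unique: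
  assumes M: "supermodule p q S M" and c: "v0 \<oplus>\<^bsub>M\<^esub> v1 \<in> carrier M"
    and "v0 \<in> grade M 0" "v1 \<in> grade M 1" "w0 \<in> grade M 0" "w1 \<in> grade M 1"
    and "v0 \<oplus>\<^bsub>M\<^esub> v1 = w0 \<oplus>\<^bsub>M\<^esub> w1"
  shows "v0 = w0 \<and> v1 = w1"
proof -
  note the = the1_equality[OF supermodule_decomposition[OF M c]]
  have "(v0, v1) = (w0, w1)"
    using the[of "(v0, v1)"] the[of "(w0, w1)"] assms by simp
  then show ?thesis by simp
qed

lemma
  assumes M: "supermodule p q S M" and ab: "(a, b) \<in> S"
  shows supermodule_act_closed: "v \<in> carrier M \<Longrightarrow> act M a b v \<in> carrier M"
    and supermodule_act_add: "v \<in> carrier M \<Longrightarrow> w \<in> carrier M \<Longrightarrow>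
      act M a b (v \<oplus>\<^bsub>M\<^esub> w) = act M a b v \<oplus>\<^bsub>M\<^esub> act M a b w"
    and supermodule_act_smult: "v \<in> carrier M \<Longrightarrow> act M a b (c \<odot>\<^bsub>M\<^esub> v) = c \<odot>\<^bsub>M\<^esub> act M a b v"
    and supermodule_act_grade: "v \<in> grade M i \<Longrightarrow> act M a b v \<in> grade M (parity p q a + parity p q b + i)"
proof -
  have "\<forall>(a, b) \<in> S.
        (\<forall>v \<in> carrier M. act M a b v \<in> carrier M) \<and>
        (\<forall>v \<in> carrier M. \<forall>w \<in> carrier M. act M a b (v \<oplus>\<^bsub>M\<^esub> w) = act M a b v \<oplus>\<^bsub>M\<^esub> act M a b w) \<and>
        (\<forall>c. \<forall>v \<in> carrier M. act M a b (c \<odot>\<^bsub>M\<^esub> v) = c \<odot>\<^bsub>M\<^esub> act M a b v) \<and>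
        (\<forall>i. \<forall>v \<in> grade M i. act M a b v \<in> grade M (parity p q a + parity p q b + i))"
    using M unfolding supermodule_def by (elim conjE)
  from bspec[OF this ab] show
    "v \<in> carrier M \<Longrightarrow> act M a b v \<in> carrier M"
    "v \<in> carrier M \<Longrightarrow> w \<in> carrier M \<Longrightarrow> act M a b (v \<oplus>\<^bsub>M\<^esub> w) = act M a b v \<oplus>\<^bsub>M\<^esub> act M a b w"
    "v \<in> carrier M \<Longrightarrow> act M a b (c \<odot>\<^bsub>M\<^esub> v) = c \<odot>\<^bsub>M\<^esub> act M a b v"
    "v \<in> grade M i \<Longrightarrow> act M a b v \<in> grade M (parity p q a + parity p q b + i)"
    unfolding prod.case by blast+
qed

lemma supermodule_bracket:
  assumes M: "supermodule p q S M" and ab: "(a, b) \<in> S" "(c, d) \<in> S" and v: "v \<in> carrier M"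
    and s: "s = minus1_pow ((parity p q a + parity p q b) * (parity p q c + parity p q d))"
  shows "act M a b (act M c d v) \<ominus>\<^bsub>M\<^esub> s \<odot>\<^bsub>M\<^esub> act M c d (act M a b v) =
        (if b = c then act M a d v else \<zero>\<^bsub>M\<^esub>) \<ominus>\<^bsub>M\<^esub> s \<odot>\<^bsub>M\<^esub> (if d = a then act M c b v else \<zero>\<^bsub>M\<^esub>)"
proof -
  have "\<forall>(a, b) \<in> S. \<forall>(c, d) \<in> S. \<forall>v \<in> carrier M.
        let s = minus1_pow ((parity p q a + parity p q b) * (parity p q c + parity p q d)) in
        act M a b (act M c d v) \<ominus>\<^bsub>M\<^esub> s \<odot>\<^bsub>M\<^esub> act M c d (act M a b v) =
        (if b = c then act M a d v else \<zero>\<^bsub>M\<^esub>) \<ominus>\<^bsub>M\<^esub> s \<odot>\<^bsub>M\<^esub> (if d = a then act M c b v else \<zero>\<^bsub>M\<^esub>)"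
    using M unfolding supermodule_def by (elim conjE)
  from bspec[OF bspec[OF bspec[OF this ab(1), unfolded prod.case] ab(2), unfolded prod.case] v]
  show ?thesis unfolding s Let_def .
qed

section \<open>Quotient modules\<close>

lemma cring_CC: "cring CC"
  by (rule cring_from_type_algebra)

lemma CC_simps [simp]:
  "carrier CC = UNIV" "\<one>\<^bsub>CC\<^esub> = 1" "\<zero>\<^bsub>CC\<^esub> = 0" "x \<oplus>\<^bsub>CC\<^esub> y = x + y" "x \<otimes>\<^bsub>CC\<^esub> y = x * y"
  by (simp_all add: ring_of_type_algebra_def)

lemma act_quot: "act (quot M H) a b A = (\<Union>x\<in>A. H +>\<^bsub>M\<^esub> act M a b x)"
  by (simp add: quot_def)

locale submodule_quotient =
  fixes M :: "'a glmod" and H :: "'a set"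
  assumes M: "Module.module CC M" and H: "submodule H CC M"
begin

sublocale Module.module CC M by (rule M)

sublocale abelian_subgroup H M
  using H submodule.axioms(1) abelian_group_axioms
  by (intro abelian_subgroupI3 additive_subgroupI) blast+

abbreviation coset :: "'a \<Rightarrow> 'a set" where "coset x \<equiv> H +>\<^bsub>M\<^esub> x"

lemma coset_eq_H_iff: "x \<in> carrier M \<Longrightarrow> coset x = H \<longleftrightarrow> x \<in> H"
  by (metis a_rcos_const a_rcos_self)

lemma quot_carrier: "carrier (quot M H) = coset ` carrier M"
  by (auto simp: quot_def A_RCOSETS_def')

lemma quot_zero: "\<zero>\<^bsub>quot M H\<^esub> = H"
  by (simp add: quot_def)

lemma quot_add: "x \<in> carrier M \<Longrightarrow> y \<in> carrier M \<Longrightarrow> coset x \<oplus>\<^bsub>quot M H\<^esub> coset y = coset (x \<oplus>\<^bsub>M\<^esub> y)"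
  by (simp add: quot_def a_rcos_sum)

text \<open>
  The operations of a quotient are unions over representatives; this makes them independent of the choice.
\<close>

lemma union_of_cosets:
  assumes "x \<in> carrier M" and f: "\<And>y. y \<in> carrier M \<Longrightarrow> f y \<in> carrier M"
    and add: "\<And>h y. h \<in> H \<Longrightarrow> y \<in> carrier M \<Longrightarrow> f (h \<oplus>\<^bsub>M\<^esub> y) = f h \<oplus>\<^bsub>M\<^esub> f y"
    and stable: "\<And>h. h \<in> H \<Longrightarrow> f h \<in> H"
  shows "(\<Union>y\<in>coset x. coset (f y)) = coset (f x)"
proof -
  have "coset (f y) = coset (f x)" if "y \<in> coset x" for y
  proof -
    obtain h where h: "h \<in> H" "y = h \<oplus>\<^bsub>M\<^esub> x" using \<open>y \<in> coset x\<close> by (auto simp: a_r_coset_def')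
    have "f y = f h \<oplus>\<^bsub>M\<^esub> f x" using h add assms(1) by simp
    then have "f y \<in> coset (f x)" using stable[OF h(1)] by (auto simp: a_r_coset_def')
    then show ?thesis using f assms(1) a_repr_independence' by metis
  qed
  moreover have "x \<in> coset x" using a_rcos_self assms(1) by blast
  ultimately show ?thesis by blast
qed

lemma quot_smult: "x \<in> carrier M \<Longrightarrow> c \<odot>\<^bsub>quot M H\<^esub> coset x = coset (c \<odot>\<^bsub>M\<^esub> x)"
  using union_of_cosets[of x "\<lambda>y. c \<odot>\<^bsub>M\<^esub> y"] submodule.smult_closed[OF H, of c]
  by (simp add: quot_def smult_r_distr)

lemma quot_act:
  assumes "x \<in> carrier M" and "\<And>y. y \<in> carrier M \<Longrightarrow> act M a b y \<in> carrier M"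
    and "\<And>y z. y \<in> carrier M \<Longrightarrow> z \<in> carrier M \<Longrightarrow> act M a b (y \<oplus>\<^bsub>M\<^esub> z) = act M a b y \<oplus>\<^bsub>M\<^esub> act M a b z"
    and "\<And>h. h \<in> H \<Longrightarrow> act M a b h \<in> H"
  shows "act (quot M H) a b (coset x) = coset (act M a b x)"
  using union_of_cosets[of x "act M a b"] assms by (simp add: quot_def)

lemma quot_in_carrier: "x \<in> carrier M \<Longrightarrow> coset x \<in> carrier (quot M H)"
  by (simp add: quot_carrier)

lemma quot_cases: "A \<in> carrier (quot M H) \<Longrightarrow> \<exists>x\<in>carrier M. A = coset x"
  by (auto simp: quot_carrier)

lemma quot_is_module: "Module.module CC (quot M H)"
proof (rule moduleI[OF cring_CC])
  let ?Q = "quot M H"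
  have zero: "\<zero>\<^bsub>?Q\<^esub> = coset \<zero>\<^bsub>M\<^esub>" using coset_eq_H_iff[of "\<zero>\<^bsub>M\<^esub>"] by (simp add: quot_zero)
  show "abelian_group ?Q"
  proof (rule abelian_groupI)
    show "\<exists>B\<in>carrier ?Q. B \<oplus>\<^bsub>?Q\<^esub> A = \<zero>\<^bsub>?Q\<^esub>" if A: "A \<in> carrier ?Q" for A
    proof -
      obtain x where x: "x \<in> carrier M" "A = coset x" using quot_cases[OF A] by blast
      then have "coset (\<ominus>\<^bsub>M\<^esub> x) \<oplus>\<^bsub>?Q\<^esub> A = \<zero>\<^bsub>?Q\<^esub>"
        by (simp add: quot_add zero M.l_neg)
      then show ?thesis using quot_in_carrier[of "\<ominus>\<^bsub>M\<^esub> x"] x by blast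
    qed
  qed (auto dest!: quot_cases simp: quot_add quot_in_carrier zero M.a_ac)
qed (auto dest!: quot_cases simp: quot_add quot_smult quot_in_carrier smult_l_distr[simplified] smult_r_distr
    smult_assoc1[simplified] smult_one[simplified])

end


section \<open>The free module on symbols\<close>

lemma tensor_alg_simps [simp]:
  "\<one>\<^bsub>tensor_alg p q n\<^esub> = 1" "\<zero>\<^bsub>tensor_alg p q n\<^esub> = 0"
  "x \<oplus>\<^bsub>tensor_alg p q n\<^esub> y = x + y" "x \<otimes>\<^bsub>tensor_alg p q n\<^esub> y = x * y"
  by (simp_all add: tensor_alg_def ring_of_type_algebra_def)

lemma tensor_alg_carrier:
  "t \<in> carrier (tensor_alg p q n) \<longleftrightarrow> (\<forall>w \<in> Poly_Mapping.keys t. set (letters w) \<subseteq> gl_ix p q n)"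
  by (simp add: tensor_alg_def ring_of_type_algebra_def)

lemma keys_uminus [simp]: "Poly_Mapping.keys (- t) = Poly_Mapping.keys (t :: 'a \<Rightarrow>\<^sub>0 complex)"
  by (auto simp: in_keys_iff)

lemma tensor_alg_closed:
  assumes "s \<in> carrier (tensor_alg p q n)" "t \<in> carrier (tensor_alg p q n)"
  shows "s + t \<in> carrier (tensor_alg p q n)" "s * t \<in> carrier (tensor_alg p q n)"
    "- s \<in> carrier (tensor_alg p q n)" "s - t \<in> carrier (tensor_alg p q n)"
proof -
  have plus: "s + r \<in> carrier (tensor_alg p q n)" if "r \<in> carrier (tensor_alg p q n)" for r
    using assms(1) that keys_add[of s r] unfolding tensor_alg_carrier by blast
  show "s + t \<in> carrier (tensor_alg p q n)" by (rule plus[OF assms(2)])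
  show "s * t \<in> carrier (tensor_alg p q n)"
    using assms keys_mult[of s t] unfolding tensor_alg_carrier by (force simp: plus_word_def)
  show "- s \<in> carrier (tensor_alg p q n)"
    using assms by (simp add: tensor_alg_carrier)
  have "- t \<in> carrier (tensor_alg p q n)"
    using assms by (simp add: tensor_alg_carrier)
  from plus[OF this] show "s - t \<in> carrier (tensor_alg p q n)" by simp
qed

lemma tensor_alg_consts:
  "0 \<in> carrier (tensor_alg p q n)" "1 \<in> carrier (tensor_alg p q n)"
  "Poly_Mapping.single 0 c \<in> carrier (tensor_alg p q n)"
  "(a, b) \<in> gl_ix p q n \<Longrightarrow> gen a b \<in> carrier (tensor_alg p q n)"
  by (auto simp: tensor_alg_carrier zero_word_def gen_def)

lemma ring_tensor_alg: "ring (tensor_alg p q n)"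
proof (rule ringI)
  show "abelian_group (tensor_alg p q n)"
  proof (rule abelian_groupI)
    show "\<exists>t\<in>carrier (tensor_alg p q n). t \<oplus>\<^bsub>tensor_alg p q n\<^esub> s = \<zero>\<^bsub>tensor_alg p q n\<^esub>"
      if "s \<in> carrier (tensor_alg p q n)" for s
      using tensor_alg_closed(3)[OF that that] by (intro bexI[of _ "- s"]) simp_all
  qed (simp_all add: tensor_alg_closed tensor_alg_consts algebra_simps)
  show "Group.monoid (tensor_alg p q n)"
    by (rule monoidI) (simp_all add: tensor_alg_closed tensor_alg_consts algebra_simps)
qed (simp_all add: algebra_simps)

lemma bracket_rels_carrier: "bracket_rels p q n \<subseteq> carrier (tensor_alg p q n)"
proof
  fix t assume "t \<in> bracket_rels p q n"
  then obtain a b c d and s :: tensor where ix: "(a, b) \<in> gl_ix p q n" "(c, d) \<in> gl_ix p q n"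
    and s: "s = minus1_pow ((parity p q a + parity p q b) * (parity p q c + parity p q d))"
    and t: "t = gen a b * gen c d - s * (gen c d * gen a b) -
      ((if b = c then gen a d else 0) - s * (if d = a then gen c b else 0))"
    unfolding bracket_rels_def Let_def by blast
  from s have s: "s = 1 \<or> s = - 1" by (simp add: minus1_pow_def)
  have "s \<in> carrier (tensor_alg p q n)"
    using s tensor_alg_consts(2) tensor_alg_closed(3) by blast
  moreover have "(a, d) \<in> gl_ix p q n" "(c, b) \<in> gl_ix p q n"
    using ix by (auto simp: gl_ix_def)
  ultimately show "t \<in> carrier (tensor_alg p q n)"
    unfolding t using ix by (intro tensor_alg_closed) (simp_all add: tensor_alg_consts)
qed

lemma ideal_bracket_ideal: "ideal (bracket_ideal p q n) (tensor_alg p q n)"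
  unfolding bracket_ideal_def using ring.genideal_ideal[OF ring_tensor_alg bracket_rels_carrier] .

lemma ring_Ugl: "ring (Ugl p q n)"
  unfolding Ugl_def by (rule ideal.quotient_is_ring[OF ideal_bracket_ideal])

lemma Ucls_hom: "Ucls p q n \<in> ring_hom (tensor_alg p q n) (Ugl p q n)"
  using ideal.rcos_ring_hom[OF ideal_bracket_ideal, of p q n]
  by (simp add: Ugl_def Ucls_def[abs_def])

lemma Ucls_simps:
  assumes "s \<in> carrier (tensor_alg p q n)" "t \<in> carrier (tensor_alg p q n)"
  shows "Ucls p q n (s + t) = Ucls p q n s \<oplus>\<^bsub>Ugl p q n\<^esub> Ucls p q n t"
    "Ucls p q n (s * t) = Ucls p q n s \<otimes>\<^bsub>Ugl p q n\<^esub> Ucls p q n t"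
    "Ucls p q n s \<in> carrier (Ugl p q n)" "Ucls p q n 1 = \<one>\<^bsub>Ugl p q n\<^esub>"
  using ring_hom_add[OF Ucls_hom assms] ring_hom_mult[OF Ucls_hom assms] ring_hom_closed[OF Ucls_hom assms(1)]
    ring_hom_one[OF Ucls_hom, of p q n] by simp_all

lemma Ucls_closed: "s \<in> carrier (tensor_alg p q n) \<Longrightarrow> Ucls p q n s \<in> carrier (Ugl p q n)"
  using Ucls_simps(3) by blast

lemma Ugl_carrier: "carrier (Ugl p q n) = Ucls p q n ` carrier (tensor_alg p q n)"
  by (auto simp: Ugl_def FactRing_def A_RCOSETS_def' Ucls_def)

text \<open>The enveloping algebra is spanned by the classes of words, which arise from 1 by left multiplication.\<close>

lemma Ugl_induct [consumes 1, case_names zero one letter scalar add]: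
  assumes "u \<in> carrier (Ugl p q n)"
    and zero: "P \<zero>\<^bsub>Ugl p q n\<^esub>" and one: "P \<one>\<^bsub>Ugl p q n\<^esub>"
    and letter: "\<And>a b u. (a, b) \<in> gl_ix p q n \<Longrightarrow> u \<in> carrier (Ugl p q n) \<Longrightarrow> P u \<Longrightarrow>
      P (Ucls p q n (gen a b) \<otimes>\<^bsub>Ugl p q n\<^esub> u)"
    and scalar: "\<And>c u. u \<in> carrier (Ugl p q n) \<Longrightarrow> P u \<Longrightarrow> P (Uscalar p q n c \<otimes>\<^bsub>Ugl p q n\<^esub> u)"
    and add: "\<And>u v. u \<in> carrier (Ugl p q n) \<Longrightarrow> v \<in> carrier (Ugl p q n) \<Longrightarrow> P u \<Longrightarrow> P v \<Longrightarrow>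
      P (u \<oplus>\<^bsub>Ugl p q n\<^esub> v)"
  shows "P u"
proof -
  let ?T = "carrier (tensor_alg p q n)"
  have mono: "Poly_Mapping.single (Word w) 1 \<in> ?T" if "set w \<subseteq> gl_ix p q n" for w
    using that by (simp add: tensor_alg_carrier)
  have word: "P (Ucls p q n (Poly_Mapping.single (Word w) 1))" if "set w \<subseteq> gl_ix p q n" for w
    using that
  proof (induction w)
    case Nil
    have "Poly_Mapping.single (Word []) 1 = (1 :: tensor)"
      by (simp flip: zero_word_def)
    then show ?case using one Ucls_simps(4)[OF tensor_alg_consts(1,1)] by simp
  next
    case (Cons ab w)
    obtain a b where ab: "ab = (a, b)" by force
    have "Poly_Mapping.single (Word (ab # w)) 1 = gen a b * Poly_Mapping.single (Word w) 1"
      by (simp add: gen_def mult_single plus_word_def ab)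
    then show ?case
      using Cons mono[of w] letter[of a b] by (simp add: ab Ucls_simps tensor_alg_consts)
  qed
  have single: "P (Ucls p q n (Poly_Mapping.single w c))" if "set (letters w) \<subseteq> gl_ix p q n" for w c
  proof -
    have "Poly_Mapping.single w c = Poly_Mapping.single 0 c * Poly_Mapping.single (Word (letters w)) 1"
      by (simp add: mult_single)
    then show ?thesis
      using scalar[of _ c] word[OF that] mono[OF that]
      by (simp add: Ucls_simps tensor_alg_consts Uscalar_def)
  qed
  have sum: "P (Ucls p q n (\<Sum>k\<in>K. Poly_Mapping.single k (f k))) \<and> (\<Sum>k\<in>K. Poly_Mapping.single k (f k)) \<in> ?T"
    if "finite K" "\<And>k. k \<in> K \<Longrightarrow> set (letters k) \<subseteq> gl_ix p q n" for K f
    using that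
  proof (induction K rule: finite_induct)
    case empty
    have "Ucls p q n 0 = \<zero>\<^bsub>Ugl p q n\<^esub>"
      using ring_hom_zero[OF Ucls_hom ring_tensor_alg ring_Ugl, of p q n] by simp
    then show ?case using zero by (simp add: tensor_alg_consts)
  next
    case (insert k K)
    have "Poly_Mapping.single k (f k) \<in> ?T"
      using insert.prems by (auto simp: tensor_alg_carrier split: if_splits)
    then show ?case
      using insert single[of k "f k"] by (simp add: Ucls_simps add tensor_alg_closed)
  qed
  from assms(1) obtain t where t: "t \<in> ?T" "u = Ucls p q n t" by (auto simp: Ugl_carrier)
  have "(\<Sum>k\<in>Poly_Mapping.keys t. Poly_Mapping.single k (Poly_Mapping.lookup t k)) = t"
    by (rule poly_mapping_eqI) (simp add: lookup_sum lookup_single when_def in_keys_iff)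
  then show ?thesis
    using sum[of "Poly_Mapping.keys t" "Poly_Mapping.lookup t"] t by (simp add: tensor_alg_carrier)
qed

definition pscale :: "complex \<Rightarrow> ('a \<Rightarrow>\<^sub>0 complex) \<Rightarrow> 'a \<Rightarrow>\<^sub>0 complex" where
  "pscale c = Poly_Mapping.map ((*) c)"

lemma lookup_pscale [simp]: "Poly_Mapping.lookup (pscale c x) k = c * Poly_Mapping.lookup x k"
  by (simp add: pscale_def map.rep_eq when_def)

lemma keys_pscale: "Poly_Mapping.keys (pscale c x) \<subseteq> Poly_Mapping.keys x"
  by (auto simp: in_keys_iff)

lemma vector_space_pscale: "vector_space pscale"
  by unfold_locales (auto intro!: poly_mapping_eqI simp: lookup_add algebra_simps)

lemma free_mod_simps [simp]:
  "carrier (free_mod p q n M) = {x. Poly_Mapping.keys x \<subseteq> carrier (Ugl p q n) \<times> carrier M}"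
  "\<zero>\<^bsub>free_mod p q n M\<^esub> = 0" "x \<oplus>\<^bsub>free_mod p q n M\<^esub> y = x + y"
  "c \<odot>\<^bsub>free_mod p q n M\<^esub> x = pscale c x"
  by (simp_all add: free_mod_def pscale_def)

lemma free_mod_is_module: "Module.module CC (free_mod p q n M)"
proof (rule moduleI[OF cring_CC])
  interpret vector_space "pscale :: complex \<Rightarrow> (tensor set \<times> 'a \<Rightarrow>\<^sub>0 complex) \<Rightarrow> _"
    by (rule vector_space_pscale)
  show "abelian_group (free_mod p q n M)"
  proof (rule abelian_groupI)
    show "\<exists>y\<in>carrier (free_mod p q n M). y \<oplus>\<^bsub>free_mod p q n M\<^esub> x = \<zero>\<^bsub>free_mod p q n M\<^esub>"
      if "x \<in> carrier (free_mod p q n M)" for x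
      using that by (intro bexI[of _ "- x"]) simp_all
  next
    fix x y assume "x \<in> carrier (free_mod p q n M)" "y \<in> carrier (free_mod p q n M)"
    then show "x \<oplus>\<^bsub>free_mod p q n M\<^esub> y \<in> carrier (free_mod p q n M)"
      using keys_add[of x y] by auto
  qed (simp_all add: algebra_simps)
  fix c x assume "x \<in> carrier (free_mod p q n M)"
  then show "c \<odot>\<^bsub>free_mod p q n M\<^esub> x \<in> carrier (free_mod p q n M)"
    using keys_pscale[of c x] by auto
next
  interpret vector_space "pscale :: complex \<Rightarrow> (tensor set \<times> 'a \<Rightarrow>\<^sub>0 complex) \<Rightarrow> _"
    by (rule vector_space_pscale)
  fix a b :: complex and x y :: "tensor set \<times> 'a \<Rightarrow>\<^sub>0 complex"
  show "(a \<oplus>\<^bsub>CC\<^esub> b) \<odot>\<^bsub>free_mod p q n M\<^esub> x = a \<odot>\<^bsub>free_mod p q n M\<^esub> x \<oplus>\<^bsub>free_mod p q n M\<^esub> b \<odot>\<^bsub>free_mod p q n M\<^esub> x"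
    "a \<odot>\<^bsub>free_mod p q n M\<^esub> (x \<oplus>\<^bsub>free_mod p q n M\<^esub> y) = a \<odot>\<^bsub>free_mod p q n M\<^esub> x \<oplus>\<^bsub>free_mod p q n M\<^esub> a \<odot>\<^bsub>free_mod p q n M\<^esub> y"
    "(a \<otimes>\<^bsub>CC\<^esub> b) \<odot>\<^bsub>free_mod p q n M\<^esub> x = a \<odot>\<^bsub>free_mod p q n M\<^esub> (b \<odot>\<^bsub>free_mod p q n M\<^esub> x)"
    "\<one>\<^bsub>CC\<^esub> \<odot>\<^bsub>free_mod p q n M\<^esub> x = x"
    by (simp_all add: scale_left_distrib scale_right_distrib)
qed

lemma single_eq_symbol: "Poly_Mapping.single (u, v) c = pscale c (tensor_symbol u v)"
  by (rule poly_mapping_eqI) (simp add: tensor_symbol_def lookup_single when_def)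

lemma tensor_symbol_carrier:
  "u \<in> carrier (Ugl p q n) \<Longrightarrow> v \<in> carrier M \<Longrightarrow> tensor_symbol u v \<in> carrier (free_mod p q n M)"
  by (simp add: tensor_symbol_def)

lemma free_mod_act_superset:
  assumes "finite K" "Poly_Mapping.keys x \<subseteq> K"
  shows "act (free_mod p q n M) a b x =
    (\<Sum>k\<in>K. Poly_Mapping.single (Ucls p q n (gen a b) \<otimes>\<^bsub>Ugl p q n\<^esub> fst k, snd k) (Poly_Mapping.lookup x k))"
  unfolding free_mod_def using assms
  by (simp add: case_prod_beta) (rule sum.mono_neutral_left, auto simp: in_keys_iff)

lemma free_mod_act_add:
  "act (free_mod p q n M) a b (x + y) = act (free_mod p q n M) a b x + act (free_mod p q n M) a b y"
proof -
  let ?K = "Poly_Mapping.keys x \<union> Poly_Mapping.keys y"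
  have "Poly_Mapping.keys (x + y) \<subseteq> ?K" using keys_add[of x y] by auto
  then show ?thesis
    by (simp add: free_mod_act_superset[of ?K] lookup_add single_add sum.distrib)
qed

lemma free_mod_act_carrier:
  assumes "(a, b) \<in> gl_ix p q n" "x \<in> carrier (free_mod p q n M)"
  shows "act (free_mod p q n M) a b x \<in> carrier (free_mod p q n M)"
proof -
  let ?f = "\<lambda>k. (Ucls p q n (gen a b) \<otimes>\<^bsub>Ugl p q n\<^esub> fst k, snd k)"
  have "Poly_Mapping.keys (act (free_mod p q n M) a b x) \<subseteq> ?f ` Poly_Mapping.keys x"
    unfolding free_mod_act_superset[OF finite_keys order.refl]
    using keys_sum[of "\<lambda>k. Poly_Mapping.single (?f k) (Poly_Mapping.lookup x k)" "Poly_Mapping.keys x"]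
    by (auto split: if_splits)
  moreover have "Ucls p q n (gen a b) \<in> carrier (Ugl p q n)"
    using Ucls_simps(3) tensor_alg_consts(4)[OF assms(1)] by blast
  then have "?f ` Poly_Mapping.keys x \<subseteq> carrier (Ugl p q n) \<times> carrier M"
    using assms(2) monoid.m_closed[OF ring.is_monoid[OF ring_Ugl]] by auto
  ultimately show ?thesis by simp
qed

lemma free_mod_act_symbol:
  "act (free_mod p q n M) a b (tensor_symbol u v) = tensor_symbol (Ucls p q n (gen a b) \<otimes>\<^bsub>Ugl p q n\<^esub> u) v"
  by (simp add: free_mod_act_superset[of "{(u, v)}"] tensor_symbol_def)

section \<open>The bottom of a quotient of the generalized Verma module\<close>

text \<open>
  A quotient \<open>L\<close> of the module induced from \<open>M\<close>, and the classes in it of the symbols \<open>u \<otimes> v\<close>.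
\<close>

locale induced_quotient =
  fixes p q n :: nat and M :: "'v glmod"
    and N :: "((tensor set \<times> 'v) \<Rightarrow>\<^sub>0 complex) set set"
    and L :: "((tensor set \<times> 'v) \<Rightarrow>\<^sub>0 complex) set set glmod"
  assumes M: "supermodule p q (k_ix p q n) M"
    and N: "subsupermodule (gl_ix p q n) (induced p q n M) N"
    and L: "L = quot (induced p q n M) N"
begin

abbreviation F where "F \<equiv> free_mod p q n M"
abbreviation U where "U \<equiv> Ugl p q n"
abbreviation V where "V \<equiv> induced p q n M"

sublocale F: Module.module CC F
  by (rule free_mod_is_module)

sublocale M: Module.module CC M
  by (rule supermodule_module[OF M])

sublocale U: ring U
  by (rule ring_Ugl)

lemma act_M: "(a, b) \<in> k_ix p q n \<Longrightarrow> v \<in> carrier M \<Longrightarrow> act M a b v \<in> carrier M"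
  by (rule supermodule_act_closed[OF M])

lemma inflated_act_M:
  "(a, b) \<in> k_ix p q n \<union> kplus_ix p q n \<Longrightarrow> v \<in> carrier M \<Longrightarrow> inflated_act p q n M a b v \<in> carrier M"
  by (auto simp: inflated_act_def act_M)

lemma gen_carrier: "(a, b) \<in> k_ix p q n \<union> kplus_ix p q n \<union> gl_ix p q n \<Longrightarrow> Ucls p q n (gen a b) \<in> carrier U"
  by (rule Ucls_closed, rule tensor_alg_consts(4)) (auto simp: k_ix_def kplus_ix_def)

lemma Uscalar_carrier: "Uscalar p q n c \<in> carrier U"
  unfolding Uscalar_def by (rule Ucls_closed[OF tensor_alg_consts(3)])

lemma F_diff: "x \<in> carrier F \<Longrightarrow> y \<in> carrier F \<Longrightarrow> x - y \<in> carrier F"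
  using F.a_closed[of x "- y"] by simp

lemma smult_symbol_carrier:
  "u \<in> carrier U \<Longrightarrow> v \<in> carrier M \<Longrightarrow> c \<odot>\<^bsub>F\<^esub> tensor_symbol u v \<in> carrier F"
  by (rule F.smult_closed[OF _ tensor_symbol_carrier]) (simp_all only: CC_simps UNIV_I)

lemma bilinear_rels_carrier: "bilinear_rels p q n M \<subseteq> carrier F"
  unfolding bilinear_rels_def
proof (intro Un_least subsetI, goal_cases)
  case (1 x)
  then obtain u u' v where x: "x = tensor_symbol (u \<oplus>\<^bsub>U\<^esub> u') v - tensor_symbol u v - tensor_symbol u' v"
    "u \<in> carrier U" "u' \<in> carrier U" "v \<in> carrier M" by blast
  show ?case
    unfolding x(1) by (intro F_diff tensor_symbol_carrier U.a_closed x)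
next
  case (2 x)
  then obtain u v v' where x: "x = tensor_symbol u (v \<oplus>\<^bsub>M\<^esub> v') - tensor_symbol u v - tensor_symbol u v'"
    "u \<in> carrier U" "v \<in> carrier M" "v' \<in> carrier M" by blast
  show ?case
    unfolding x(1) by (intro F_diff tensor_symbol_carrier M.a_closed x)
next
  case (3 x)
  then obtain c u v where x: "x = tensor_symbol (Uscalar p q n c \<otimes>\<^bsub>U\<^esub> u) v - c \<odot>\<^bsub>F\<^esub> tensor_symbol u v"
    "u \<in> carrier U" "v \<in> carrier M" by blast
  show ?case
    unfolding x(1) by (intro F_diff smult_symbol_carrier tensor_symbol_carrier U.m_closed Uscalar_carrier x)
next
  case (4 x)
  then obtain c u v where x: "x = tensor_symbol u (c \<odot>\<^bsub>M\<^esub> v) - c \<odot>\<^bsub>F\<^esub> tensor_symbol u v"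
    "u \<in> carrier U" "v \<in> carrier M" by blast
  have "c \<odot>\<^bsub>M\<^esub> v \<in> carrier M" using x(3) by (intro M.smult_closed) (simp_all only: CC_simps UNIV_I)
  then show ?case
    unfolding x(1) by (intro F_diff smult_symbol_carrier tensor_symbol_carrier x)
qed

lemma balanced_rels_carrier: "balanced_rels p q n M \<subseteq> carrier F"
proof
  fix x assume "x \<in> balanced_rels p q n M"
  then obtain a b u v where x:
      "x = tensor_symbol (u \<otimes>\<^bsub>U\<^esub> Ucls p q n (gen a b)) v - tensor_symbol u (inflated_act p q n M a b v)"
      "(a, b) \<in> k_ix p q n \<union> kplus_ix p q n" "u \<in> carrier U" "v \<in> carrier M"
    unfolding balanced_rels_def by blast
  have "Ucls p q n (gen a b) \<in> carrier U" using x(2) by (intro gen_carrier) (rule UnI1)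
  then show "x \<in> carrier F"
    unfolding x(1) by (intro F_diff tensor_symbol_carrier U.m_closed inflated_act_M x)
qed

lemma relations_subset: "bilinear_rels p q n M \<union> balanced_rels p q n M \<subseteq> tensor_rels p q n M"
  by (auto simp: tensor_rels_def)

lemma submodule_tensor_rels: "submodule (tensor_rels p q n M) CC F"
proof (rule F.submoduleI)
  have "carrier F \<in> {H. submodule H CC F \<and> bilinear_rels p q n M \<union> balanced_rels p q n M \<subseteq> H}"
    using F.carrier_is_submodule bilinear_rels_carrier balanced_rels_carrier by simp
  then show "tensor_rels p q n M \<subseteq> carrier F"
    unfolding tensor_rels_def by blast
  have closed: "\<zero>\<^bsub>F\<^esub> \<in> H \<and> (\<forall>x\<in>H. \<ominus>\<^bsub>F\<^esub> x \<in> H) \<and> (\<forall>x\<in>H. \<forall>y\<in>H. x \<oplus>\<^bsub>F\<^esub> y \<in> H) \<and> (\<forall>c. \<forall>x\<in>H. c \<odot>\<^bsub>F\<^esub> x \<in> H)"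
    if "submodule H CC F" for H
    using F.submoduleE[OF that] subgroup.one_closed[OF submodule.axioms(1)[OF that]] by simp
  show "\<zero>\<^bsub>F\<^esub> \<in> tensor_rels p q n M"
    unfolding tensor_rels_def using closed by blast
  show "\<ominus>\<^bsub>F\<^esub> x \<in> tensor_rels p q n M" if "x \<in> tensor_rels p q n M" for x
    using that closed unfolding tensor_rels_def by blast
  show "x \<oplus>\<^bsub>F\<^esub> y \<in> tensor_rels p q n M" if "x \<in> tensor_rels p q n M" "y \<in> tensor_rels p q n M" for x y
    using that closed unfolding tensor_rels_def by blast
  show "c \<odot>\<^bsub>F\<^esub> x \<in> tensor_rels p q n M" if "x \<in> tensor_rels p q n M" for c x
    using that closed unfolding tensor_rels_def by blast
qed

sublocale FT: submodule_quotient F "tensor_rels p q n M"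
  by (rule submodule_quotient.intro[OF free_mod_is_module submodule_tensor_rels])

sublocale VN: submodule_quotient V N
proof (rule submodule_quotient.intro)
  show "Module.module CC V" unfolding induced_def by (rule FT.quot_is_module)
  show "submodule N CC V" using N unfolding subsupermodule_def by (rule conjunct1)
qed

text \<open>
  The relations are stable under \<open>\<gg>\<ll>\<close>: since \<open>N\<close> is a submodule, an operator sends the zero coset
  to a single coset, which contains 0 and all images of relations.
\<close>

lemma act_N: "(a, b) \<in> gl_ix p q n \<Longrightarrow> v \<in> N \<Longrightarrow> act V a b v \<in> N"
  using N unfolding subsupermodule_def by blast

lemma V_cases: "A \<in> carrier V \<Longrightarrow> \<exists>x\<in>carrier F. A = FT.coset x"
  unfolding induced_def by (rule FT.quot_cases)

lemma V_add: "x \<in> carrier F \<Longrightarrow> y \<in> carrier F \<Longrightarrow> FT.coset x \<oplus>\<^bsub>V\<^esub> FT.coset y = FT.coset (x + y)"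
  unfolding induced_def by (simp only: FT.quot_add free_mod_simps(3))

lemma V_zero: "\<zero>\<^bsub>V\<^esub> = tensor_rels p q n M"
  unfolding induced_def by (rule FT.quot_zero)

lemma tensor_rels_stable:
  assumes ab: "(a, b) \<in> gl_ix p q n" and x: "x \<in> tensor_rels p q n M"
  shows "act F a b x \<in> tensor_rels p q n M"
proof -
  let ?T = "tensor_rels p q n M"
  have xF: "x \<in> carrier F" using x FT.a_subset by blast
  have "act V a b \<zero>\<^bsub>V\<^esub> \<in> N" using act_N[OF ab VN.zero_closed] .
  then have "act V a b ?T \<in> carrier V" unfolding V_zero using VN.a_subset by blast
  then obtain y where y: "y \<in> carrier F" "act V a b ?T = FT.coset y" using V_cases by blast
  have "act V a b ?T = (\<Union>z\<in>?T. FT.coset (act F a b z))"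
    by (simp only: induced_def act_quot)
  with y(2) have Y: "FT.coset y = (\<Union>z\<in>?T. FT.coset (act F a b z))" by (simp only:)
  have sub: "FT.coset (act F a b z) \<subseteq> FT.coset y" if "z \<in> ?T" for z
    unfolding Y using that by (rule UN_upper)
  have T0: "0 \<in> ?T" using FT.zero_closed by simp
  have "act F a b 0 = 0" using free_mod_act_add[of p q n M a b 0 0] by simp
  then have "0 \<in> FT.coset y" using sub[OF T0] FT.a_rcos_self[of 0] by auto
  then have "FT.coset y = FT.coset 0" by (rule FT.a_repr_independence'[OF _ y(1)])
  also have "\<dots> = ?T" using FT.coset_eq_H_iff[of 0] T0 by simp
  finally have "FT.coset (act F a b x) \<subseteq> ?T" using sub[OF x] by simp
  then show ?thesis using FT.a_rcos_self[OF free_mod_act_carrier[OF ab xF]] by blast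
qed

lemma act_V:
  assumes "(a, b) \<in> gl_ix p q n" "x \<in> carrier F"
  shows "act V a b (FT.coset x) = FT.coset (act F a b x)"
  unfolding induced_def
  using assms free_mod_act_carrier tensor_rels_stable
  by (intro FT.quot_act) (simp_all add: free_mod_act_add del: free_mod_simps(1))

definition cl :: "((tensor set \<times> 'v) \<Rightarrow>\<^sub>0 complex) \<Rightarrow> ((tensor set \<times> 'v) \<Rightarrow>\<^sub>0 complex) set set" where
  "cl x = VN.coset (FT.coset x)"

lemma coset_V: "x \<in> carrier F \<Longrightarrow> FT.coset x \<in> carrier V"
  unfolding induced_def by (rule FT.quot_in_carrier)

lemma carrier_L: "carrier L = cl ` carrier F"
  unfolding L VN.quot_carrier unfolding induced_def FT.quot_carrier
  by (simp add: image_image cl_def[abs_def] induced_def del: free_mod_simps)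

lemma cl_add: "x \<in> carrier F \<Longrightarrow> y \<in> carrier F \<Longrightarrow> cl (x + y) = cl x \<oplus>\<^bsub>L\<^esub> cl y"
  unfolding L cl_def by (simp only: VN.quot_add[OF coset_V coset_V] V_add)

lemma cl_smult:
  assumes "x \<in> carrier F" shows "cl (pscale c x) = c \<odot>\<^bsub>L\<^esub> cl x"
proof -
  have "c \<odot>\<^bsub>V\<^esub> FT.coset x = FT.coset (pscale c x)"
    unfolding induced_def FT.quot_smult[OF assms] by (simp only: free_mod_simps)
  then show ?thesis
    unfolding L cl_def VN.quot_smult[OF coset_V[OF assms]] by (simp only:)
qed

lemma cl_relation: "x \<in> tensor_rels p q n M \<Longrightarrow> cl x = \<zero>\<^bsub>L\<^esub>"
proof -
  assume x: "x \<in> tensor_rels p q n M"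
  then have "x \<in> carrier F" using FT.a_subset by blast
  with x have "FT.coset x = \<zero>\<^bsub>V\<^esub>"
    unfolding V_zero by (simp only: FT.coset_eq_H_iff)
  then have "cl x = VN.coset \<zero>\<^bsub>V\<^esub>" by (simp only: cl_def)
  also have "\<dots> = N" using VN.coset_eq_H_iff[OF VN.M.zero_closed] VN.zero_closed by blast
  finally show ?thesis unfolding L VN.quot_zero .
qed

lemma cl_act:
  assumes ab: "(a, b) \<in> gl_ix p q n" and x: "x \<in> carrier F"
  shows "act L a b (cl x) = cl (act F a b x)"
proof -
  have "act L a b (cl x) = VN.coset (act V a b (FT.coset x))"
    unfolding L cl_def
  proof (rule VN.quot_act[OF coset_V[OF x]])
    show "act V a b A \<in> carrier V" if A: "A \<in> carrier V" for A
    proof -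
      obtain y where y: "y \<in> carrier F" "A = FT.coset y" using V_cases[OF A] by blast
      show ?thesis
        unfolding y(2) act_V[OF ab y(1)] by (rule coset_V[OF free_mod_act_carrier[OF ab y(1)]])
    qed
    show "act V a b (A \<oplus>\<^bsub>V\<^esub> B) = act V a b A \<oplus>\<^bsub>V\<^esub> act V a b B" if AB: "A \<in> carrier V" "B \<in> carrier V" for A B
    proof -
      obtain y z where yz: "y \<in> carrier F" "z \<in> carrier F" "A = FT.coset y" "B = FT.coset z"
        using V_cases[OF AB(1)] V_cases[OF AB(2)] by blast
      note act = free_mod_act_carrier[OF ab yz(1)] free_mod_act_carrier[OF ab yz(2)]
      have "y + z \<in> carrier F" using F.a_closed[OF yz(1,2)] by (simp only: free_mod_simps)
      then show ?thesis
        unfolding yz(3,4) V_add[OF yz(1,2)] act_V[OF ab yz(1)] act_V[OF ab yz(2)] V_add[OF act]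
        by (simp only: act_V[OF ab] free_mod_act_add)
    qed
    show "act V a b h \<in> N" if "h \<in> N" for h
      using act_N[OF ab that] .
  qed
  then show ?thesis by (simp add: act_V[OF ab x] cl_def)
qed

lemma L_module: "Module.module CC L"
  unfolding L by (rule VN.quot_is_module)

sublocale L: Module.module CC L
  by (rule L_module)

lemma cl_carrier: "x \<in> carrier F \<Longrightarrow> cl x \<in> carrier L"
  unfolding carrier_L by blast

lemma cl_zero: "cl 0 = \<zero>\<^bsub>L\<^esub>"
  using cl_relation[of 0] FT.zero_closed by simp

definition symbol_class :: "tensor set \<Rightarrow> 'v \<Rightarrow> ((tensor set \<times> 'v) \<Rightarrow>\<^sub>0 complex) set set" where
  "symbol_class u v = cl (tensor_symbol u v)"

lemma symbol_class_carrier: "u \<in> carrier U \<Longrightarrow> v \<in> carrier M \<Longrightarrow> symbol_class u v \<in> carrier L"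
  unfolding symbol_class_def by (intro cl_carrier tensor_symbol_carrier)

lemma cl_eqI:
  assumes "x - y \<in> bilinear_rels p q n M \<union> balanced_rels p q n M" "y \<in> carrier F"
  shows "cl x = cl y"
proof -
  have "x - y \<in> tensor_rels p q n M" using assms(1) relations_subset by blast
  then have "cl ((x - y) + y) = cl y"
    using cl_add[of "x - y" y] cl_relation cl_carrier[OF assms(2)] assms FT.a_subset by auto
  then show ?thesis by simp
qed

lemma symbol_class_add_left:
  assumes "u \<in> carrier U" "u' \<in> carrier U" "v \<in> carrier M"
  shows "symbol_class (u \<oplus>\<^bsub>U\<^esub> u') v = symbol_class u v \<oplus>\<^bsub>L\<^esub> symbol_class u' v"
proof -
  have "tensor_symbol (u \<oplus>\<^bsub>U\<^esub> u') v - (tensor_symbol u v + tensor_symbol u' v)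
      = tensor_symbol (u \<oplus>\<^bsub>U\<^esub> u') v - tensor_symbol u v - tensor_symbol u' v"
    by simp
  then have "tensor_symbol (u \<oplus>\<^bsub>U\<^esub> u') v - (tensor_symbol u v + tensor_symbol u' v) \<in> bilinear_rels p q n M"
    unfolding bilinear_rels_def using assms by blast
  moreover have c: "tensor_symbol u v \<in> carrier F" "tensor_symbol u' v \<in> carrier F"
    by (intro tensor_symbol_carrier assms)+
  moreover have "tensor_symbol u v + tensor_symbol u' v \<in> carrier F" using F.a_closed[OF c] by simp
  ultimately have "symbol_class (u \<oplus>\<^bsub>U\<^esub> u') v = cl (tensor_symbol u v + tensor_symbol u' v)"
    unfolding symbol_class_def using cl_eqI by blast
  then show ?thesis using cl_add[OF c] by (simp add: symbol_class_def)
qed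

lemma symbol_class_add_right:
  assumes "u \<in> carrier U" "v \<in> carrier M" "v' \<in> carrier M"
  shows "symbol_class u (v \<oplus>\<^bsub>M\<^esub> v') = symbol_class u v \<oplus>\<^bsub>L\<^esub> symbol_class u v'"
proof -
  have "tensor_symbol u (v \<oplus>\<^bsub>M\<^esub> v') - (tensor_symbol u v + tensor_symbol u v')
      = tensor_symbol u (v \<oplus>\<^bsub>M\<^esub> v') - tensor_symbol u v - tensor_symbol u v'"
    by simp
  then have "tensor_symbol u (v \<oplus>\<^bsub>M\<^esub> v') - (tensor_symbol u v + tensor_symbol u v') \<in> bilinear_rels p q n M"
    unfolding bilinear_rels_def using assms by blast
  moreover have c: "tensor_symbol u v \<in> carrier F" "tensor_symbol u v' \<in> carrier F"
    by (intro tensor_symbol_carrier assms)+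
  moreover have "tensor_symbol u v + tensor_symbol u v' \<in> carrier F" using F.a_closed[OF c] by simp
  ultimately have "symbol_class u (v \<oplus>\<^bsub>M\<^esub> v') = cl (tensor_symbol u v + tensor_symbol u v')"
    unfolding symbol_class_def using cl_eqI by blast
  then show ?thesis using cl_add[OF c] by (simp add: symbol_class_def)
qed

lemma symbol_class_smult:
  assumes "u \<in> carrier U" "v \<in> carrier M"
  shows "symbol_class (Uscalar p q n c \<otimes>\<^bsub>U\<^esub> u) v = c \<odot>\<^bsub>L\<^esub> symbol_class u v" "symbol_class u (c \<odot>\<^bsub>M\<^esub> v) = c \<odot>\<^bsub>L\<^esub> symbol_class u v"
proof -
  have F: "c \<odot>\<^bsub>F\<^esub> tensor_symbol u v \<in> carrier F"
    by (intro F.smult_closed tensor_symbol_carrier assms) simp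
  have eq: "cl (c \<odot>\<^bsub>F\<^esub> tensor_symbol u v) = c \<odot>\<^bsub>L\<^esub> symbol_class u v"
    using cl_smult[OF tensor_symbol_carrier[OF assms]] by (simp add: symbol_class_def)
  have "tensor_symbol (Uscalar p q n c \<otimes>\<^bsub>U\<^esub> u) v - c \<odot>\<^bsub>F\<^esub> tensor_symbol u v \<in> bilinear_rels p q n M"
    unfolding bilinear_rels_def using assms by blast
  then have "symbol_class (Uscalar p q n c \<otimes>\<^bsub>U\<^esub> u) v = cl (c \<odot>\<^bsub>F\<^esub> tensor_symbol u v)"
    unfolding symbol_class_def by (intro cl_eqI[OF _ F]) blast
  then show "symbol_class (Uscalar p q n c \<otimes>\<^bsub>U\<^esub> u) v = c \<odot>\<^bsub>L\<^esub> symbol_class u v" using eq by simp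
  have "tensor_symbol u (c \<odot>\<^bsub>M\<^esub> v) - c \<odot>\<^bsub>F\<^esub> tensor_symbol u v \<in> bilinear_rels p q n M"
    unfolding bilinear_rels_def using assms by blast
  then have "symbol_class u (c \<odot>\<^bsub>M\<^esub> v) = cl (c \<odot>\<^bsub>F\<^esub> tensor_symbol u v)"
    unfolding symbol_class_def by (intro cl_eqI[OF _ F]) blast
  then show "symbol_class u (c \<odot>\<^bsub>M\<^esub> v) = c \<odot>\<^bsub>L\<^esub> symbol_class u v" using eq by simp
qed

lemma symbol_class_balanced:
  assumes "(a, b) \<in> k_ix p q n \<union> kplus_ix p q n" "u \<in> carrier U" "v \<in> carrier M"
  shows "symbol_class (u \<otimes>\<^bsub>U\<^esub> Ucls p q n (gen a b)) v = symbol_class u (inflated_act p q n M a b v)"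
  unfolding symbol_class_def
proof (rule cl_eqI)
  show "tensor_symbol u (inflated_act p q n M a b v) \<in> carrier F"
    by (intro tensor_symbol_carrier inflated_act_M assms)
  show "tensor_symbol (u \<otimes>\<^bsub>U\<^esub> Ucls p q n (gen a b)) v - tensor_symbol u (inflated_act p q n M a b v)
      \<in> bilinear_rels p q n M \<union> balanced_rels p q n M"
    unfolding balanced_rels_def using assms by blast
qed

lemma act_symbol_class:
  assumes "(a, b) \<in> gl_ix p q n" "u \<in> carrier U" "v \<in> carrier M"
  shows "act L a b (symbol_class u v) = symbol_class (Ucls p q n (gen a b) \<otimes>\<^bsub>U\<^esub> u) v"
  using cl_act[OF assms(1) tensor_symbol_carrier[OF assms(2,3)]] by (simp add: symbol_class_def free_mod_act_symbol)

text \<open>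
  The map \<open>v \<mapsto> 1 \<otimes> v\<close>, whose image is the bottom of \<open>L\<close>.
\<close>

definition bottom :: "'v \<Rightarrow> ((tensor set \<times> 'v) \<Rightarrow>\<^sub>0 complex) set set" where
  "bottom v = symbol_class \<one>\<^bsub>U\<^esub> v"

lemma bottom_carrier: "v \<in> carrier M \<Longrightarrow> bottom v \<in> carrier L"
  by (simp add: bottom_def symbol_class_carrier)

lemma bottom_add: "v \<in> carrier M \<Longrightarrow> w \<in> carrier M \<Longrightarrow> bottom (v \<oplus>\<^bsub>M\<^esub> w) = bottom v \<oplus>\<^bsub>L\<^esub> bottom w"
  by (simp add: bottom_def symbol_class_add_right)

lemma bottom_smult: "v \<in> carrier M \<Longrightarrow> bottom (c \<odot>\<^bsub>M\<^esub> v) = c \<odot>\<^bsub>L\<^esub> bottom v"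
  by (simp add: bottom_def symbol_class_smult)

lemma act_bottom:
  assumes "(a, b) \<in> k_ix p q n \<union> kplus_ix p q n" "v \<in> carrier M"
  shows "act L a b (bottom v) = bottom (inflated_act p q n M a b v)"
proof -
  have gl: "(a, b) \<in> gl_ix p q n" using assms(1) by (auto simp: k_ix_def kplus_ix_def)
  have "Ucls p q n (gen a b) \<in> carrier U" using gen_carrier gl by blast
  then show ?thesis
    unfolding bottom_def using act_symbol_class[OF gl U.one_closed assms(2)] symbol_class_balanced[OF assms(1) U.one_closed assms(2)]
    by simp
qed

lemma act_bottom_k: "(a, b) \<in> k_ix p q n \<Longrightarrow> v \<in> carrier M \<Longrightarrow> act L a b (bottom v) = bottom (act M a b v)"
  using act_bottom[of a b v] by (auto simp: inflated_act_def k_ix_def kplus_ix_def)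

lemma bottom_zero: "bottom \<zero>\<^bsub>M\<^esub> = \<zero>\<^bsub>L\<^esub>"
  using bottom_smult[of "\<zero>\<^bsub>M\<^esub>" 0] bottom_carrier[of "\<zero>\<^bsub>M\<^esub>"] M.smult_l_null L.smult_l_null by simp

lemma act_bottom_kplus: "(a, b) \<in> kplus_ix p q n \<Longrightarrow> v \<in> carrier M \<Longrightarrow> act L a b (bottom v) = \<zero>\<^bsub>L\<^esub>"
  using act_bottom[of a b v] by (simp add: inflated_act_def bottom_zero)

lemma bottom_grade: "v \<in> grade M i \<Longrightarrow> v \<in> carrier M \<Longrightarrow> bottom v \<in> grade L i"
proof -
  assume v: "v \<in> grade M i" "v \<in> carrier M"
  have "\<one>\<^bsub>U\<^esub> = Ucls p q n 1" using Ucls_simps(4)[OF tensor_alg_consts(1,1)] by simp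
  then have "\<one>\<^bsub>U\<^esub> \<in> Ugrade p q n 0"
    unfolding Ugrade_def using tensor_alg_consts(2) by (auto simp: word_parity_def zero_word_def)
  then have "tensor_symbol \<one>\<^bsub>U\<^esub> v \<in> grade F i"
    using v by (auto simp: free_mod_def tensor_symbol_def intro!: exI[of _ 0])
  then show ?thesis
    unfolding L bottom_def symbol_class_def cl_def induced_def quot_def by (simp del: free_mod_simps)
qed

text \<open>
  The bottom generates \<open>L\<close>.
\<close>

lemma L_trivial_if_bottom_trivial:
  assumes bottom: "\<And>v. v \<in> carrier M \<Longrightarrow> bottom v = \<zero>\<^bsub>L\<^esub>"
    and act_zero: "\<And>a b. (a, b) \<in> gl_ix p q n \<Longrightarrow> act L a b \<zero>\<^bsub>L\<^esub> = \<zero>\<^bsub>L\<^esub>"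
  shows "carrier L = {\<zero>\<^bsub>L\<^esub>}"
proof -
  have symbol_class: "\<forall>v\<in>carrier M. symbol_class u v = \<zero>\<^bsub>L\<^esub>" if "u \<in> carrier U" for u
    using that
  proof (induction rule: Ugl_induct)
    case zero
    show ?case
    proof
      fix v assume v: "v \<in> carrier M"
      have "symbol_class \<zero>\<^bsub>U\<^esub> v = symbol_class \<zero>\<^bsub>U\<^esub> v \<oplus>\<^bsub>L\<^esub> symbol_class \<zero>\<^bsub>U\<^esub> v"
        using symbol_class_add_left[of "\<zero>\<^bsub>U\<^esub>" "\<zero>\<^bsub>U\<^esub>" v] v by simp
      then show "symbol_class \<zero>\<^bsub>U\<^esub> v = \<zero>\<^bsub>L\<^esub>"
        using symbol_class_carrier[OF U.zero_closed v] L.M.add.r_cancel_one' by metis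
    qed
  next
    case one
    then show ?case using bottom by (simp add: bottom_def)
  next
    case (letter a b u)
    then show ?case using act_symbol_class[of a b u] act_zero by auto
  next
    case (scalar c u)
    then show ?case by (simp add: symbol_class_smult L.smult_r_null)
  next
    case (add u v)
    then show ?case by (simp add: symbol_class_add_left)
  qed
  have sum: "cl (\<Sum>k\<in>K. Poly_Mapping.single k (f k)) = \<zero>\<^bsub>L\<^esub> \<and> (\<Sum>k\<in>K. Poly_Mapping.single k (f k)) \<in> carrier F"
    if "finite K" "K \<subseteq> carrier U \<times> carrier M" for K f
    using that
  proof (induction K rule: finite_induct)
    case empty
    then show ?case by (simp add: cl_zero)
  next
    case (insert k K)
    obtain u v where k: "k = (u, v)" by force
    with insert have uv: "u \<in> carrier U" "v \<in> carrier M" by auto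
    have s: "Poly_Mapping.single k (f k) \<in> carrier F"
      using uv by (simp add: k)
    have "cl (Poly_Mapping.single k (f k)) = f k \<odot>\<^bsub>L\<^esub> symbol_class u v"
      unfolding k single_eq_symbol symbol_class_def by (rule cl_smult[OF tensor_symbol_carrier[OF uv]])
    also have "\<dots> = \<zero>\<^bsub>L\<^esub>" using symbol_class uv by (simp add: L.smult_r_null)
    finally have z: "cl (Poly_Mapping.single k (f k)) = \<zero>\<^bsub>L\<^esub>" .
    have IH: "cl (\<Sum>k\<in>K. Poly_Mapping.single k (f k)) = \<zero>\<^bsub>L\<^esub>" "(\<Sum>k\<in>K. Poly_Mapping.single k (f k)) \<in> carrier F"
      using insert by auto
    show ?case
      using insert.hyps cl_add[OF s IH(2)] F.a_closed[OF s IH(2)] z IH(1) by simp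
  qed
  have "cl x = \<zero>\<^bsub>L\<^esub>" if "x \<in> carrier F" for x
  proof -
    have "(\<Sum>k\<in>Poly_Mapping.keys x. Poly_Mapping.single k (Poly_Mapping.lookup x k)) = x"
      by (rule poly_mapping_eqI) (simp add: lookup_sum lookup_single when_def in_keys_iff)
    then show ?thesis
      using sum[of "Poly_Mapping.keys x" "Poly_Mapping.lookup x"] that by simp
  qed
  then show ?thesis using cl_carrier[of 0] cl_zero unfolding carrier_L by (auto simp del: free_mod_simps(1))
qed

end

context induced_quotient
begin

text \<open>
  The kernel is a graded \<open>\<kk>\<close>-submodule of the simple module \<open>M\<close>, and it is not all of \<open>M\<close> because the
  bottom generates \<open>L\<close>.
\<close>

lemma bottom_inj:
  assumes simple: "simple_supermodule p q (k_ix p q n) M"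
    and super: "supermodule p q (gl_ix p q n) L" and nontriv: "carrier L \<noteq> {\<zero>\<^bsub>L\<^esub>}"
  shows "inj_on bottom (carrier M)"
proof -
  define K where "K = {v \<in> carrier M. bottom v = \<zero>\<^bsub>L\<^esub>}"
  have neg: "bottom (\<ominus>\<^bsub>M\<^esub> v) = \<ominus>\<^bsub>L\<^esub> bottom v" if v: "v \<in> carrier M" for v
  proof -
    have "bottom (\<ominus>\<^bsub>M\<^esub> v) \<oplus>\<^bsub>L\<^esub> bottom v = \<zero>\<^bsub>L\<^esub>"
      using bottom_add[of "\<ominus>\<^bsub>M\<^esub> v" v] v by (simp add: M.M.l_neg bottom_zero)
    then show ?thesis
      using v bottom_carrier L.M.minus_equality[of "bottom (\<ominus>\<^bsub>M\<^esub> v)" "bottom v"] by simp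
  qed
  have zero: "act L a b \<zero>\<^bsub>L\<^esub> = \<zero>\<^bsub>L\<^esub>" if "(a, b) \<in> gl_ix p q n" for a b
    using supermodule_act_smult[OF super that, of "\<zero>\<^bsub>L\<^esub>" 0] supermodule_act_closed[OF super that, of "\<zero>\<^bsub>L\<^esub>"]
      L.smult_l_null[of "\<zero>\<^bsub>L\<^esub>"] L.smult_l_null[of "act L a b \<zero>\<^bsub>L\<^esub>"] by simp
  have "subsupermodule (k_ix p q n) M K"
    unfolding subsupermodule_def
  proof (intro conjI)
    show "submodule K CC M"
    proof (rule M.submoduleI)
      show "K \<subseteq> carrier M" by (auto simp: K_def)
      show "\<zero>\<^bsub>M\<^esub> \<in> K" by (simp add: K_def bottom_zero)
      show "\<ominus>\<^bsub>M\<^esub> v \<in> K" if "v \<in> K" for v using that by (simp add: K_def neg)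
      show "v \<oplus>\<^bsub>M\<^esub> w \<in> K" if "v \<in> K" "w \<in> K" for v w using that by (simp add: K_def bottom_add)
      show "c \<odot>\<^bsub>M\<^esub> v \<in> K" if "v \<in> K" for c v using that by (simp add: K_def bottom_smult L.smult_r_null)
    qed
    have "act M a b v \<in> K" if ab: "(a, b) \<in> k_ix p q n" and v: "v \<in> K" for a b v
    proof -
      have "(a, b) \<in> gl_ix p q n" using ab by (auto simp: k_ix_def)
      then show ?thesis
        using v act_bottom_k[OF ab, of v, symmetric] act_M[OF ab, of v] zero by (simp add: K_def)
    qed
    then show "\<forall>(a, b)\<in>k_ix p q n. \<forall>v\<in>K. act M a b v \<in> K" by blast
    show "\<forall>v\<in>K. \<exists>v0\<in>K \<inter> grade M 0. \<exists>v1\<in>K \<inter> grade M 1. v = v0 \<oplus>\<^bsub>M\<^esub> v1"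
    proof
      fix v assume v: "v \<in> K"
      then have vM: "v \<in> carrier M" by (simp add: K_def)
      obtain v0 v1 where d: "v0 \<in> grade M 0" "v1 \<in> grade M 1" "v = v0 \<oplus>\<^bsub>M\<^esub> v1"
        using ex1_implies_ex[OF supermodule_decomposition[OF M vM]] by auto
      have c: "v0 \<in> carrier M" "v1 \<in> carrier M"
        using M.submoduleE(1)[OF supermodule_grade[OF M]] d by blast+
      have gr: "bottom v0 \<in> grade L 0" "bottom v1 \<in> grade L 1" using bottom_grade d c by blast+
      have sum: "\<zero>\<^bsub>L\<^esub> = bottom v0 \<oplus>\<^bsub>L\<^esub> bottom v1"
        using v c by (simp add: K_def d(3) bottom_add)
      have z: "\<zero>\<^bsub>L\<^esub> \<in> grade L i" for i
        using subgroup.one_closed[OF submodule.axioms(1)[OF supermodule_grade[OF super]]] by simp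
      have "bottom v0 = \<zero>\<^bsub>L\<^esub> \<and> bottom v1 = \<zero>\<^bsub>L\<^esub>"
        using sum by (intro supermodule_decomposition_unique[OF super _ gr z z]) (simp_all flip: sum)
      then show "\<exists>v0\<in>K \<inter> grade M 0. \<exists>v1\<in>K \<inter> grade M 1. v = v0 \<oplus>\<^bsub>M\<^esub> v1"
        using c d by (intro bexI[of _ v0] bexI[of _ v1]) (simp_all add: K_def)
    qed
  qed
  then have "K = {\<zero>\<^bsub>M\<^esub>} \<or> K = carrier M"
    using simple unfolding simple_supermodule_def by blast
  moreover have "K \<noteq> carrier M"
  proof
    assume "K = carrier M"
    then have triv: "bottom v = \<zero>\<^bsub>L\<^esub>" if "v \<in> carrier M" for v
      using that unfolding K_def by blast
    show False using L_trivial_if_bottom_trivial[OF triv zero] nontriv by blast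
  qed
  ultimately have K: "K = {\<zero>\<^bsub>M\<^esub>}" by blast
  show ?thesis
  proof (rule inj_onI)
    fix v w assume vw: "v \<in> carrier M" "w \<in> carrier M" "bottom v = bottom w"
    then have "bottom (v \<oplus>\<^bsub>M\<^esub> \<ominus>\<^bsub>M\<^esub> w) = \<zero>\<^bsub>L\<^esub>"
      by (simp add: bottom_add neg bottom_carrier L.M.r_neg)
    then have "v \<oplus>\<^bsub>M\<^esub> \<ominus>\<^bsub>M\<^esub> w \<in> K" using vw by (simp add: K_def)
    then have "v \<oplus>\<^bsub>M\<^esub> \<ominus>\<^bsub>M\<^esub> w = \<zero>\<^bsub>M\<^esub>" using K by simp
    then show "v = w" using vw M.M.minus_equality[of v "\<ominus>\<^bsub>M\<^esub> w"] by simp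
  qed
qed

end


section \<open>Realizing a supermodule inside a vector space type\<close>

text \<open>
  A supermodule, given on a carrier set, is embedded by \<open>J\<close> into a vector space type, with retraction
  \<open>P\<close>. Operators on the whole type are obtained by composing with \<open>P\<close> and \<open>J\<close>; since \<open>P (J x) = x\<close>, they satisfy
  the same relations.
\<close>

locale supermodule_in_type = complex_space scale
  for scale :: "complex \<Rightarrow> 'v::ab_group_add \<Rightarrow> 'v" (infixr "*s" 75) +
  fixes p q n :: nat and A :: "'a glmod" and J :: "'a \<Rightarrow> 'v" and P :: "'v \<Rightarrow> 'a"
  assumes A: "supermodule p q (gl_ix p q n) A"
    and P_carrier: "P t \<in> carrier A" and P_add: "P (s + t) = P s \<oplus>\<^bsub>A\<^esub> P t" and P_scale: "P (c *s t) = c \<odot>\<^bsub>A\<^esub> P t"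
    and J_add: "x \<in> carrier A \<Longrightarrow> y \<in> carrier A \<Longrightarrow> J (x \<oplus>\<^bsub>A\<^esub> y) = J x + J y"
    and J_scale: "x \<in> carrier A \<Longrightarrow> J (c \<odot>\<^bsub>A\<^esub> x) = c *s J x"
    and P_J: "x \<in> carrier A \<Longrightarrow> P (J x) = x"

text \<open>
  If \<open>A\<close> is the image of a subspace of the type, then \<open>A\<close> is isomorphic to a complement of the kernel:
  \<open>r\<close> projects to the subspace, \<open>k\<close> projects to the kernel, and \<open>J\<close> sends the class of \<open>t\<close> to \<open>t - k t\<close>.
\<close>

lemma (in complex_space) supermodule_in_type_exists:
  fixes A :: "'a glmod" and cl :: "'v \<Rightarrow> 'a"
  assumes A: "supermodule p q (gl_ix p q n) A" and F: "subspace F" and surj: "carrier A = cl ` F"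
    and add: "\<And>x y. x \<in> F \<Longrightarrow> y \<in> F \<Longrightarrow> cl (x + y) = cl x \<oplus>\<^bsub>A\<^esub> cl y"
    and smult: "\<And>c x. x \<in> F \<Longrightarrow> cl (c *s x) = c \<odot>\<^bsub>A\<^esub> cl x"
  shows "\<exists>J P. supermodule_in_type scale p q n A J P"
proof -
  interpret A: Module.module CC A by (rule supermodule_module[OF A])
  interpret vector_space_pair scale scale by unfold_locales
  have projection: "\<exists>g. (\<forall>x. g x \<in> S) \<and> Vector_Spaces.linear scale scale g \<and> (\<forall>x\<in>S. g x = x)"
    if "subspace S" for S
  proof -
    have "Vector_Spaces.linear scale scale id"
      unfolding Vector_Spaces.linear_iff using vector_space_axioms by simp
    from linear_exists_left_inverse_on[OF this that] show ?thesis by auto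
  qed
  obtain r where r: "\<And>x. r x \<in> F" "Vector_Spaces.linear scale scale r" "\<And>x. x \<in> F \<Longrightarrow> r x = x"
    using projection[OF F] by blast
  interpret r: Vector_Spaces.linear scale scale r by (rule r(2))
  define P where "P t = cl (r t)" for t
  have P: "P t \<in> carrier A" "P (s + t) = P s \<oplus>\<^bsub>A\<^esub> P t" "P (c *s t) = c \<odot>\<^bsub>A\<^esub> P t" for s t c
    using r(1) surj by (auto simp: P_def r.add r.scale add smult)
  define K where "K = {t. P t = \<zero>\<^bsub>A\<^esub>}"
  have "subspace K"
  proof (rule subspaceI)
    have "P (0 *s 0) = \<zero>\<^bsub>A\<^esub>" unfolding P(3) using A.smult_l_null[OF P(1)] by simp
    then show "0 \<in> K" by (simp add: K_def)
  qed (auto simp: K_def P A.smult_r_null)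
  from projection[OF this] obtain k where k: "\<And>x. k x \<in> K" "Vector_Spaces.linear scale scale k" "\<And>x. x \<in> K \<Longrightarrow> k x = x"
    by blast
  interpret k: Vector_Spaces.linear scale scale k by (rule k(2))
  define J where "J x = (let t = SOME t. P t = x in t - k t)" for x
  have P_diff: "P (s - t) = P s \<ominus>\<^bsub>A\<^esub> P t" for s t
  proof -
    have "P (s - t) \<oplus>\<^bsub>A\<^esub> P t = P s" by (simp flip: P(2))
    then show ?thesis using P(1) A.M.add.inv_solve_right[of "P (s - t)" "P s" "P t"] by (simp add: a_minus_def)
  qed
  have J_P: "J (P t) = t - k t" for t
  proof -
    define s where "s = (SOME s. P s = P t)"
    have "P s = P t" unfolding s_def by (rule someI[of _ t]) simp
    then have "s - t \<in> K" using P(1) by (simp add: K_def P_diff a_minus_def A.M.r_neg)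
    from k(3)[OF this] have "s - k s = t - k t" by (simp add: k.diff algebra_simps)
    then show ?thesis by (simp add: J_def s_def Let_def)
  qed
  have P_surj: "\<exists>t. x = P t" if "x \<in> carrier A" for x
  proof -
    obtain t where "t \<in> F" "x = cl t" using \<open>x \<in> carrier A\<close> unfolding surj by blast
    then have "x = P t" using r(3) by (simp add: P_def)
    then show ?thesis by blast
  qed
  have "supermodule_in_type scale p q n A J P"
  proof
    show "supermodule p q (gl_ix p q n) A" by (rule A)
    show "J (x \<oplus>\<^bsub>A\<^esub> y) = J x + J y" if "x \<in> carrier A" "y \<in> carrier A" for x y
      using P_surj[OF that(1)] P_surj[OF that(2)] by (auto simp: J_P k.add simp flip: P(2))
    show "J (c \<odot>\<^bsub>A\<^esub> x) = c *s J x" if "x \<in> carrier A" for c x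
      using P_surj[OF that] by (auto simp: J_P k.scale scale_right_diff_distrib simp flip: P(3))
    show "P (J x) = x" if "x \<in> carrier A" for x
    proof -
      obtain t where t: "x = P t" using P_surj[OF \<open>x \<in> carrier A\<close>] by blast
      have "P (k t) = \<zero>\<^bsub>A\<^esub>" using k(1) by (simp add: K_def)
      then show ?thesis using that by (simp add: t J_P P_diff a_minus_def)
    qed
  qed (fact P)+
  then show ?thesis by blast
qed

context supermodule_in_type
begin

sublocale A: Module.module CC A
  by (rule supermodule_module[OF A])

lemma J_zero: "J \<zero>\<^bsub>A\<^esub> = 0"
  using J_add[of "\<zero>\<^bsub>A\<^esub>" "\<zero>\<^bsub>A\<^esub>"] by simp

lemma J_minus: "x \<in> carrier A \<Longrightarrow> J (\<ominus>\<^bsub>A\<^esub> x) = - J x"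
  using J_add[of "\<ominus>\<^bsub>A\<^esub> x" x] J_zero by (simp add: A.M.l_neg eq_neg_iff_add_eq_0)

lemma J_diff: "x \<in> carrier A \<Longrightarrow> y \<in> carrier A \<Longrightarrow> J (x \<ominus>\<^bsub>A\<^esub> y) = J x - J y"
  by (simp add: a_minus_def J_add J_minus)

lemma J_inj: "x \<in> carrier A \<Longrightarrow> y \<in> carrier A \<Longrightarrow> J x = J y \<longleftrightarrow> x = y"
  using P_J by metis

lemma J_eq_0: "x \<in> carrier A \<Longrightarrow> J x = 0 \<longleftrightarrow> x = \<zero>\<^bsub>A\<^esub>"
  using J_inj[of x "\<zero>\<^bsub>A\<^esub>"] J_zero by simp

definition E :: "nat \<Rightarrow> nat \<Rightarrow> 'v \<Rightarrow> 'v" where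
  "E a b t = (if (a, b) \<in> gl_ix p q n then J (act A a b (P t)) else 0)"

lemma act_carrier: "(a, b) \<in> gl_ix p q n \<Longrightarrow> x \<in> carrier A \<Longrightarrow> act A a b x \<in> carrier A"
  by (rule supermodule_act_closed[OF A])

lemma E_J: "(a, b) \<in> gl_ix p q n \<Longrightarrow> x \<in> carrier A \<Longrightarrow> E a b (J x) = J (act A a b x)"
  by (simp add: E_def P_J)

sublocale gl_operators scale p q n E
proof
  show "E a b (v + w) = E a b v + E a b w" for a b v w
    by (simp add: E_def P_add supermodule_act_add[OF A] P_carrier J_add act_carrier)
  show "E a b (k *s v) = k *s E a b v" for a b k v
    by (simp add: E_def P_scale supermodule_act_smult[OF A] P_carrier J_scale act_carrier)
  fix a b c d v
  assume ab: "(a, b) \<in> gl_ix p q n" and cd: "(c, d) \<in> gl_ix p q n"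
  define s where "s = (minus1_pow ((parity p q a + parity p q b) * (parity p q c + parity p q d)) :: complex)"
  define x where "x = P v"
  have x: "x \<in> carrier A" by (simp add: x_def P_carrier)
  have ix: "(a, d) \<in> gl_ix p q n" "(c, b) \<in> gl_ix p q n" using ab cd by (auto simp: gl_ix_def)
  have move: "x = z + y - w" if "x - z = y - w" for x y z w :: 'v
    using that by (simp add: algebra_simps)
  note c = act_carrier[OF ab] act_carrier[OF cd] act_carrier[OF ix(1)] act_carrier[OF ix(2)]
  have E: "E a' b' v = J (act A a' b' x)" if "(a', b') \<in> gl_ix p q n" for a' b'
    using that by (simp add: E_def x_def)
  have sm: "k \<odot>\<^bsub>A\<^esub> y \<in> carrier A" if "y \<in> carrier A" for k y using that by (simp add: A.smult_closed)
  have cond: "(if b = c then act A a d x else \<zero>\<^bsub>A\<^esub>) \<in> carrier A" "(if d = a then act A c b x else \<zero>\<^bsub>A\<^esub>) \<in> carrier A"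
    using c x by auto
  have "J (act A a b (act A c d x) \<ominus>\<^bsub>A\<^esub> s \<odot>\<^bsub>A\<^esub> act A c d (act A a b x)) =
      J ((if b = c then act A a d x else \<zero>\<^bsub>A\<^esub>) \<ominus>\<^bsub>A\<^esub> s \<odot>\<^bsub>A\<^esub> (if d = a then act A c b x else \<zero>\<^bsub>A\<^esub>))"
    using supermodule_bracket[OF A ab cd x s_def] by simp
  then have "J (act A a b (act A c d x)) - s *s J (act A c d (act A a b x)) =
      J (if b = c then act A a d x else \<zero>\<^bsub>A\<^esub>) - s *s J (if d = a then act A c b x else \<zero>\<^bsub>A\<^esub>)"
    using c x sm cond by (simp add: J_diff J_scale)
  moreover have "J (if b = c then act A a d x else \<zero>\<^bsub>A\<^esub>) = (if b = c then E a d v else 0)"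
    "J (if d = a then act A c b x else \<zero>\<^bsub>A\<^esub>) = (if d = a then E c b v else 0)"
    using E ix J_zero by auto
  moreover have "E a b (E c d v) = J (act A a b (act A c d x))" "E c d (E a b v) = J (act A c d (act A a b x))"
    using E[OF ab] E[OF cd] E_J[OF ab] E_J[OF cd] c x by simp_all
  ultimately have "E a b (E c d v) - s *s E c d (E a b v) =
      (if b = c then E a d v else 0) - s *s (if d = a then E c b v else 0)"
    by (simp only:)
  then show "E a b (E c d v) = minus1_pow ((parity p q a + parity p q b) * (parity p q c + parity p q d)) *s E c d (E a b v)
      + (if b = c then E a d v else 0)
      - minus1_pow ((parity p q a + parity p q b) * (parity p q c + parity p q d)) *s (if d = a then E c b v else 0)"
    unfolding s_def by (rule move)
qed

definition parts :: "'a \<Rightarrow> 'a \<times> 'a" where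
  "parts x = (THE (x0, x1). x0 \<in> grade A 0 \<and> x1 \<in> grade A 1 \<and> x = x0 \<oplus>\<^bsub>A\<^esub> x1)"

lemma grade_carrier: "x \<in> grade A i \<Longrightarrow> x \<in> carrier A"
  using A.submoduleE(1)[OF supermodule_grade[OF A]] by blast

lemma grade_closed:
  "x \<in> grade A i \<Longrightarrow> y \<in> grade A i \<Longrightarrow> x \<oplus>\<^bsub>A\<^esub> y \<in> grade A i" "x \<in> grade A i \<Longrightarrow> c \<odot>\<^bsub>A\<^esub> x \<in> grade A i"
  using A.submoduleE(4,5)[OF supermodule_grade[OF A]] by auto

lemma parts_eq: "x0 \<in> grade A 0 \<Longrightarrow> x1 \<in> grade A 1 \<Longrightarrow> parts (x0 \<oplus>\<^bsub>A\<^esub> x1) = (x0, x1)"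
  unfolding parts_def
  by (rule the1_equality[OF supermodule_decomposition[OF A]]) (auto intro: grade_carrier)

lemma decomposition:
  assumes "x \<in> carrier A"
  obtains x0 x1 where "x0 \<in> grade A 0" "x1 \<in> grade A 1" "x = x0 \<oplus>\<^bsub>A\<^esub> x1"
  using ex1_implies_ex[OF supermodule_decomposition[OF A assms]] by auto

definition \<gamma> :: "'v \<Rightarrow> 'v" where
  "\<gamma> t = J (fst (parts (P t))) - J (snd (parts (P t)))"

lemma \<gamma>_J: "x0 \<in> grade A 0 \<Longrightarrow> x1 \<in> grade A 1 \<Longrightarrow> \<gamma> (J (x0 \<oplus>\<^bsub>A\<^esub> x1)) = J x0 - J x1"
  by (simp add: \<gamma>_def P_J parts_eq grade_carrier)

lemma \<gamma>_P: "x0 \<in> grade A 0 \<Longrightarrow> x1 \<in> grade A 1 \<Longrightarrow> P t = x0 \<oplus>\<^bsub>A\<^esub> x1 \<Longrightarrow> \<gamma> t = J x0 - J x1"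
  by (simp add: \<gamma>_def parts_eq)

lemma \<gamma>_add: "\<gamma> (s + t) = \<gamma> s + \<gamma> t"
proof -
  obtain x0 x1 where x: "x0 \<in> grade A 0" "x1 \<in> grade A 1" "P s = x0 \<oplus>\<^bsub>A\<^esub> x1" using decomposition[OF P_carrier] .
  obtain y0 y1 where y: "y0 \<in> grade A 0" "y1 \<in> grade A 1" "P t = y0 \<oplus>\<^bsub>A\<^esub> y1" using decomposition[OF P_carrier] .
  have "P (s + t) = (x0 \<oplus>\<^bsub>A\<^esub> y0) \<oplus>\<^bsub>A\<^esub> (x1 \<oplus>\<^bsub>A\<^esub> y1)"
    using x y grade_carrier by (simp add: P_add A.M.a_ac)
  from \<gamma>_P[OF _ _ this] have "\<gamma> (s + t) = J (x0 \<oplus>\<^bsub>A\<^esub> y0) - J (x1 \<oplus>\<^bsub>A\<^esub> y1)"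
    using x y grade_closed by blast
  then show ?thesis using x y grade_carrier by (simp add: \<gamma>_P[OF x] \<gamma>_P[OF y] J_add)
qed

lemma \<gamma>_scale: "\<gamma> (c *s t) = c *s \<gamma> t"
proof -
  obtain x0 x1 where x: "x0 \<in> grade A 0" "x1 \<in> grade A 1" "P t = x0 \<oplus>\<^bsub>A\<^esub> x1" using decomposition[OF P_carrier] .
  have "P (c *s t) = (c \<odot>\<^bsub>A\<^esub> x0) \<oplus>\<^bsub>A\<^esub> (c \<odot>\<^bsub>A\<^esub> x1)"
    using x grade_carrier by (simp add: P_scale A.smult_r_distr)
  from \<gamma>_P[OF _ _ this] have "\<gamma> (c *s t) = J (c \<odot>\<^bsub>A\<^esub> x0) - J (c \<odot>\<^bsub>A\<^esub> x1)"
    using x grade_closed by blast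
  then show ?thesis using x grade_carrier by (simp add: \<gamma>_P[OF x] J_scale scale_right_diff_distrib)
qed

definition space :: "'v set" where "space = J ` carrier A"

lemma space_cases: "t \<in> space \<Longrightarrow> \<exists>x\<in>carrier A. t = J x"
  by (auto simp: space_def)

lemma J_in_space: "x \<in> carrier A \<Longrightarrow> J x \<in> space"
  by (auto simp: space_def)

lemma J_P: "t \<in> space \<Longrightarrow> J (P t) = t"
  using P_J by (auto simp: space_def)

lemma subspace_space: "subspace space"
proof (rule subspaceI)
  show "0 \<in> space" using J_in_space[OF A.M.zero_closed] J_zero by simp
  show "s + t \<in> space" if "s \<in> space" "t \<in> space" for s t
    using that space_cases[OF that(1)] space_cases[OF that(2)] J_in_space A.M.a_closed by (metis J_add)
  show "c *s t \<in> space" if t: "t \<in> space" for c t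
  proof -
    obtain x where x: "x \<in> carrier A" "t = J x" using space_cases[OF t] by blast
    then have "c \<odot>\<^bsub>A\<^esub> x \<in> carrier A" by (simp add: A.smult_closed)
    then show ?thesis using J_in_space J_scale[OF x(1), of c] x(2) by metis
  qed
qed

lemma E_space: "E a b t \<in> space"
  using subspace_0[OF subspace_space] by (auto simp: E_def space_def P_carrier act_carrier)

lemma \<gamma>_space: "\<gamma> t \<in> space"
proof -
  obtain x0 x1 where x: "x0 \<in> grade A 0" "x1 \<in> grade A 1" "P t = x0 \<oplus>\<^bsub>A\<^esub> x1" using decomposition[OF P_carrier] .
  show ?thesis
    unfolding \<gamma>_P[OF x] using x grade_carrier by (intro subspace_diff[OF subspace_space] J_in_space)
qed

lemma \<gamma>_\<gamma>: "t \<in> space \<Longrightarrow> \<gamma> (\<gamma> t) = t"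
proof -
  assume t: "t \<in> space"
  obtain x0 x1 where x: "x0 \<in> grade A 0" "x1 \<in> grade A 1" "P t = x0 \<oplus>\<^bsub>A\<^esub> x1" using decomposition[OF P_carrier] .
  have c: "x0 \<in> carrier A" "x1 \<in> carrier A" using x grade_carrier by blast+
  have z: "\<zero>\<^bsub>A\<^esub> \<in> grade A i" for i
    using subgroup.one_closed[OF submodule.axioms(1)[OF supermodule_grade[OF A]]] by simp
  have "\<gamma> (J x0) = J x0" "\<gamma> (J x1) = - J x1"
    using \<gamma>_J[OF x(1) z] \<gamma>_J[OF z x(2)] c J_zero by simp_all
  moreover have "\<gamma> (J x0 - J x1) = \<gamma> (J x0) - \<gamma> (J x1)"
    using \<gamma>_add[of "J x0 - J x1" "J x1"] by (simp add: algebra_simps)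
  moreover have "t = J x0 + J x1" using J_P[OF t] x(3) c by (simp add: J_add)
  ultimately show ?thesis unfolding \<gamma>_P[OF x] by simp
qed

lemma E_\<gamma>:
  assumes ab: "(a, b) \<in> gl_ix p q n"
  shows "E a b (\<gamma> t) = minus1_pow (parity p q a + parity p q b) *s \<gamma> (E a b t)"
proof -
  obtain x0 x1 where x: "x0 \<in> grade A 0" "x1 \<in> grade A 1" "P t = x0 \<oplus>\<^bsub>A\<^esub> x1" using decomposition[OF P_carrier] .
  have c: "x0 \<in> carrier A" "x1 \<in> carrier A" using x grade_carrier by blast+
  have "E a b (\<gamma> t) = J (act A a b x0) - J (act A a b x1)"
    unfolding \<gamma>_P[OF x] E_diff using E_J[OF ab] c by simp
  moreover have "E a b t = J (act A a b x0 \<oplus>\<^bsub>A\<^esub> act A a b x1)"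
    using ab x(3) supermodule_act_add[OF A ab c] by (simp add: E_def)
  moreover have "\<gamma> (J (act A a b x0 \<oplus>\<^bsub>A\<^esub> act A a b x1)) =
      minus1_pow (parity p q a + parity p q b) *s (J (act A a b x0) - J (act A a b x1))"
  proof (cases "parity p q a + parity p q b = 0")
    case True
    then have "act A a b x0 \<in> grade A 0" "act A a b x1 \<in> grade A 1"
      using supermodule_act_grade[OF A ab x(1)] supermodule_act_grade[OF A ab x(2)] by simp_all
    then show ?thesis using \<gamma>_J True by (simp add: minus1_pow_def)
  next
    case False
    then have par: "parity p q a + parity p q b = 1" by simp
    have g: "act A a b x0 \<in> grade A 1" "act A a b x1 \<in> grade A 0"
      using supermodule_act_grade[OF A ab x(1)] supermodule_act_grade[OF A ab x(2)] unfolding par by simp_all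
    have "act A a b x0 \<oplus>\<^bsub>A\<^esub> act A a b x1 = act A a b x1 \<oplus>\<^bsub>A\<^esub> act A a b x0"
      using act_carrier[OF ab] c by (simp add: A.M.a_comm)
    then show ?thesis using \<gamma>_J[OF g(2,1)] unfolding par by (simp add: minus1_pow_def)
  qed
  ultimately show ?thesis by simp
qed

text \<open>
  The homogeneous components of \<open>t\<close> are \<open>(t + \<gamma> t) / 2\<close> and \<open>(t - \<gamma> t) / 2\<close>.
\<close>

lemma graded_if_\<gamma>_stable:
  assumes N: "subspace N" "\<And>t. t \<in> N \<Longrightarrow> \<gamma> t \<in> N"
    and x: "x0 \<in> grade A 0" "x1 \<in> grade A 1" "J (x0 \<oplus>\<^bsub>A\<^esub> x1) \<in> N"
  shows "J x0 \<in> N" "J x1 \<in> N"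
proof -
  have c: "x0 \<in> carrier A" "x1 \<in> carrier A" using x grade_carrier by blast+
  have s: "J x0 + J x1 \<in> N" "J x0 - J x1 \<in> N"
    using x N(2)[OF x(3)] \<gamma>_J[OF x(1,2)] c by (simp_all add: J_add)
  have "(1 / 2) *s ((J x0 + J x1) + (J x0 - J x1)) = J x0" "(1 / 2) *s ((J x0 + J x1) - (J x0 - J x1)) = J x1"
    by (simp_all add: scale_right_distrib scale_right_diff_distrib flip: scale_left_distrib)
  then show "J x0 \<in> N" "J x1 \<in> N"
    using subspace_scale[OF N(1) subspace_add[OF N(1) s], of "1 / 2"]
      subspace_scale[OF N(1) subspace_diff[OF N(1) s], of "1 / 2"] by simp_all
qed

lemma simple_space:
  assumes simple: "simple_supermodule p q (gl_ix p q n) A"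
    and N: "subspace N" "N \<subseteq> space" "\<And>a b v. (a, b) \<in> gl_ix p q n \<Longrightarrow> v \<in> N \<Longrightarrow> E a b v \<in> N"
      "\<And>v. v \<in> N \<Longrightarrow> \<gamma> v \<in> N"
  shows "N = {0} \<or> N = space"
proof -
  define K where "K = {x \<in> carrier A. J x \<in> N}"
  have "subsupermodule (gl_ix p q n) A K"
    unfolding subsupermodule_def
  proof (intro conjI)
    show "submodule K CC A"
      by (rule A.submoduleI)
        (auto simp: K_def J_zero J_minus J_add J_scale N subspace_0 subspace_neg subspace_add subspace_scale)
    have "act A a b v \<in> K" if ab: "(a, b) \<in> gl_ix p q n" and v: "v \<in> K" for a b v
      using N(3)[OF ab, of "J v"] v E_J[OF ab, of v] act_carrier[OF ab, of v] by (simp add: K_def)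
    then show "\<forall>(a, b)\<in>gl_ix p q n. \<forall>v\<in>K. act A a b v \<in> K" by blast
    show "\<forall>v\<in>K. \<exists>v0\<in>K \<inter> grade A 0. \<exists>v1\<in>K \<inter> grade A 1. v = v0 \<oplus>\<^bsub>A\<^esub> v1"
    proof
      fix v assume v: "v \<in> K"
      then obtain x0 x1 where x: "x0 \<in> grade A 0" "x1 \<in> grade A 1" "v = x0 \<oplus>\<^bsub>A\<^esub> x1"
        using decomposition by (auto simp: K_def)
      then show "\<exists>v0\<in>K \<inter> grade A 0. \<exists>v1\<in>K \<inter> grade A 1. v = v0 \<oplus>\<^bsub>A\<^esub> v1"
        using v graded_if_\<gamma>_stable[OF N(1,4) x(1,2)] grade_carrier
        by (intro bexI[of _ x0] bexI[of _ x1]) (simp_all add: K_def)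
    qed
  qed
  then have "K = {\<zero>\<^bsub>A\<^esub>} \<or> K = carrier A"
    using simple unfolding simple_supermodule_def by blast
  moreover have "N = J ` K" using N(2) by (auto simp: K_def space_def)
  ultimately show ?thesis by (auto simp: J_zero space_def)
qed

end

lemma simple_supermodule_is_supermodule: "simple_supermodule p q S M \<Longrightarrow> supermodule p q S M"
  unfolding simple_supermodule_def by (rule conjunct1)

lemma pos_def_hermitian_formD:
  assumes "pos_def_hermitian_form M H"
  shows "\<lbrakk>u \<in> carrier M; v \<in> carrier M; w \<in> carrier M\<rbrakk> \<Longrightarrow> H u (v \<oplus>\<^bsub>M\<^esub> w) = H u v + H u w"
    and "\<lbrakk>u \<in> carrier M; v \<in> carrier M\<rbrakk> \<Longrightarrow> H u (c \<odot>\<^bsub>M\<^esub> v) = c * H u v"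
    and "\<lbrakk>u \<in> carrier M; v \<in> carrier M\<rbrakk> \<Longrightarrow> H v u = cnj (H u v)"
    and "\<lbrakk>v \<in> carrier M; v \<noteq> \<zero>\<^bsub>M\<^esub>\<rbrakk> \<Longrightarrow> 0 < H v v"
proof -
  note h = assms[unfolded pos_def_hermitian_form_def]
  note add = h[THEN conjunct1] and smult = h[THEN conjunct2, THEN conjunct1]
    and herm = h[THEN conjunct2, THEN conjunct2, THEN conjunct1]
    and pos = h[THEN conjunct2, THEN conjunct2, THEN conjunct2]
  show "\<lbrakk>u \<in> carrier M; v \<in> carrier M; w \<in> carrier M\<rbrakk> \<Longrightarrow> H u (v \<oplus>\<^bsub>M\<^esub> w) = H u v + H u w"
    using add by blast
  show "\<lbrakk>u \<in> carrier M; v \<in> carrier M\<rbrakk> \<Longrightarrow> H u (c \<odot>\<^bsub>M\<^esub> v) = c * H u v"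
    using smult by blast
  show "\<lbrakk>u \<in> carrier M; v \<in> carrier M\<rbrakk> \<Longrightarrow> H v u = cnj (H u v)"
    using herm by blast
  show "\<lbrakk>v \<in> carrier M; v \<noteq> \<zero>\<^bsub>M\<^esub>\<rbrakk> \<Longrightarrow> 0 < H v v"
    using pos by blast
qed

section \<open>The bottom inside the realization\<close>

locale realized_quotient =
  induced_quotient p q n M N L + S: supermodule_in_type pscale p q n L J P
  for p q n :: nat and M :: "'v glmod"
    and N :: "((tensor set \<times> 'v) \<Rightarrow>\<^sub>0 complex) set set"
    and L :: "((tensor set \<times> 'v) \<Rightarrow>\<^sub>0 complex) set set glmod"
    and J :: "((tensor set \<times> 'v) \<Rightarrow>\<^sub>0 complex) set set \<Rightarrow> (tensor set \<times> 'v) \<Rightarrow>\<^sub>0 complex"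
    and P :: "((tensor set \<times> 'v) \<Rightarrow>\<^sub>0 complex) \<Rightarrow> ((tensor set \<times> 'v) \<Rightarrow>\<^sub>0 complex) set set" +
  assumes simple_bottom: "simple_supermodule p q (k_ix p q n) M"
    and simple_L: "simple_supermodule p q (gl_ix p q n) L"
begin

text \<open>
  The embedding of \<open>L\<^sub>0\<close> as the bottom of the realization.
\<close>

definition emb :: "'v \<Rightarrow> (tensor set \<times> 'v) \<Rightarrow>\<^sub>0 complex" where
  "emb v = J (bottom v)"

lemma super_L: "supermodule p q (gl_ix p q n) L"
  by (rule simple_supermodule_is_supermodule[OF simple_L])

lemma emb_add: "v \<in> carrier M \<Longrightarrow> w \<in> carrier M \<Longrightarrow> emb (v \<oplus>\<^bsub>M\<^esub> w) = emb v + emb w"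
  by (simp add: emb_def bottom_add bottom_carrier S.J_add)

lemma emb_scale: "v \<in> carrier M \<Longrightarrow> emb (c \<odot>\<^bsub>M\<^esub> v) = pscale c (emb v)"
  by (simp add: emb_def bottom_smult bottom_carrier S.J_scale)

lemma emb_zero: "emb \<zero>\<^bsub>M\<^esub> = 0"
  by (simp add: emb_def bottom_zero S.J_zero)

lemma emb_minus: "v \<in> carrier M \<Longrightarrow> emb (\<ominus>\<^bsub>M\<^esub> v) = - emb v"
  using emb_add[of "\<ominus>\<^bsub>M\<^esub> v" v] emb_zero by (simp add: M.M.l_neg eq_neg_iff_add_eq_0)

lemma emb_inj: "inj_on emb (carrier M)"
proof (rule inj_onI)
  have nontriv: "carrier L \<noteq> {\<zero>\<^bsub>L\<^esub>}"
    using simple_L unfolding simple_supermodule_def by blast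
  fix v w assume vw: "v \<in> carrier M" "w \<in> carrier M" "emb v = emb w"
  then have "bottom v = bottom w"
    using S.J_inj[OF bottom_carrier bottom_carrier] by (simp add: emb_def)
  then show "v = w"
    using inj_onD[OF bottom_inj[OF simple_bottom super_L nontriv]] vw by blast
qed

lemma emb_eq_0: "v \<in> carrier M \<Longrightarrow> emb v = 0 \<longleftrightarrow> v = \<zero>\<^bsub>M\<^esub>"
  using inj_onD[OF emb_inj, of v "\<zero>\<^bsub>M\<^esub>"] emb_zero by auto

lemma k_in_gl: "(a, b) \<in> k_ix p q n \<Longrightarrow> (a, b) \<in> gl_ix p q n"
  by (simp add: k_ix_def)

lemma E_emb_k: "(a, b) \<in> k_ix p q n \<Longrightarrow> v \<in> carrier M \<Longrightarrow> S.E a b (emb v) = emb (act M a b v)"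
  unfolding emb_def by (simp only: S.E_J[OF k_in_gl bottom_carrier] act_bottom_k)

lemma E_emb_kplus: "(a, b) \<in> kplus_ix p q n \<Longrightarrow> v \<in> carrier M \<Longrightarrow> S.E a b (emb v) = 0"
proof -
  assume ab: "(a, b) \<in> kplus_ix p q n" and v: "v \<in> carrier M"
  have gl: "(a, b) \<in> gl_ix p q n" using ab by (simp add: kplus_ix_def)
  show ?thesis
    unfolding emb_def S.E_J[OF gl bottom_carrier[OF v]] act_bottom_kplus[OF ab v] by (rule S.J_zero)
qed

definition bottom_space :: "((tensor set \<times> 'v) \<Rightarrow>\<^sub>0 complex) set" where "bottom_space = emb ` carrier M"

lemma emb_in_bottom_space: "v \<in> carrier M \<Longrightarrow> emb v \<in> bottom_space"
  by (simp add: bottom_space_def)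

lemma bottom_space_cases: "t \<in> bottom_space \<Longrightarrow> \<exists>v\<in>carrier M. t = emb v"
  by (auto simp: bottom_space_def)

lemma bottom_space_subset: "bottom_space \<subseteq> S.space"
  by (auto simp: bottom_space_def emb_def intro: S.J_in_space bottom_carrier)

lemma subspace_bottom_space: "S.subspace bottom_space"
proof (rule S.subspaceI)
  show "0 \<in> bottom_space" using emb_in_bottom_space[OF M.M.zero_closed] emb_zero by simp
  show "s + t \<in> bottom_space" if st: "s \<in> bottom_space" "t \<in> bottom_space" for s t
  proof -
    obtain v w where "v \<in> carrier M" "w \<in> carrier M" "s = emb v" "t = emb w"
      using bottom_space_cases[OF st(1)] bottom_space_cases[OF st(2)] by blast
    then show ?thesis using emb_in_bottom_space[OF M.M.a_closed, of v w] emb_add by simp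
  qed
  show "pscale c t \<in> bottom_space" if t: "t \<in> bottom_space" for c t
  proof -
    obtain v where v: "v \<in> carrier M" "t = emb v" using bottom_space_cases[OF t] by blast
    then have "c \<odot>\<^bsub>M\<^esub> v \<in> carrier M" by (simp add: M.smult_closed)
    then show ?thesis using emb_in_bottom_space v by (metis emb_scale)
  qed
qed

lemma grade_M: "v \<in> grade M i \<Longrightarrow> v \<in> carrier M"
  using M.submoduleE(1)[OF supermodule_grade[OF M]] by blast

lemma M_decomposition:
  assumes "v \<in> carrier M"
  obtains v0 v1 where "v0 \<in> grade M 0" "v1 \<in> grade M 1" "v = v0 \<oplus>\<^bsub>M\<^esub> v1"
  using ex1_implies_ex[OF supermodule_decomposition[OF M assms]] by auto

lemma emb_sum: "v0 \<in> grade M 0 \<Longrightarrow> v1 \<in> grade M 1 \<Longrightarrow> emb (v0 \<oplus>\<^bsub>M\<^esub> v1) = J (bottom v0 \<oplus>\<^bsub>L\<^esub> bottom v1)"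
  by (simp only: emb_def bottom_add[OF grade_M grade_M])

lemma \<gamma>_bottom_space:
  assumes "t \<in> bottom_space" shows "S.\<gamma> t \<in> bottom_space"
proof -
  obtain v where v: "v \<in> carrier M" "t = emb v" using bottom_space_cases[OF assms] by blast
  obtain v0 v1 where d: "v0 \<in> grade M 0" "v1 \<in> grade M 1" "v = v0 \<oplus>\<^bsub>M\<^esub> v1" using M_decomposition[OF v(1)] .
  have "S.\<gamma> t = emb v0 - emb v1"
    unfolding v(2) d(3) emb_sum[OF d(1,2)] unfolding emb_def
    by (rule S.\<gamma>_J[OF bottom_grade[OF d(1) grade_M[OF d(1)]] bottom_grade[OF d(2) grade_M[OF d(2)]]])
  then show ?thesis
    using S.subspace_diff[OF subspace_bottom_space emb_in_bottom_space[OF grade_M[OF d(1)]] emb_in_bottom_space[OF grade_M[OF d(2)]]] by simp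
qed

lemma simple_bottom_space:
  assumes K: "S.subspace K" "K \<subseteq> bottom_space" "\<And>a b v. (a, b) \<in> k_ix p q n \<Longrightarrow> v \<in> K \<Longrightarrow> S.E a b v \<in> K"
      "\<And>v. v \<in> K \<Longrightarrow> S.\<gamma> v \<in> K"
  shows "K = {0} \<or> K = bottom_space"
proof -
  define K' where "K' = {v \<in> carrier M. emb v \<in> K}"
  have "subsupermodule (k_ix p q n) M K'"
    unfolding subsupermodule_def
  proof (intro conjI)
    show "submodule K' CC M"
      by (rule M.submoduleI)
        (auto simp: K'_def emb_zero emb_minus emb_add emb_scale S.subspace_0[OF K(1)] S.subspace_neg[OF K(1)]
          S.subspace_add[OF K(1)] S.subspace_scale[OF K(1)])
    have "act M a b v \<in> K'" if ab: "(a, b) \<in> k_ix p q n" and v: "v \<in> K'" for a b v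
      using K(3)[OF ab, of "emb v"] v E_emb_k[OF ab, of v] act_M[OF ab, of v] by (simp add: K'_def)
    then show "\<forall>(a, b)\<in>k_ix p q n. \<forall>v\<in>K'. act M a b v \<in> K'" by blast
    show "\<forall>v\<in>K'. \<exists>v0\<in>K' \<inter> grade M 0. \<exists>v1\<in>K' \<inter> grade M 1. v = v0 \<oplus>\<^bsub>M\<^esub> v1"
    proof
      fix v assume v: "v \<in> K'"
      then have "v \<in> carrier M" by (simp add: K'_def)
      then obtain v0 v1 where d: "v0 \<in> grade M 0" "v1 \<in> grade M 1" "v = v0 \<oplus>\<^bsub>M\<^esub> v1"
        using M_decomposition by blast
      have c: "v0 \<in> carrier M" "v1 \<in> carrier M" using d grade_M by blast+
      have "J (bottom v0 \<oplus>\<^bsub>L\<^esub> bottom v1) \<in> K"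
        using v unfolding emb_sum[OF d(1,2), symmetric] d(3)[symmetric] by (simp add: K'_def)
      then have "emb v0 \<in> K" "emb v1 \<in> K"
        using S.graded_if_\<gamma>_stable[OF K(1,4) bottom_grade[OF d(1) c(1)] bottom_grade[OF d(2) c(2)]]
        unfolding emb_def by blast+
      then show "\<exists>v0\<in>K' \<inter> grade M 0. \<exists>v1\<in>K' \<inter> grade M 1. v = v0 \<oplus>\<^bsub>M\<^esub> v1"
        using c d by (intro bexI[of _ v0] bexI[of _ v1]) (simp_all add: K'_def)
    qed
  qed
  then have "K' = {\<zero>\<^bsub>M\<^esub>} \<or> K' = carrier M"
    using simple_bottom unfolding simple_supermodule_def by blast
  moreover have "K = emb ` K'" using K(2) by (auto simp: K'_def bottom_space_def)
  ultimately show ?thesis by (auto simp: emb_zero bottom_space_def)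
qed

lemma realization_is_simple_hw_module:
  assumes \<Lambda>: "\<Lambda> \<in> weights p q n" and v: "v \<in> carrier M" "v \<noteq> \<zero>\<^bsub>M\<^esub>"
    and weight: "\<And>a. a \<in> {1..p + q + n} \<Longrightarrow> act M a a v = \<Lambda> a \<odot>\<^bsub>M\<^esub> v"
    and high: "\<And>a b. (a, b) \<in> k_ix p q n \<Longrightarrow> a < b \<Longrightarrow> act M a b v = \<zero>\<^bsub>M\<^esub>"
  shows "simple_hw_module pscale p q n S.E S.\<gamma> S.space bottom_space \<Lambda> (emb v)"
proof (unfold_locales, goal_cases)
  case 1 show ?case by (rule S.\<gamma>_add)
next
  case 2 show ?case by (rule S.\<gamma>_scale)
next
  case 3 then show ?case by (rule S.\<gamma>_\<gamma>)
next
  case 4 then show ?case by (rule S.E_\<gamma>)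
next
  case 5 show ?case by (rule S.subspace_space)
next
  case 6 show ?case by (rule S.E_space)
next
  case 7 show ?case by (rule S.\<gamma>_space)
next
  case (8 K) then show ?case using S.simple_space[OF simple_L, of K] by blast
next
  case 9 show ?case by (rule subspace_bottom_space)
next
  case 10 show ?case by (rule bottom_space_subset)
next
  case (11 a b t)
  obtain w where w: "w \<in> carrier M" "t = emb w" using bottom_space_cases[OF 11(2)] by blast
  show ?case unfolding w(2) E_emb_k[OF 11(1) w(1)] by (rule emb_in_bottom_space[OF act_M[OF 11(1) w(1)]])
next
  case (12 a b t)
  obtain w where w: "w \<in> carrier M" "t = emb w" using bottom_space_cases[OF 12(2)] by blast
  show ?case unfolding w(2) by (rule E_emb_kplus[OF 12(1) w(1)])
next
  case 13 then show ?case by (rule \<gamma>_bottom_space)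
next
  case (14 K) then show ?case using simple_bottom_space[of K] by blast
next
  case 15 show ?case by (rule \<Lambda>)
next
  case 16 show ?case by (rule emb_in_bottom_space[OF v(1)])
next
  case 17 show ?case using emb_eq_0[OF v(1)] v(2) by simp
next
  case (18 a)
  then have "(a, a) \<in> k_ix p q n" by (auto simp: k_ix_def gl_ix_def)
  then show ?case by (simp only: E_emb_k[OF _ v(1)] weight[OF 18] emb_scale[OF v(1)])
next
  case (19 a b)
  then show ?case by (simp only: E_emb_k[OF _ v(1)] high emb_zero)
qed

lemma k_highest_weights_iff:
  "\<xi> \<in> k_highest_weights p q n L \<longleftrightarrow> \<xi> \<in> weights p q n \<and>
    (\<exists>u\<in>S.space. u \<noteq> 0 \<and> (\<forall>a\<in>{1..p + q + n}. S.E a a u = pscale (\<xi> a) u) \<and>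
      (\<forall>a b. (a, b) \<in> k_ix p q n \<longrightarrow> a < b \<longrightarrow> S.E a b u = 0))"
proof -
  have eq: "(x \<noteq> \<zero>\<^bsub>L\<^esub> \<and> (\<forall>a\<in>{1..p + q + n}. act L a a x = \<xi> a \<odot>\<^bsub>L\<^esub> x) \<and>
      (\<forall>(a, b)\<in>k_ix p q n. a < b \<longrightarrow> act L a b x = \<zero>\<^bsub>L\<^esub>)) \<longleftrightarrow>
    (J x \<noteq> 0 \<and> (\<forall>a\<in>{1..p + q + n}. S.E a a (J x) = pscale (\<xi> a) (J x)) \<and>
      (\<forall>a b. (a, b) \<in> k_ix p q n \<longrightarrow> a < b \<longrightarrow> S.E a b (J x) = 0))"
    if x: "x \<in> carrier L" for x
  proof -
    have "S.E a a (J x) = pscale (\<xi> a) (J x) \<longleftrightarrow> act L a a x = \<xi> a \<odot>\<^bsub>L\<^esub> x" if "a \<in> {1..p + q + n}" for a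
    proof -
      have gl: "(a, a) \<in> gl_ix p q n" using that by (simp add: gl_ix_def)
      have "\<xi> a \<odot>\<^bsub>L\<^esub> x \<in> carrier L" using x by (simp add: L.smult_closed)
      then show ?thesis
        unfolding S.E_J[OF gl x] S.J_scale[OF x, symmetric] using S.J_inj[OF S.act_carrier[OF gl x]] by blast
    qed
    moreover have "S.E a b (J x) = 0 \<longleftrightarrow> act L a b x = \<zero>\<^bsub>L\<^esub>" if "(a, b) \<in> k_ix p q n" for a b
      unfolding S.E_J[OF k_in_gl[OF that] x] using S.J_eq_0[OF S.act_carrier[OF k_in_gl[OF that] x]] .
    ultimately show ?thesis using S.J_eq_0[OF x] by auto
  qed
  show ?thesis
    unfolding k_highest_weights_def S.space_def mem_Collect_eq bex_simps(7)
    by (intro conj_cong refl bex_cong eq)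
qed

definition unitary_form :: "(((tensor set \<times> 'v) \<Rightarrow>\<^sub>0 complex) \<Rightarrow> ((tensor set \<times> 'v) \<Rightarrow>\<^sub>0 complex) \<Rightarrow> complex) \<Rightarrow> bool" where
  "unitary_form c \<longleftrightarrow> hermitian_form pscale S.space c \<and> (\<forall>u\<in>S.space. u \<noteq> 0 \<longrightarrow> 0 < c u u) \<and>
     (\<forall>a b. (a, b) \<in> gl_ix p q n \<longrightarrow> (\<forall>u\<in>S.space. \<forall>v\<in>S.space.
       c (S.E a b u) v = c u (if (a, b) \<in> k_ix p q n then S.E b a v else - S.E b a v)))"

lemma unitary_formI:
  assumes "hermitian_form pscale S.space c" and "\<And>u. u \<in> S.space \<Longrightarrow> u \<noteq> 0 \<Longrightarrow> 0 < c u u"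
    and "\<And>a b u v. (a, b) \<in> gl_ix p q n \<Longrightarrow> u \<in> S.space \<Longrightarrow> v \<in> S.space \<Longrightarrow>
      c (S.E a b u) v = c u (if (a, b) \<in> k_ix p q n then S.E b a v else - S.E b a v)"
  shows "unitary_form c"
  unfolding unitary_form_def by (intro conjI allI ballI impI assms)

lemma unitary_formD:
  assumes "unitary_form c"
  shows "hermitian_form pscale S.space c" and "u \<in> S.space \<Longrightarrow> u \<noteq> 0 \<Longrightarrow> 0 < c u u"
    and "(a, b) \<in> gl_ix p q n \<Longrightarrow> u \<in> S.space \<Longrightarrow> v \<in> S.space \<Longrightarrow>
      c (S.E a b u) v = c u (if (a, b) \<in> k_ix p q n then S.E b a v else - S.E b a v)"
proof -
  note h = assms[unfolded unitary_form_def]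
  show "hermitian_form pscale S.space c" by (rule h[THEN conjunct1])
  show "u \<in> S.space \<Longrightarrow> u \<noteq> 0 \<Longrightarrow> 0 < c u u"
    using h[THEN conjunct2, THEN conjunct1] by blast
  show "(a, b) \<in> gl_ix p q n \<Longrightarrow> u \<in> S.space \<Longrightarrow> v \<in> S.space \<Longrightarrow>
      c (S.E a b u) v = c u (if (a, b) \<in> k_ix p q n then S.E b a v else - S.E b a v)"
    using h[THEN conjunct2, THEN conjunct2] by blast
qed

text \<open>
  Forms on \<open>L\<close> and forms on its realization are pulled back along \<open>J\<close> and \<open>P\<close>.
\<close>

lemma unitary_iff: "unitary p q n L \<longleftrightarrow> (\<exists>c. unitary_form c)"
proof
  assume "unitary p q n L"
  then obtain H where H: "pos_def_hermitian_form L H"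
    and adj: "\<And>a b v w. (a, b) \<in> gl_ix p q n \<Longrightarrow> v \<in> carrier L \<Longrightarrow> w \<in> carrier L \<Longrightarrow>
          H (act L a b v) w = H v (if (a, b) \<in> k_ix p q n then act L b a w else \<ominus>\<^bsub>L\<^esub> act L b a w)"
    unfolding unitary_def by blast
  note add = pos_def_hermitian_formD(1)[OF H] and scl = pos_def_hermitian_formD(2)[OF H]
    and herm = pos_def_hermitian_formD(3)[OF H] and pos = pos_def_hermitian_formD(4)[OF H]
  define c where "c s t = H (P s) (P t)" for s t
  have "hermitian_form pscale S.space c"
  proof
    show "S.subspace S.space" by (rule S.subspace_space)
    show "c v u = cnj (c u v)" for u v unfolding c_def by (rule herm[OF S.P_carrier S.P_carrier])
  qed (simp_all add: c_def S.P_add S.P_scale S.P_carrier add scl)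
  moreover have "0 < c u u" if u: "u \<in> S.space" "u \<noteq> 0" for u
  proof -
    have "P u \<noteq> \<zero>\<^bsub>L\<^esub>" using S.J_P[OF u(1)] u(2) S.J_zero by metis
    then show ?thesis unfolding c_def by (rule pos[OF S.P_carrier])
  qed
  moreover have "c (S.E a b u) v = c u (if (a, b) \<in> k_ix p q n then S.E b a v else - S.E b a v)"
    if ab: "(a, b) \<in> gl_ix p q n" for a b u v
  proof -
    have ba: "(b, a) \<in> gl_ix p q n" using ab by (auto simp: gl_ix_def)
    have PE: "P (S.E a b u) = act L a b (P u)" "P (S.E b a v) = act L b a (P v)"
      using ab ba S.P_J S.act_carrier S.P_carrier by (simp_all add: S.E_def)
    have "P (- S.E b a v) = \<ominus>\<^bsub>L\<^esub> act L b a (P v)"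
      using S.P_J[OF L.M.a_inv_closed[OF S.act_carrier[OF ba S.P_carrier]], of v]
        S.J_minus[OF S.act_carrier[OF ba S.P_carrier], of v] ba by (simp add: S.E_def)
    then show ?thesis
      unfolding c_def PE using adj[OF ab S.P_carrier S.P_carrier, of u v] PE by auto
  qed
  ultimately have "unitary_form c" by (rule unitary_formI)
  then show "\<exists>c. unitary_form c" by blast
next
  assume "\<exists>c. unitary_form c"
  then obtain c where c: "unitary_form c" by blast
  interpret c: hermitian_form pscale S.space c by (rule unitary_formD(1)[OF c])
  note pos = unitary_formD(2)[OF c] and adj = unitary_formD(3)[OF c]
  define H where "H x y = c (J x) (J y)" for x y
  have "pos_def_hermitian_form L H"
    unfolding pos_def_hermitian_form_def
  proof (intro conjI ballI impI allI)
    fix u v w assume "u \<in> carrier L" "v \<in> carrier L" "w \<in> carrier L"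
    then show "H u (v \<oplus>\<^bsub>L\<^esub> w) = H u v + H u w" by (simp add: H_def S.J_add S.J_in_space c.form_add)
  next
    fix u v k assume "u \<in> carrier L" "v \<in> carrier L"
    then show "H u (k \<odot>\<^bsub>L\<^esub> v) = k * H u v" by (simp add: H_def S.J_scale S.J_in_space c.form_scale)
  next
    fix u v assume "u \<in> carrier L" "v \<in> carrier L"
    then show "H v u = cnj (H u v)" unfolding H_def by (intro c.form_herm S.J_in_space)
  next
    fix v assume v: "v \<in> carrier L" "v \<noteq> \<zero>\<^bsub>L\<^esub>"
    then have "J v \<noteq> 0" by (simp add: S.J_eq_0)
    then show "0 < H v v" unfolding H_def using pos[OF S.J_in_space[OF v(1)]] by blast
  qed
  moreover have "H (act L a b v) w = H v (if (a, b) \<in> k_ix p q n then act L b a w else \<ominus>\<^bsub>L\<^esub> act L b a w)"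
    if ab: "(a, b) \<in> gl_ix p q n" and vw: "v \<in> carrier L" "w \<in> carrier L" for a b v w
  proof -
    have ba: "(b, a) \<in> gl_ix p q n" using ab by (auto simp: gl_ix_def)
    show ?thesis
      using adj[OF ab S.J_in_space[OF vw(1)] S.J_in_space[OF vw(2)]]
      unfolding H_def S.E_J[OF ab vw(1)] S.E_J[OF ba vw(2)]
      by (auto simp: S.J_minus[OF S.act_carrier[OF ba vw(2)]])
  qed
  ultimately show "unitary p q n L" unfolding unitary_def by blast
qed

lemma bottom_form_exists:
  assumes unit: "type1_unitary p q n M" and real: "\<And>a. \<Lambda> a \<in> \<real>"
    and hw: "simple_hw_module pscale p q n S.E S.\<gamma> S.space bottom_space \<Lambda> vac"
  shows "\<exists>b. unitary_bottom pscale p q n S.E S.\<gamma> S.space bottom_space \<Lambda> vac b"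
proof -
  interpret H: simple_hw_module pscale p q n S.E S.\<gamma> S.space bottom_space \<Lambda> vac by (rule hw)
  from unit obtain H where H: "pos_def_hermitian_form M H"
    and adj: "\<And>a b v w. (a, b) \<in> k_ix p q n \<Longrightarrow> v \<in> carrier M \<Longrightarrow> w \<in> carrier M \<Longrightarrow>
      H (act M a b v) w = H v (act M b a w)"
    unfolding type1_unitary_def by blast
  note add = pos_def_hermitian_formD(1)[OF H] and scl = pos_def_hermitian_formD(2)[OF H]
    and herm = pos_def_hermitian_formD(3)[OF H] and pos = pos_def_hermitian_formD(4)[OF H]
  define i where "i = inv_into (carrier M) emb"
  have i_emb: "i (emb v) = v" if "v \<in> carrier M" for v
    unfolding i_def using inv_into_f_f[OF emb_inj that] .
  define b where "b s t = H (i s) (i t)" for s t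
  have b_emb: "b (emb v) (emb w) = H v w" if "v \<in> carrier M" "w \<in> carrier M" for v w
    using that by (simp add: b_def i_emb)
  have "hermitian_form pscale bottom_space b"
  proof
    show "S.subspace bottom_space" by (rule subspace_bottom_space)
    fix u v w k
    assume u: "u \<in> bottom_space" and v: "v \<in> bottom_space"
    obtain u' v' where uv: "u' \<in> carrier M" "u = emb u'" "v' \<in> carrier M" "v = emb v'"
      using bottom_space_cases[OF u] bottom_space_cases[OF v] by blast
    show "b v u = cnj (b u v)"
      unfolding uv(2,4) b_emb[OF uv(1,3)] b_emb[OF uv(3,1)] by (rule herm[OF uv(1,3)])
    have "k \<odot>\<^bsub>M\<^esub> v' \<in> carrier M" using uv by (simp add: M.smult_closed)
    then show "b u (pscale k v) = k * b u v"
      using b_emb[OF uv(1), of "k \<odot>\<^bsub>M\<^esub> v'"] scl uv by (simp add: b_emb emb_scale)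
    assume w: "w \<in> bottom_space"
    obtain w' where w': "w' \<in> carrier M" "w = emb w'" using bottom_space_cases[OF w] by blast
    show "b u (v + w) = b u v + b u w"
      using b_emb[OF uv(1) M.M.a_closed[OF uv(3) w'(1)]] add uv w' by (simp add: b_emb emb_add)
  qed
  moreover have "0 < b v v" if v: "v \<in> bottom_space" "v \<noteq> 0" for v
  proof -
    obtain v' where v': "v' \<in> carrier M" "v = emb v'" using bottom_space_cases[OF v(1)] by blast
    then have "v' \<noteq> \<zero>\<^bsub>M\<^esub>" using v(2) emb_zero by auto
    then show ?thesis using pos v' by (simp add: b_emb)
  qed
  moreover have "b (S.E a c u) v = b u (S.E c a v)" if ac: "(a, c) \<in> k_ix p q n" and uv: "u \<in> bottom_space" "v \<in> bottom_space" for a c u v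
  proof -
    have ca: "(c, a) \<in> k_ix p q n" using ac by (auto simp: k_ix_def gl_ix_def)
    obtain u' v' where uv': "u' \<in> carrier M" "u = emb u'" "v' \<in> carrier M" "v = emb v'"
      using bottom_space_cases[OF uv(1)] bottom_space_cases[OF uv(2)] by blast
    show ?thesis
      unfolding uv'(2,4) E_emb_k[OF ac uv'(1)] E_emb_k[OF ca uv'(3)]
        b_emb[OF act_M[OF ac uv'(1)] uv'(3)] b_emb[OF uv'(1) act_M[OF ca uv'(3)]]
      by (rule adj[OF ac uv'(1,3)])
  qed
  ultimately have "unitary_bottom pscale p q n S.E S.\<gamma> S.space bottom_space \<Lambda> vac b"
    using hw real by (simp add: unitary_bottom_def unitary_bottom_axioms_def)
  then show ?thesis by blast
qed

end

section \<open>The criterion for unitarity\<close>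

theorem proposition6p3:
  fixes p q n :: nat and \<Lambda> :: "nat \<Rightarrow> complex" and L0 :: "'v glmod"
    and N :: "((tensor set \<times> 'v) \<Rightarrow>\<^sub>0 complex) set set"
    and L :: "((tensor set \<times> 'v) \<Rightarrow>\<^sub>0 complex) set set glmod"
  assumes "p > 0" and "q > 0" and "n > 0"
    and "\<Lambda> \<in> D_plus p q n"
    and "simple_supermodule p q (k_ix p q n) L0" and "\<Lambda> \<in> k_highest_weights p q n L0"
    and "type1_unitary p q n L0"
    and "subsupermodule (gl_ix p q n) (induced p q n L0) N"
    and "L = quot (induced p q n L0) N" and "simple_supermodule p q (gl_ix p q n) L"
  shows "unitary p q n L \<longleftrightarrow>
    (\<forall>\<xi> \<in> k_highest_weights p q n L.
       bil p q n (\<lambda>a. \<Lambda> a - \<xi> a) (\<lambda>a. \<Lambda> a + \<xi> a + 2 * rho p q n a) \<le> 0)"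
proof -
  note M = simple_supermodule_is_supermodule[OF assms(5)]
  note super = simple_supermodule_is_supermodule[OF assms(10)]
  interpret IQ: induced_quotient p q n L0 N L
    by (rule induced_quotient.intro[OF M assms(8,9)])
  interpret T: complex_space "pscale :: complex \<Rightarrow> ((tensor set \<times> 'v) \<Rightarrow>\<^sub>0 complex) \<Rightarrow> _"
    by (rule complex_space.intro[OF vector_space_pscale])
  have sub: "T.subspace (carrier IQ.F)"
    using IQ.F.M.zero_closed IQ.F.M.a_closed IQ.F.smult_closed
    by (intro T.subspaceI) (simp_all only: free_mod_simps CC_simps UNIV_I)
  have "\<exists>(J :: _ \<Rightarrow> (tensor set \<times> 'v) \<Rightarrow>\<^sub>0 complex) P. supermodule_in_type pscale p q n L J P"
    by (rule T.supermodule_in_type_exists[OF super sub IQ.carrier_L IQ.cl_add IQ.cl_smult])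
  then obtain J :: "_ \<Rightarrow> (tensor set \<times> 'v) \<Rightarrow>\<^sub>0 complex" and P
    where "supermodule_in_type pscale p q n L J P" by blast
  then interpret R: realized_quotient p q n L0 N L J P
    by (intro realized_quotient.intro realized_quotient_axioms.intro IQ.induced_quotient_axioms assms(5,10))
  from assms(6) obtain v where v: "v \<in> carrier L0" "v \<noteq> \<zero>\<^bsub>L0\<^esub>"
    "\<And>a. a \<in> {1..p + q + n} \<Longrightarrow> act L0 a a v = \<Lambda> a \<odot>\<^bsub>L0\<^esub> v"
    "\<And>a b. (a, b) \<in> k_ix p q n \<Longrightarrow> a < b \<Longrightarrow> act L0 a b v = \<zero>\<^bsub>L0\<^esub>"
    unfolding k_highest_weights_def by blast
  have \<Lambda>: "\<Lambda> \<in> weights p q n" "\<And>a. \<Lambda> a \<in> \<real>" using assms(4) by (auto simp: D_plus_def)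
  note hw = R.realization_is_simple_hw_module[OF \<Lambda>(1) v]
  interpret H: simple_hw_module pscale p q n R.S.E R.S.\<gamma> R.S.space R.bottom_space \<Lambda> "R.emb v" by (rule hw)
  have weights: "\<xi> \<in> k_highest_weights p q n L \<longleftrightarrow> \<xi> \<in> weights p q n \<and>
    (\<exists>u\<in>H.wt_space \<xi>. u \<noteq> 0 \<and> (\<forall>a b. (a, b) \<in> k_ix p q n \<longrightarrow> a < b \<longrightarrow> R.S.E a b u = 0))" for \<xi>
    unfolding R.k_highest_weights_iff H.wt_space_def by blast
  show ?thesis
  proof
    assume "unitary p q n L"
    then obtain c where c: "R.unitary_form c" unfolding R.unitary_iff by blast
    interpret c: hermitian_form pscale R.S.space c by (rule R.unitary_formD(1)[OF c])
    note adj = R.unitary_formD(3)[OF c]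
    have adj': "c (R.S.E a b u) v = - c u (R.S.E b a v)"
      if ab: "(a, b) \<in> kplus_ix p q n" and uv: "u \<in> R.S.space" "v \<in> R.S.space" for a b u v
    proof -
      have "(a, b) \<in> gl_ix p q n" "(a, b) \<notin> k_ix p q n" using ab by (auto simp: kplus_ix_def k_ix_def)
      then show ?thesis using adj[OF _ uv, of a b] c.form_minus(1)[OF uv(1) R.S.E_space] by simp
    qed
    show "\<forall>\<xi> \<in> k_highest_weights p q n L.
       bil p q n (\<lambda>a. \<Lambda> a - \<xi> a) (\<lambda>a. \<Lambda> a + \<xi> a + 2 * rho p q n a) \<le> 0"
    proof
      fix \<xi> assume "\<xi> \<in> k_highest_weights p q n L"
      then obtain u where "u \<in> H.wt_space \<xi>" "u \<noteq> 0"
        "\<And>a b. (a, b) \<in> k_ix p q n \<Longrightarrow> a < b \<Longrightarrow> R.S.E a b u = 0"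
        unfolding weights by blast
      from R.unitary_formD(1)[OF c] R.unitary_formD(2)[OF c] adj' this
      show "bil p q n (\<lambda>a. \<Lambda> a - \<xi> a) (\<lambda>a. \<Lambda> a + \<xi> a + 2 * rho p q n a) \<le> 0"
        by (rule H.bil_nonpos_if_unitary)
    qed
  next
    assume bound: "\<forall>\<xi> \<in> k_highest_weights p q n L.
       bil p q n (\<lambda>a. \<Lambda> a - \<xi> a) (\<lambda>a. \<Lambda> a + \<xi> a + 2 * rho p q n a) \<le> 0"
    obtain b where "unitary_bottom pscale p q n R.S.E R.S.\<gamma> R.S.space R.bottom_space \<Lambda> (R.emb v) b"
      using R.bottom_form_exists[OF assms(7) \<Lambda>(2) hw] by blast
    then interpret Ub: unitary_bottom pscale p q n R.S.E R.S.\<gamma> R.S.space R.bottom_space \<Lambda> "R.emb v" b .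
    have "0 < Ub.form u u" if "u \<in> R.S.space" "u \<noteq> 0" for u
    proof (rule Ub.form_pos[OF _ that])
      fix \<xi> u assume "\<xi> \<in> weights p q n" "u \<in> H.wt_space \<xi>" "u \<noteq> 0"
        and "\<And>a b. (a, b) \<in> k_ix p q n \<Longrightarrow> a < b \<Longrightarrow> R.S.E a b u = 0"
      then have "\<xi> \<in> k_highest_weights p q n L" unfolding weights by blast
      then show "bil p q n (\<lambda>a. \<Lambda> a - \<xi> a) (\<lambda>a. \<Lambda> a + \<xi> a + 2 * rho p q n a) \<le> 0"
        using bound by blast
    qed
    moreover have "Ub.form (R.S.E a b u) v = Ub.form u (if (a, b) \<in> k_ix p q n then R.S.E b a v else - R.S.E b a v)"
      if "(a, b) \<in> gl_ix p q n" "u \<in> R.S.space" "v \<in> R.S.space" for a b u v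
      using Ub.form_k[of a b u v] Ub.form_non_k[of a b u v] that R.S.E_space by simp
    ultimately have "R.unitary_form Ub.form" by (rule R.unitary_formI[OF Ub.F.hermitian_form_axioms])
    then show "unitary p q n L" unfolding R.unitary_iff by blast
  qed
qed

end
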